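(* Let $\Phi$ be an arbitrary irreducible reduced root system and $\omega=\omega_j\in\Omega$ with $j\in J$. Then $\Delta^\omega=\{\bar\alpha_1^\omega,\dots,\bar\alpha_r^\omega\}$ is a basis of the root system $\Phi_{\mathrm{re}}^\omega$ in $E^\omega$. Furthermore, the lattice generated by $\{\bar\pi_1^\omega,\dots,\bar\pi_r^\omega\}$ is the coweight lattice $\{x\in E^\omega : (\gamma,x)\in\mathbb{Z}\text{ for all }\gamma\in\Phi_{\mathrm{re}}^\omega\}$ of $\Phi_{\mathrm{re}}^\omega$.
   Context: Root systems are finite, not containing $0$, spanning the ambient Euclidean space, stable under reflections and with integral Cartan numbers, but not necessarily reduced; the empty set is a root system in $\{0\}$. A basis of a root system is a vector space basis of the ambient space consisting of indivisible roots ($\alpha$ is indivisible if $\frac12\alpha$ is not a root) such that every root is an integer combination of it with all coefficients non-negative or all non-positive. Setting: $\Phi$ is an irreducible reduced root system in a Euclidean space $E$ with inner product $(\cdot,\cdot)$, basis $\Delta=\{\alpha_1,\dots,\alpha_\ell\}$, Weyl group $W$ and highest root $\tilde\alpha=\sum_{i=1}^\ell n_i\alpha_i$. Put $\alpha_0=-\tilde\alpha$, $n_0=1$, $I=\{0,\dots,\ell\}$, $J=\{i\in I:n_i=1\}$. For $j\in J$ let $w_j$ be the longest element of the subgroup of $W$ generated by the reflections $s_{\alpha_i}$, $i\in\{1,\dots,\ell\}\setminus\{j\}$ (so $w_0$ is the longest element of $W$), and $\omega_j=w_jw_0$. Then $\Omega=\{\omega_j:j\in J\}$ is a subgroup of $W$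 permuting $\{\alpha_0,\dots,\alpha_\ell\}$; let $\sigma_j$ be the permutation of $I$ with $\omega_j(\alpha_i)=\alpha_{\sigma_j(i)}$; one has $\sigma_j(0)=j$ and $n_{\sigma_j(i)}=n_i$. For $\omega=\omega_j$ of order $o(\omega)$ and $x\in E$ put $x^\omega=\frac1{o(\omega)}\sum_{t=1}^{o(\omega)}\omega^t(x)$, $E^\omega=\{x\in E:\omega(x)=x\}$ and $\Phi_{\mathrm{re}}^\omega=\{\beta^\omega:\beta\in\Phi,\ \beta^\omega\ne0\}$. Let $S_0^j,\dots,S_r^j$ be the $\langle\sigma_j\rangle$-orbits on $I$, with $0\in S_0^j$. Put $\bar\alpha_k^\omega=\frac{1}{\#S_k^j}\sum_{s\in S_k^j}\alpha_s$ (which equals $\alpha_s^\omega$ for any $s\in S_k^j$). Let $\bar n_k=n_s$ for $s\in S_k^j$ and $m_k=\#S_k^j\,\bar n_k/\#S_0^j$. Let $\varpi_1^\vee,\dots,\varpi_\ell^\vee\in E$ be the dual basis of $\Delta$, i.e. $(\alpha_i,\varpi_{i'}^\vee)=\delta_{ii'}$, and $\varpi_0^\vee=0$. Put $\pi_k^j=\sum_{s\in S_k^j}\varpi_s^\vee$ for $0\le k\le r$ and $\bar\pi_k^\omega=(\pi_k^j)^\omega=\pi_k^j-m_k\pi_0^j$ for $1\le k\le r$. *)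

theory Defs
  imports
    "HOL-Analysis.Analysis"
    "HOL-Combinatorics.Orbits"
    "HOL-Computational_Algebra.Group_Closure"
begin

section \<open>Root systems\<close>

definition reflection :: "'a::real_inner \<Rightarrow> 'a \<Rightarrow> 'a" where
  "reflection a x = x - (2 * (a \<bullet> x) / (a \<bullet> a)) *\<^sub>R a"

text \<open>Root systems live in a subspace \<open>V\<close> of the ambient Euclidean space and need not be
  reduced; the empty set is a root system in \<open>{0}\<close>.\<close>

definition root_system :: "'a::euclidean_space set \<Rightarrow> 'a set \<Rightarrow> bool" where
  "root_system V \<Phi> \<longleftrightarrow>
     subspace V \<and> finite \<Phi> \<and> 0 \<notin> \<Phi> \<and> span \<Phi> = V \<and>
     (\<forall>a\<in>\<Phi>. reflection a ` \<Phi> \<subseteq> \<Phi>) \<and>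
     (\<forall>a\<in>\<Phi>. \<forall>b\<in>\<Phi>. 2 * (a \<bullet> b) / (b \<bullet> b) \<in> \<int>)"

definition reduced_roots :: "'a::euclidean_space set \<Rightarrow> bool" where
  "reduced_roots \<Phi> \<longleftrightarrow> (\<forall>a\<in>\<Phi>. \<forall>c::real. c *\<^sub>R a \<in> \<Phi> \<longrightarrow> c = 1 \<or> c = -1)"

definition irreducible_roots :: "'a::euclidean_space set \<Rightarrow> bool" where
  "irreducible_roots \<Phi> \<longleftrightarrow>
     \<Phi> \<noteq> {} \<and>
     \<not> (\<exists>A B. A \<noteq> {} \<and> B \<noteq> {} \<and> A \<inter> B = {} \<and> A \<union> B = \<Phi> \<and> (\<forall>a\<in>A. \<forall>b\<in>B. a \<bullet> b = 0))"

definition indivisible :: "'a::euclidean_space set \<Rightarrow> 'a \<Rightarrow> bool" where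
  "indivisible \<Phi> a \<longleftrightarrow> a \<in> \<Phi> \<and> (1/2) *\<^sub>R a \<notin> \<Phi>"

definition root_basis :: "'a::euclidean_space set \<Rightarrow> 'a set \<Rightarrow> 'a set \<Rightarrow> bool" where
  "root_basis V \<Phi> B \<longleftrightarrow>
     independent B \<and> span B = V \<and> (\<forall>b\<in>B. indivisible \<Phi> b) \<and>
     (\<forall>a\<in>\<Phi>. \<exists>c :: 'a \<Rightarrow> int. a = (\<Sum>b\<in>B. of_int (c b) *\<^sub>R b) \<and>
        ((\<forall>b\<in>B. c b \<ge> 0) \<or> (\<forall>b\<in>B. c b \<le> 0)))"

definition highest_root :: "'a::euclidean_space set \<Rightarrow> 'a set \<Rightarrow> 'a \<Rightarrow> bool" where
  "highest_root \<Phi> B h \<longleftrightarrow>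
     h \<in> \<Phi> \<and> (\<forall>a\<in>\<Phi>. \<exists>c :: 'a \<Rightarrow> nat. h - a = (\<Sum>b\<in>B. of_nat (c b) *\<^sub>R b))"

definition coweight_lattice :: "'a::euclidean_space set \<Rightarrow> 'a set \<Rightarrow> 'a set" where
  "coweight_lattice V \<Phi> = {x \<in> V. \<forall>a\<in>\<Phi>. a \<bullet> x \<in> \<int>}"


section \<open>Longest elements\<close>

inductive_set reflection_group :: "'a::euclidean_space set \<Rightarrow> ('a \<Rightarrow> 'a) set" for A where
  one: "id \<in> reflection_group A"
| gen: "a \<in> A \<Longrightarrow> reflection a \<in> reflection_group A"
| mult: "v \<in> reflection_group A \<Longrightarrow> w \<in> reflection_group A \<Longrightarrow> v \<circ> w \<in> reflection_group A"
| inv: "w \<in> reflection_group A \<Longrightarrow> inv w \<in> reflection_group A"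

definition reflection_word :: "'a::euclidean_space list \<Rightarrow> 'a \<Rightarrow> 'a" where
  "reflection_word as = foldr (\<lambda>a w. reflection a \<circ> w) as id"

definition word_length :: "'a::euclidean_space set \<Rightarrow> ('a \<Rightarrow> 'a) \<Rightarrow> nat" where
  "word_length A w = (LEAST k. \<exists>as. set as \<subseteq> A \<and> length as = k \<and> reflection_word as = w)"

text \<open>When \<open>A\<close> is a set of simple roots, the element of maximal length is unique.\<close>

definition longest_element :: "'a::euclidean_space set \<Rightarrow> 'a \<Rightarrow> 'a" where
  "longest_element A = (ARG_MAX (word_length A) w. w \<in> reflection_group A)"


section \<open>The elements \<open>\<omega>\<^sub>j\<close> and their action on the extended simple roots\<close>

text \<open>Throughout, \<open>\<alpha> 1, \<dots>, \<alpha> l\<close> are the simple roots and \<open>\<alpha> 0\<close> is the negative of the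
  highest root.\<close>

definition w_elt :: "nat \<Rightarrow> (nat \<Rightarrow> 'a::euclidean_space) \<Rightarrow> nat \<Rightarrow> 'a \<Rightarrow> 'a" where
  "w_elt l \<alpha> j = longest_element (\<alpha> ` ({1..l} - {j}))"

definition omega :: "nat \<Rightarrow> (nat \<Rightarrow> 'a::euclidean_space) \<Rightarrow> nat \<Rightarrow> 'a \<Rightarrow> 'a" where
  "omega l \<alpha> j = w_elt l \<alpha> j \<circ> w_elt l \<alpha> 0"

text \<open>The permutation \<open>\<sigma>\<^sub>j\<close> of \<open>{0..l}\<close>, extended by the identity.\<close>

definition sigma :: "nat \<Rightarrow> (nat \<Rightarrow> 'a::euclidean_space) \<Rightarrow> nat \<Rightarrow> nat \<Rightarrow> nat" where
  "sigma l \<alpha> j i =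
     (if i \<in> {0..l} then (THE k. k \<in> {0..l} \<and> omega l \<alpha> j (\<alpha> i) = \<alpha> k) else i)"

text \<open>\<open>orbit f i\<close> consists of the \<open>(f ^^ t) i\<close> with \<open>t > 0\<close>; for a permutation of a finite set
  this is the orbit of \<open>i\<close> under the cyclic group generated by \<open>f\<close>.\<close>

definition sigma_orbits :: "nat \<Rightarrow> (nat \<Rightarrow> 'a::euclidean_space) \<Rightarrow> nat \<Rightarrow> nat set set" where
  "sigma_orbits l \<alpha> j = orbit (sigma l \<alpha> j) ` {0..l}"


section \<open>Averages over a cyclic group\<close>

definition map_order :: "('a \<Rightarrow> 'a) \<Rightarrow> nat" where
  "map_order f = (LEAST t. 0 < t \<and> f ^^ t = id)"

definition avg :: "('a::euclidean_space \<Rightarrow> 'a) \<Rightarrow> 'a \<Rightarrow> 'a" where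
  "avg f x = (1 / of_nat (map_order f)) *\<^sub>R (\<Sum>t=1..map_order f. (f ^^ t) x)"

definition fixed_space :: "('a \<Rightarrow> 'a) \<Rightarrow> 'a set" where
  "fixed_space f = {x. f x = x}"

definition restricted_roots :: "('a::euclidean_space \<Rightarrow> 'a) \<Rightarrow> 'a set \<Rightarrow> 'a set" where
  "restricted_roots f \<Phi> = {avg f b | b. b \<in> \<Phi> \<and> avg f b \<noteq> 0}"

definition orbit_root :: "(nat \<Rightarrow> 'a::euclidean_space) \<Rightarrow> nat set \<Rightarrow> 'a" where
  "orbit_root \<alpha> S = (1 / of_nat (card S)) *\<^sub>R (\<Sum>s\<in>S. \<alpha> s)"

definition orbit_coweight ::
  "('a::euclidean_space \<Rightarrow> 'a) \<Rightarrow> (nat \<Rightarrow> 'a) \<Rightarrow> nat set \<Rightarrow> 'a" where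
  "orbit_coweight f cw S = avg f (\<Sum>s\<in>S. cw s)"

end

theory Submission
  imports Defs
begin

text \<open>
  Averaging over \<open>\<omega>\<close> is the orthogonal projection \<open>P\<close> onto the fixed space, so \<open>P (\<alpha> i)\<close> depends only on
  the \<open>\<sigma>\<close>-orbit of \<open>i\<close>.  If \<open>P (\<alpha> i) \<noteq> 0\<close>, the simple affine roots in the orbit of \<open>i\<close> form a
  diagram of type \<open>A\<^sub>1\<^sup>m\<close> or \<open>A\<^sub>2\<^sup>m\<close>, and the product of the reflections in the highest roots of its components
  induces the reflection in \<open>P (\<alpha> i)\<close> on the fixed space.  Sign coherence of affine roots and induction on the height
  reduce every restricted root by such reflections to a multiple of some \<open>P (\<alpha> i)\<close>, which gives
  the root system axioms.

  Coherence of signs with respect to the orbits other than that of \<open>0\<close> follows once the reflection in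
  \<open>P (\<alpha> 0)\<close> is known to be a product of the reflections in the other \<open>P (\<alpha> i)\<close>.  For this it is enough to
  find a root without components in the orbit of \<open>0\<close> whose average is a nonzero multiple of \<open>P (\<alpha> 0)\<close>, and such a
  root exists because \<open>\<omega>\<close> lies in the Weyl group of the roots averaging to \<open>0\<close> (Steinberg).  Integrality of the
  coefficients holds because the Weyl group acts trivially on coweights modulo coroots and because no nonzero
  minuscule coweight is a sum of coroots.
\<close>

section \<open>Reflections\<close>

text \<open>Ordinary folding starts from a symmetry of the simple roots. Here
  \<open>\<omega>\<close> may send a simple root to \<open>\<alpha> 0\<close>, so it does not
  respect positivity; passing to affine roots puts all nodes \<open>0, \<dots>, l\<close> on the
  same footing. The price is that the averages over all orbits satisfy a linear relation, so the
  orbit of 0 has to be dropped, and coherence of affine signs says nothing about the coefficients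
  left after \<open>P (\<alpha> 0)\<close> has been eliminated. Hence the detour through roots
  without components in that orbit. The detour determines a restricted root only up to a scalar,
  which is harmless for signs but not for integrality. That is why integrality needs its own
  argument: eliminating \<open>P (\<alpha> 0)\<close> introduces the quotients m_k, whose
  integrality is a divisibility property of marks.\<close>

lemma reflection_0 [simp]: "reflection 0 x = x"
  by (simp add: reflection_def)

lemma reflection_self: "reflection a a = - a"
  by (cases "a = 0") (simp_all add: reflection_def scaleR_2)

lemma reflection_scaleR:
  assumes "t \<noteq> 0" shows "reflection (t *\<^sub>R a) = reflection a"
  using assms by (auto simp: reflection_def fun_eq_iff)

lemma linear_reflection: "linear (reflection a)"
  by (rule linearI) (simp_all add: reflection_def inner_add_right algebra_simps add_divide_distrib)

lemma reflection_inner: "reflection a x \<bullet> reflection a y = x \<bullet> y"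
  by (cases "a = 0") (simp_all add: reflection_def inner_diff_left inner_diff_right inner_commute field_simps)

lemma reflection_reflection [simp]: "reflection a (reflection a x) = x"
  by (cases "a = 0") (simp_all add: reflection_def inner_diff_right algebra_simps)

lemma orthogonal_transformation_reflection: "orthogonal_transformation (reflection a)"
  by (simp add: orthogonal_transformation_def linear_reflection reflection_inner)

lemma reflection_conjugate:
  assumes "orthogonal_transformation w"
  shows "reflection (w a) (w x) = w (reflection a x)"
  using assms by (simp add: reflection_def orthogonal_transformation_def linear_diff linear_scale)

lemma reflection_orthogonal: "a \<bullet> x = 0 \<Longrightarrow> reflection a x = x"
  by (simp add: reflection_def)

lemma reflection_eq: "reflection a x = x - (2 * (x \<bullet> a) / (a \<bullet> a)) *\<^sub>R a"
  by (simp add: reflection_def inner_commute)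

lemma reflection_word_Nil [simp]: "reflection_word [] = id"
  by (simp add: reflection_word_def)

lemma reflection_word_Cons [simp]: "reflection_word (a # as) = reflection a \<circ> reflection_word as"
  by (simp add: reflection_word_def)

lemma reflection_word_append: "reflection_word (as @ bs) = reflection_word as \<circ> reflection_word bs"
  by (induction as) (simp_all add: comp_assoc)

lemma reflection_word_rev: "reflection_word (rev as) \<circ> reflection_word as = id"
  by (induction as) (simp_all add: reflection_word_append fun_eq_iff)

lemma orthogonal_transformation_reflection_word: "orthogonal_transformation (reflection_word as)"
proof (induction as)
  case (Cons a as)
  then show ?case
    using orthogonal_transformation_compose [OF orthogonal_transformation_reflection [of a]] by (simp add: o_def)
qed (simp add: id_def)

lemma reflection_group_conv_word: "w \<in> reflection_group A \<longleftrightarrow> (\<exists>as. set as \<subseteq> A \<and> w = reflection_word as)"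
proof
  show "\<exists>as. set as \<subseteq> A \<and> w = reflection_word as" if "w \<in> reflection_group A"
    using that
  proof induction
    case one
    show ?case by (rule exI [of _ "[]"]) simp
  next
    case (gen a)
    then show ?case by (intro exI [of _ "[a]"]) simp
  next
    case (mult v w)
    then obtain as bs where "set as \<subseteq> A" "v = reflection_word as" "set bs \<subseteq> A" "w = reflection_word bs"
      by blast
    then show ?case by (intro exI [of _ "as @ bs"]) (simp add: reflection_word_append)
  next
    case (inv w)
    then obtain as where "set as \<subseteq> A" "w = reflection_word as" by blast
    moreover have "reflection_word as \<circ> reflection_word (rev as) = id"
      using reflection_word_rev [of "rev as"] by simp
    ultimately have "inv w = reflection_word (rev as)"
      using reflection_word_rev [of as] inv_unique_comp by metis
    then show ?case using \<open>set as \<subseteq> A\<close> by (intro exI [of _ "rev as"]) simp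
  qed
  assume "\<exists>as. set as \<subseteq> A \<and> w = reflection_word as"
  then obtain as where "set as \<subseteq> A" "w = reflection_word as" by blast
  then show "w \<in> reflection_group A"
    by (induction as arbitrary: w) (auto intro!: reflection_group.intros)
qed

lemma reflection_group_orthogonal:
  "w \<in> reflection_group A \<Longrightarrow> orthogonal_transformation w"
  by (auto simp: reflection_group_conv_word orthogonal_transformation_reflection_word)

text \<open>Reflections are involutions, so products of generators already include all inverses and
  one step case suffices.\<close>

lemma reflection_group_induct [consumes 1, case_names id reflection]:
  assumes "w \<in> reflection_group A" and "P id"
    and "\<And>a w. a \<in> A \<Longrightarrow> w \<in> reflection_group A \<Longrightarrow> P w \<Longrightarrow> P (reflection a \<circ> w)"
  shows "P w"
proof -
  obtain as where "set as \<subseteq> A" "w = reflection_word as"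
    using assms(1) reflection_group_conv_word by blast
  then show ?thesis
  proof (induction as arbitrary: w)
    case (Cons a as)
    have "reflection_word as \<in> reflection_group A"
      using Cons.prems by (auto simp: reflection_group_conv_word)
    then have "P (reflection a \<circ> reflection_word as)"
      using Cons by (intro assms(3)) simp_all
    then show ?case using Cons.prems by (simp add: o_def)
  qed (simp add: assms(2))
qed

lemma reflection_group_mono:
  assumes "A \<subseteq> B" shows "reflection_group A \<subseteq> reflection_group B"
proof
  fix w assume "w \<in> reflection_group A"
  then show "w \<in> reflection_group B"
    by induction (use assms in \<open>blast intro: reflection_group.intros\<close>)+
qed

lemma word_length_le:
  "set as \<subseteq> A \<Longrightarrow> word_length A (reflection_word as) \<le> length as"
  unfolding word_length_def by (rule Least_le) blast

lemma word_length_witness: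
  assumes "w \<in> reflection_group A"
  obtains as where "set as \<subseteq> A" "length as = word_length A w" "reflection_word as = w"
proof -
  obtain bs where "set bs \<subseteq> A" "reflection_word bs = w"
    using assms by (auto simp: reflection_group_conv_word)
  then have "\<exists>k as. set as \<subseteq> A \<and> length as = k \<and> reflection_word as = w" by blast
  from LeastI_ex [OF this] obtain as where "set as \<subseteq> A" "length as = word_length A w" "reflection_word as = w"
    by (auto simp: word_length_def)
  then show thesis by (rule that)
qed

lemma orthogonal_transformation_inner: "orthogonal_transformation f \<Longrightarrow> f x \<bullet> f y = x \<bullet> y"
  by (simp add: orthogonal_transformation_def)

lemma group_closure_scaleR_int:
  fixes x :: "'b::real_vector"
  assumes "x \<in> group_closure S" shows "of_int z *\<^sub>R x \<in> group_closure S"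
proof -
  have nat: "of_nat k *\<^sub>R x \<in> group_closure S" for k
    by (induction k) (simp_all add: scaleR_add_left group_closure_add assms)
  show ?thesis
  proof (cases "z \<ge> 0")
    case True
    then show ?thesis using nat [of "nat z"] by simp
  next
    case False
    then have "of_int z *\<^sub>R x = - (of_nat (nat (- z)) *\<^sub>R x)" by simp
    then show ?thesis using nat [of "nat (- z)"] by (simp only: group_closure_minus_iff)
  qed
qed

lemma group_closure_sum_mem:
  fixes f :: "'c \<Rightarrow> 'b::real_vector"
  shows "(\<And>i. i \<in> I \<Longrightarrow> f i \<in> group_closure S) \<Longrightarrow> (\<Sum>i\<in>I. f i) \<in> group_closure S"
  by (induction I rule: infinite_finite_induct) (simp_all add: group_closure_add)

section \<open>Based root systems with a highest root\<close>

locale based_root_system =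
  fixes \<Phi> :: "'a::euclidean_space set"
    and \<alpha> cw :: "nat \<Rightarrow> 'a"
    and h :: 'a
    and n :: "nat \<Rightarrow> int"
    and l :: nat
  assumes root_system: "root_system UNIV \<Phi>" and reduced: "reduced_roots \<Phi>"
    and inj_simple: "inj_on \<alpha> {1..l}" and root_basis: "root_basis UNIV \<Phi> (\<alpha> ` {1..l})"
    and highest: "highest_root \<Phi> (\<alpha> ` {1..l}) h" and h_eq: "h = (\<Sum>i=1..l. of_int (n i) *\<^sub>R \<alpha> i)"
    and alpha_0: "\<alpha> 0 = - h" and n_0: "n 0 = 1"
    and dual: "\<And>i k. i \<in> {1..l} \<Longrightarrow> k \<in> {1..l} \<Longrightarrow> \<alpha> i \<bullet> cw k = (if i = k then 1 else 0)"
    and cw_0: "cw 0 = 0"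
begin

lemma finite_roots: "finite \<Phi>"
  and zero_notin: "0 \<notin> \<Phi>"
  and span_roots: "span \<Phi> = UNIV"
  using root_system by (auto simp: root_system_def)

lemma reflection_root: "a \<in> \<Phi> \<Longrightarrow> b \<in> \<Phi> \<Longrightarrow> reflection a b \<in> \<Phi>"
  using root_system by (auto simp: root_system_def)

lemma cartan_int: "a \<in> \<Phi> \<Longrightarrow> b \<in> \<Phi> \<Longrightarrow> 2 * (a \<bullet> b) / (b \<bullet> b) \<in> \<int>"
  using root_system by (auto simp: root_system_def)

lemma uminus_root: "a \<in> \<Phi> \<Longrightarrow> - a \<in> \<Phi>"
  using reflection_root [of a a] by (simp add: reflection_self)

lemma multiple_root: "a \<in> \<Phi> \<Longrightarrow> c *\<^sub>R a \<in> \<Phi> \<Longrightarrow> c = 1 \<or> c = -1"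
  using reduced by (auto simp: reduced_roots_def)

text \<open>Pairing with \<open>cw i\<close> reads off the coordinate at \<open>\<alpha> i\<close>.
  Later statements about coefficients use these linear expressions instead of the existentially
  quantified functions in \<open>root_basis\<close>.\<close>

lemma expansion: "x = (\<Sum>i=1..l. (x \<bullet> cw i) *\<^sub>R \<alpha> i)"
proof -
  have "x \<in> span (\<alpha> ` {1..l})" using root_basis by (simp add: root_basis_def)
  then show ?thesis
  proof (induction rule: span_induct_alt)
    case (step c b y)
    then obtain k where k: "k \<in> {1..l}" "b = \<alpha> k" by blast
    have "(\<Sum>i=1..l. (b \<bullet> cw i) *\<^sub>R \<alpha> i) = (\<Sum>i=1..l. if i = k then \<alpha> i else 0)"
      using k by (intro sum.cong) (auto simp: dual)
    then have "(\<Sum>i=1..l. (b \<bullet> cw i) *\<^sub>R \<alpha> i) = b" using k by simp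
    then have "c *\<^sub>R b + y = c *\<^sub>R (\<Sum>i=1..l. (b \<bullet> cw i) *\<^sub>R \<alpha> i) + (\<Sum>i=1..l. (y \<bullet> cw i) *\<^sub>R \<alpha> i)"
      using step.IH by simp
    also have "\<dots> = (\<Sum>i=1..l. ((c *\<^sub>R b + y) \<bullet> cw i) *\<^sub>R \<alpha> i)"
      by (simp add: inner_add_left scaleR_add_left sum.distrib scaleR_sum_right)
    finally show ?case .
  qed simp
qed

lemma simple_combination_coeff:
  assumes "T \<subseteq> {1..l}" "k \<in> {1..l}"
  shows "(\<Sum>i\<in>T. c i *\<^sub>R \<alpha> i) \<bullet> cw k = (if k \<in> T then c k else 0)"
proof -
  have "finite T" using assms finite_subset by blast
  have "(\<Sum>i\<in>T. c i *\<^sub>R \<alpha> i) \<bullet> cw k = (\<Sum>i\<in>T. if i = k then c i else 0)"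
    unfolding inner_sum_left using assms by (intro sum.cong) (auto simp: dual)
  then show ?thesis using \<open>finite T\<close> by simp
qed

lemma coeff_eqI: "(\<And>i. i \<in> {1..l} \<Longrightarrow> x \<bullet> cw i = y \<bullet> cw i) \<Longrightarrow> x = y"
  by (subst expansion [of x], subst expansion [of y]) (rule sum.cong, auto)

lemma simple_root: "i \<in> {1..l} \<Longrightarrow> \<alpha> i \<in> \<Phi>"
  using root_basis by (auto simp: root_basis_def indivisible_def)

lemma h_root: "h \<in> \<Phi>"
  using highest by (simp add: highest_root_def)

lemma alpha_root: "i \<in> {0..l} \<Longrightarrow> \<alpha> i \<in> \<Phi>"
  using simple_root uminus_root h_root alpha_0 by (cases "i = 0") auto

lemma h_coeff: "i \<in> {1..l} \<Longrightarrow> h \<bullet> cw i = of_int (n i)"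
  using simple_combination_coeff [of "{1..l}" i "\<lambda>i. of_int (n i)"] h_eq by simp

lemma root_coeffs:
  assumes "b \<in> \<Phi>"
  shows "(\<forall>i\<in>{1..l}. b \<bullet> cw i \<in> \<int>) \<and> ((\<forall>i\<in>{1..l}. b \<bullet> cw i \<ge> 0) \<or> (\<forall>i\<in>{1..l}. b \<bullet> cw i \<le> 0))"
proof -
  obtain c :: "'a \<Rightarrow> int" where c: "b = (\<Sum>a\<in>\<alpha> ` {1..l}. of_int (c a) *\<^sub>R a)"
    and s: "(\<forall>a\<in>\<alpha> ` {1..l}. c a \<ge> 0) \<or> (\<forall>a\<in>\<alpha> ` {1..l}. c a \<le> 0)"
    using root_basis assms unfolding root_basis_def by blast
  have "b = (\<Sum>i\<in>{1..l}. of_int (c (\<alpha> i)) *\<^sub>R \<alpha> i)"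
    using c inj_simple by (simp add: sum.reindex)
  then have "b \<bullet> cw i = of_int (c (\<alpha> i))" if "i \<in> {1..l}" for i
    using simple_combination_coeff [of "{1..l}" i "\<lambda>i. of_int (c (\<alpha> i))"] that by simp
  then show ?thesis using s by auto
qed

lemma coeff_int: "b \<in> \<Phi> \<Longrightarrow> b \<bullet> cw i \<in> \<int>" if "i \<in> {0..l}"
  using root_coeffs [of b] that cw_0 by (cases "i = 0") auto

lemma highest_coeff:
  assumes "b \<in> \<Phi>" "i \<in> {1..l}"
  shows "b \<bullet> cw i \<le> of_int (n i)"
proof -
  obtain c :: "'a \<Rightarrow> nat" where c: "h - b = (\<Sum>a\<in>\<alpha> ` {1..l}. of_nat (c a) *\<^sub>R a)"
    using highest assms unfolding highest_root_def by blast
  have "h - b = (\<Sum>i\<in>{1..l}. of_nat (c (\<alpha> i)) *\<^sub>R \<alpha> i)"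
    using c inj_simple by (simp add: sum.reindex)
  then have "(h - b) \<bullet> cw i = of_nat (c (\<alpha> i))"
    using simple_combination_coeff [of "{1..l}" i "\<lambda>i. of_nat (c (\<alpha> i))"] assms by simp
  then show ?thesis using h_coeff assms by (simp add: inner_diff_left)
qed

lemma highest_coeff_abs: "b \<in> \<Phi> \<Longrightarrow> i \<in> {1..l} \<Longrightarrow> \<bar>b \<bullet> cw i\<bar> \<le> of_int (n i)"
  using highest_coeff [of b i] highest_coeff [of "- b" i] uminus_root by auto

lemma n_pos: "i \<in> {0..l} \<Longrightarrow> n i \<ge> 1"
  using highest_coeff [of "\<alpha> i" i] dual [of i i] simple_root n_0 by (cases "i = 0") auto

section \<open>Positive roots and the exchange property\<close>

definition positive :: "'a \<Rightarrow> bool" where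
  "positive b \<longleftrightarrow> b \<in> \<Phi> \<and> (\<forall>i\<in>{1..l}. b \<bullet> cw i \<ge> 0)"

lemma positive_root: "positive b \<Longrightarrow> b \<in> \<Phi>"
  by (simp add: positive_def)

lemma positive_or_negative: "b \<in> \<Phi> \<Longrightarrow> positive b \<or> positive (- b)"
  using root_coeffs uminus_root by (auto simp: positive_def)

lemma not_positive_negative: "positive b \<Longrightarrow> \<not> positive (- b)"
proof
  assume "positive b" "positive (- b)"
  then have "b = 0" by (intro coeff_eqI) (auto simp: positive_def intro: antisym)
  then show False using \<open>positive b\<close> zero_notin by (simp add: positive_def)
qed

lemma positive_simple: "i \<in> {1..l} \<Longrightarrow> positive (\<alpha> i)"
  using simple_root by (auto simp: positive_def dual)

lemma positive_h: "positive h"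
  using h_root n_pos by (force simp: positive_def h_coeff)

lemma positiveI: "b \<in> \<Phi> \<Longrightarrow> i \<in> {1..l} \<Longrightarrow> b \<bullet> cw i > 0 \<Longrightarrow> positive b"
  using root_coeffs [of b] by (fastforce simp: positive_def)

lemma simple_reflection_coeff:
  "i \<in> {1..l} \<Longrightarrow> k \<in> {1..l} \<Longrightarrow> k \<noteq> i \<Longrightarrow> reflection (\<alpha> i) x \<bullet> cw k = x \<bullet> cw k"
  by (simp add: reflection_def inner_diff_left dual)

text \<open>By reducedness \<open>b\<close> has a positive coefficient at some simple root other
  than \<open>\<alpha> i\<close>. The reflection leaves it alone, and sign coherence does the
  rest.\<close>

lemma simple_reflection_positive:
  assumes "i \<in> {1..l}" "positive b" "b \<noteq> \<alpha> i"
  shows "positive (reflection (\<alpha> i) b)"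
proof -
  have "\<exists>k\<in>{1..l}. k \<noteq> i \<and> b \<bullet> cw k > 0"
  proof (rule ccontr)
    assume "\<not> ?thesis"
    then have z: "b \<bullet> cw k = 0" if "k \<in> {1..l}" "k \<noteq> i" for k
      using assms(2) that by (force simp: positive_def)
    have "b = (b \<bullet> cw i) *\<^sub>R \<alpha> i"
      by (rule coeff_eqI) (use z assms(1) dual in auto)
    then have "b \<bullet> cw i = 1 \<or> b \<bullet> cw i = -1"
      using multiple_root [of "\<alpha> i" "b \<bullet> cw i"] simple_root [OF assms(1)] positive_root [OF assms(2)] by simp
    moreover have "b \<bullet> cw i \<ge> 0" using assms by (auto simp: positive_def)
    ultimately have "b \<bullet> cw i = 1" by linarith
    then show False using \<open>b = _\<close> assms(3) by simp
  qed
  then obtain k where "k \<in> {1..l}" "k \<noteq> i" "b \<bullet> cw k > 0" by blast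
  then show ?thesis
    using positiveI [OF reflection_root [OF simple_root [OF assms(1)] positive_root [OF assms(2)]], of k]
      assms(1) by (simp add: simple_reflection_coeff)
qed

lemma group_root: "w \<in> reflection_group A \<Longrightarrow> A \<subseteq> \<Phi> \<Longrightarrow> b \<in> \<Phi> \<Longrightarrow> w b \<in> \<Phi>"
  by (induction rule: reflection_group_induct) (auto intro: reflection_root)

lemma group_preimage:
  assumes "w \<in> reflection_group A" "A \<subseteq> \<Phi>" "b \<in> \<Phi>"
  obtains a where "a \<in> \<Phi>" "w a = b"
proof
  show "inv w b \<in> \<Phi>" using assms group_root reflection_group.inv by blast
  show "w (inv w b) = b"
    using assms reflection_group_orthogonal orthogonal_transformation_surj surj_f_inv_f by metis
qed

text \<open>As the letters act from the right, the image of \<open>\<alpha> i\<close> turns negative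
  at some letter. A simple reflection makes only its own root negative, so the image just before is
  that letter, and conjugation cancels it against \<open>reflection (\<alpha> i)\<close>. No new
  letters appear, so this also works in parabolic subgroups.\<close>

lemma exchange:
  assumes "set as \<subseteq> \<alpha> ` {1..l}" "i \<in> {1..l}" "positive (- reflection_word as (\<alpha> i))"
  shows "\<exists>bs. set bs \<subseteq> set as \<and> length bs < length as \<and> reflection_word as \<circ> reflection (\<alpha> i) = reflection_word bs"
  using assms
proof (induction as)
  case Nil
  then show ?case using not_positive_negative positive_simple by auto
next
  case (Cons a as)
  let ?w = "reflection_word as"
  have w: "?w \<in> reflection_group (\<alpha> ` {1..l})" using Cons.prems reflection_group_conv_word by auto
  have r: "?w (\<alpha> i) \<in> \<Phi>" using group_root [OF w] simple_root Cons.prems by blast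
  show ?case
  proof (cases "positive (- ?w (\<alpha> i))")
    case True
    moreover have "set as \<subseteq> \<alpha> ` {1..l}" using Cons.prems(1) by simp
    ultimately obtain bs where "set bs \<subseteq> set as" "length bs < length as"
      and e: "?w \<circ> reflection (\<alpha> i) = reflection_word bs"
      using Cons.IH Cons.prems(2) by blast
    moreover have "reflection_word (a # as) \<circ> reflection (\<alpha> i) = reflection_word (a # bs)"
      by (simp only: reflection_word_Cons comp_assoc e)
    moreover have "set (a # bs) \<subseteq> set (a # as)" "length (a # bs) < length (a # as)"
      using calculation by auto
    ultimately show ?thesis by blast
  next
    case False
    then have p: "positive (?w (\<alpha> i))" using positive_or_negative r by blast
    obtain k where k: "k \<in> {1..l}" "a = \<alpha> k" using Cons.prems by auto
    have "a = ?w (\<alpha> i)"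
    proof (rule ccontr)
      assume "a \<noteq> ?w (\<alpha> i)"
      then have "positive (reflection a (?w (\<alpha> i)))"
        using simple_reflection_positive k p by auto
      then show False using Cons.prems not_positive_negative by auto
    qed
    then have "reflection a (?w x) = ?w (reflection (\<alpha> i) x)" for x
      using reflection_conjugate [OF reflection_group_orthogonal [OF w]] by simp
    then have "reflection_word (a # as) \<circ> reflection (\<alpha> i) = ?w" by (auto simp: fun_eq_iff)
    moreover have "set as \<subseteq> set (a # as)" "length as < length (a # as)" by auto
    ultimately show ?thesis by blast
  qed
qed

text \<open>An element is determined by its action on the finite spanning set \<open>\<Phi>\<close>,
  which it maps into itself.\<close>

lemma finite_group:
  assumes "A \<subseteq> \<Phi>" shows "finite (reflection_group A)"
proof (rule inj_on_finite)
  show "inj_on (\<lambda>w. restrict w \<Phi>) (reflection_group A)"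
  proof (rule inj_onI)
    fix v w assume v: "v \<in> reflection_group A" and w: "w \<in> reflection_group A" and e: "restrict v \<Phi> = restrict w \<Phi>"
    have "linear v" "linear w"
      using v w reflection_group_orthogonal orthogonal_transformation_linear by auto
    moreover have "v b = w b" if "b \<in> \<Phi>" for b using fun_cong [OF e, of b] that by simp
    ultimately have "v x = w x" for x
      using linear_eq_on_span [of v w \<Phi> x] span_roots by auto
    then show "v = w" by auto
  qed
  show "(\<lambda>w. restrict w \<Phi>) ` reflection_group A \<subseteq> \<Phi> \<rightarrow>\<^sub>E \<Phi>"
    using group_root assms by auto
  show "finite (\<Phi> \<rightarrow>\<^sub>E \<Phi>)" using finite_roots by (rule finite_PiE) (rule finite_roots)
qed

section \<open>Longest elements of parabolic subgroups\<close>

lemma longest_element_props: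
  assumes "A \<subseteq> \<Phi>"
  shows "longest_element A \<in> reflection_group A"
    and "w \<in> reflection_group A \<Longrightarrow> word_length A w \<le> word_length A (longest_element A)"
proof -
  \<comment> \<open>\<open>Suc\<close> because the existence lemma for the maximum asks for a strict
    upper bound.\<close>
  let ?b = "Suc (Max (word_length A ` reflection_group A))"
  have "\<forall>y. y \<in> reflection_group A \<longrightarrow> word_length A y < ?b"
    using finite_group [OF assms] by (auto intro!: Max_ge simp: less_Suc_eq_le)
  from arg_max_nat_lemma [OF reflection_group.one this]
  show "longest_element A \<in> reflection_group A"
    and "w \<in> reflection_group A \<Longrightarrow> word_length A w \<le> word_length A (longest_element A)"
    unfolding longest_element_def by blast+
qed

text \<open>If the image were positive, exchange in a shortest word for
  \<open>?w \<circ> reflection (\<alpha> i)\<close> would give a strictly shorter word for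
  \<open>?w\<close>, so this product would be longer than the longest element.\<close>

lemma longest_element_negative:
  assumes T: "T \<subseteq> {1..l}" and i: "i \<in> T"
  shows "positive (- longest_element (\<alpha> ` T) (\<alpha> i))"
proof (rule ccontr)
  let ?A = "\<alpha> ` T" let ?w = "longest_element ?A"
  have A: "?A \<subseteq> \<Phi>" using T simple_root by auto
  have w: "?w \<in> reflection_group ?A" by (rule longest_element_props [OF A])
  assume "\<not> positive (- ?w (\<alpha> i))"
  then have p: "positive (?w (\<alpha> i))" using positive_or_negative group_root [OF w A] A i by blast
  have v: "?w \<circ> reflection (\<alpha> i) \<in> reflection_group ?A" using w i by (auto intro: reflection_group.intros)
  obtain as where as: "set as \<subseteq> ?A" "length as = word_length ?A (?w \<circ> reflection (\<alpha> i))"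
    "reflection_word as = ?w \<circ> reflection (\<alpha> i)" using word_length_witness [OF v] by blast
  have "positive (- reflection_word as (\<alpha> i))"
    using p orthogonal_transformation_linear [OF reflection_group_orthogonal [OF w]]
    by (simp add: as(3) reflection_self linear_neg)
  then obtain bs where bs: "set bs \<subseteq> set as" "length bs < length as"
    "reflection_word as \<circ> reflection (\<alpha> i) = reflection_word bs"
    using exchange [of as i] as(1) T i by blast
  then have "?w = reflection_word bs" by (auto simp: as(3) fun_eq_iff)
  then have "word_length ?A ?w \<le> length bs" using word_length_le [of bs ?A] bs as by auto
  also have "\<dots> < length as" by fact
  also have "\<dots> \<le> word_length ?A ?w" using longest_element_props(2) [OF A v] as by simp
  finally show False by simp
qed

lemma parabolic_coeff:
  assumes "w \<in> reflection_group (\<alpha> ` T)" "T \<subseteq> {1..l}" "k \<in> {1..l} - T"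
  shows "w x \<bullet> cw k = x \<bullet> cw k"
  using assms(1)
proof (induction rule: reflection_group_induct)
  case (reflection a w)
  then obtain i where "i \<in> T" "a = \<alpha> i" by blast
  moreover have "k \<noteq> i" "i \<in> {1..l}" "k \<in> {1..l}" using assms \<open>i \<in> T\<close> by blast+
  ultimately show ?case using reflection simple_reflection_coeff [of i k "w x"] by simp
qed simp

text \<open>The preimage \<open>b\<close> of \<open>- \<alpha> i\<close> is a nonnegative
  combination of the \<open>\<alpha> k\<close> with \<open>k \<in> T\<close>. Applying
  \<open>?w\<close> writes \<open>\<alpha> i\<close> as a nonnegative combination of the positive
  roots \<open>- ?w (\<alpha> k)\<close>, so each one that occurs is a multiple of
  \<open>\<alpha> i\<close>, and reducedness makes the factor 1.\<close>

lemma longest_element_simple_preimage: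
  assumes T: "T \<subseteq> {1..l}" and i: "i \<in> T"
  shows "\<exists>k\<in>T. longest_element (\<alpha> ` T) (\<alpha> k) = - \<alpha> i"
proof -
  let ?w = "longest_element (\<alpha> ` T)"
  have A: "\<alpha> ` T \<subseteq> \<Phi>" using T simple_root by auto
  have fT: "finite T" using T finite_subset by blast
  have w: "?w \<in> reflection_group (\<alpha> ` T)" by (rule longest_element_props [OF A])
  have lin: "linear ?w" using w reflection_group_orthogonal orthogonal_transformation_linear by blast
  have neg: "positive (- ?w (\<alpha> i))" if "i \<in> T" for i using longest_element_negative T that by blast
  have off: "?w (\<alpha> i) \<bullet> cw k = 0" if "i \<in> T" "k \<in> {1..l} - T" for i k
  proof -
    have "i \<in> {1..l}" "k \<in> {1..l}" "i \<noteq> k" using that T by blast+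
    then show ?thesis using parabolic_coeff [OF w T that(2)] dual [of i k] by simp
  qed
  have comb: "x = (\<Sum>k\<in>T. (x \<bullet> cw k) *\<^sub>R \<alpha> k)" if "\<forall>k\<in>{1..l} - T. x \<bullet> cw k = 0" for x
    by (subst expansion [of x], rule sum.mono_neutral_right) (use T that in auto)
  obtain b where b: "b \<in> \<Phi>" "?w b = - \<alpha> i" using group_preimage [OF w A] uminus_root A i by blast
  have b_off: "b \<bullet> cw k = 0" if "k \<in> {1..l} - T" for k
  proof -
    have "i \<in> {1..l}" "k \<in> {1..l}" "i \<noteq> k" using that T i by blast+
    then show ?thesis using parabolic_coeff [OF w T that, of b] b(2) dual [of i k] by simp
  qed
  have "?w b = ?w (\<Sum>k\<in>T. (b \<bullet> cw k) *\<^sub>R \<alpha> k)" using comb [of b] b_off by simp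
  then have wb: "?w b = (\<Sum>k\<in>T. (b \<bullet> cw k) *\<^sub>R ?w (\<alpha> k))"
    by (simp only: linear_sum [OF lin] linear_scale [OF lin])
  have wbi: "- (?w b \<bullet> cw m) = (\<Sum>k\<in>T. (b \<bullet> cw k) * (- ?w (\<alpha> k) \<bullet> cw m))" for m
    by (subst wb) (simp add: inner_sum_left sum_negf)
  have pb: "positive b"
  proof (rule ccontr)
    assume "\<not> positive b"
    then have nb: "positive (- b)" using b positive_or_negative by blast
    have "(\<Sum>k\<in>T. (b \<bullet> cw k) * (- ?w (\<alpha> k) \<bullet> cw i)) \<le> 0"
      using nb neg T i by (intro sum_nonpos mult_nonpos_nonneg) (auto simp: positive_def)
    then show False using wbi [of i] b(2) dual [of i i] i T by auto
  qed
  have bk: "b \<bullet> cw k \<ge> 0" if "k \<in> T" for k using pb that T by (auto simp: positive_def)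
  have wk: "- ?w (\<alpha> k) \<bullet> cw m \<ge> 0" if "k \<in> T" "m \<in> {1..l}" for k m
    using neg [OF that(1)] that by (auto simp: positive_def)
  have "\<exists>k\<in>T. b \<bullet> cw k \<noteq> 0"
  proof (rule ccontr)
    assume "\<not> ?thesis"
    then have "b = 0" using comb [of b] b_off by simp
    then show False using b zero_notin by simp
  qed
  then obtain k where k: "k \<in> T" "b \<bullet> cw k > 0" using bk by force
  have z: "- ?w (\<alpha> k) \<bullet> cw m = 0" if "m \<in> {1..l}" "m \<noteq> i" for m
  proof -
    have "(\<Sum>k\<in>T. (b \<bullet> cw k) * (- ?w (\<alpha> k) \<bullet> cw m)) = 0"
      using wbi [of m] b(2) dual [of i m] that i T by auto
    then have "(b \<bullet> cw k) * (- ?w (\<alpha> k) \<bullet> cw m) = 0"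
      using sum_nonneg_eq_0_iff [OF fT, of "\<lambda>k. (b \<bullet> cw k) * (- ?w (\<alpha> k) \<bullet> cw m)"]
        bk wk that k mult_nonneg_nonneg by blast
    then show ?thesis using k by simp
  qed
  define t where "t = - ?w (\<alpha> k) \<bullet> cw i"
  have e: "- ?w (\<alpha> k) = t *\<^sub>R \<alpha> i"
    by (rule coeff_eqI) (use z i T dual t_def in auto)
  have "t *\<^sub>R \<alpha> i \<in> \<Phi>" using e neg [OF k(1)] by (auto simp: positive_def)
  moreover have "t \<ge> 0" using wk k i T by (auto simp: t_def)
  ultimately have "t = 1" using multiple_root [of "\<alpha> i" t] A i by auto
  then have "?w (\<alpha> k) = - \<alpha> i" using e by (metis minus_minus scaleR_one)
  then show ?thesis using k by blast
qed

text \<open>The preimages define an injective self-map of the finite set \<open>T\<close>, hence a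
  permutation, which can be inverted.\<close>

lemma longest_element_simple:
  assumes T: "T \<subseteq> {1..l}" and i: "i \<in> T"
  shows "\<exists>k\<in>T. longest_element (\<alpha> ` T) (\<alpha> i) = - \<alpha> k"
proof -
  obtain f where f: "\<And>i. i \<in> T \<Longrightarrow> f i \<in> T \<and> longest_element (\<alpha> ` T) (\<alpha> (f i)) = - \<alpha> i"
    using longest_element_simple_preimage [OF T] by metis
  have "inj_on f T"
    using f inj_on_subset [OF inj_simple T] by (metis inj_onD inj_onI minus_minus)
  moreover have "finite T" using T finite_subset by blast
  ultimately have "f ` T = T" using f by (intro endo_inj_surj) auto
  then show ?thesis using f i by (metis imageE)
qed

section \<open>Dominant vectors and stabilizers in the Weyl group\<close>

lemma positive_inner:
  assumes "\<And>i. i \<in> {1..l} \<Longrightarrow> \<alpha> i \<bullet> x \<ge> 0" "positive b"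
  shows "b \<bullet> x \<ge> 0"
proof -
  have "b \<bullet> x = (\<Sum>i=1..l. (b \<bullet> cw i) * (\<alpha> i \<bullet> x))"
    by (subst expansion [of b]) (simp add: inner_sum_left)
  also have "\<dots> \<ge> 0"
    using assms by (intro sum_nonneg mult_nonneg_nonneg) (auto simp: positive_def)
  finally show ?thesis .
qed

text \<open>Take \<open>v\<close> with the fewest positive roots that are negative on
  \<open>v x\<close>. If \<open>\<alpha> i\<close> were one of them, its reflection would permute
  the other positive roots and lower the count.\<close>

lemma dominant_conjugate:
  "\<exists>v\<in>reflection_group (\<alpha> ` {1..l}). \<forall>i\<in>{1..l}. \<alpha> i \<bullet> v x \<ge> 0"
proof -
  define N where "N v = {b. positive b \<and> b \<bullet> v x < 0}" for v :: "'a \<Rightarrow> 'a"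
  have fin: "finite (N v)" for v
    using finite_roots by (rule finite_subset [rotated]) (auto simp: N_def positive_def)
  obtain v where v: "v \<in> reflection_group (\<alpha> ` {1..l})"
    and min: "\<And>w. w \<in> reflection_group (\<alpha> ` {1..l}) \<Longrightarrow> card (N v) \<le> card (N w)"
    using ex_has_least_nat [of "\<lambda>v. v \<in> reflection_group (\<alpha> ` {1..l})" id "\<lambda>v. card (N v)"]
      reflection_group.one by blast
  have "\<alpha> i \<bullet> v x \<ge> 0" if i: "i \<in> {1..l}" for i
  proof (rule ccontr)
    assume neg: "\<not> \<alpha> i \<bullet> v x \<ge> 0"
    let ?s = "reflection (\<alpha> i)"
    have adj: "b \<bullet> ?s y = ?s b \<bullet> y" for b y
      using reflection_inner [of "\<alpha> i" "?s b" y] by simp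
    have "?s ` N (?s \<circ> v) \<subseteq> N v - {\<alpha> i}"
    proof
      fix c assume "c \<in> ?s ` N (?s \<circ> v)"
      then obtain b where b: "positive b" "?s b \<bullet> v x < 0" "c = ?s b"
        by (auto simp: N_def adj)
      have "b \<noteq> \<alpha> i" using b neg by (auto simp: reflection_self)
      then have "positive c" using simple_reflection_positive i b by blast
      moreover have "c \<noteq> \<alpha> i"
      proof
        assume "c = \<alpha> i"
        then have "b = - \<alpha> i" using b(3) reflection_reflection [of "\<alpha> i" b] reflection_self by metis
        then show False using b(1) not_positive_negative positive_simple i by blast
      qed
      ultimately show "c \<in> N v - {\<alpha> i}" using b by (simp add: N_def)
    qed
    then have "card (?s ` N (?s \<circ> v)) \<le> card (N v - {\<alpha> i})" by (intro card_mono) (auto simp: fin)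
    moreover have "inj_on ?s (N (?s \<circ> v))"
      using reflection_reflection by (metis inj_onI)
    moreover have "\<alpha> i \<in> N v" using neg positive_simple i by (simp add: N_def)
    ultimately have "card (N (?s \<circ> v)) < card (N v)"
      using fin [of v] card_Diff1_less [of "N v" "\<alpha> i"] by (simp add: card_image)
    moreover have "?s \<circ> v \<in> reflection_group (\<alpha> ` {1..l})"
      using v i by (intro reflection_group.mult reflection_group.gen) auto
    ultimately show False using min by (meson not_le)
  qed
  then show ?thesis using v by blast
qed

text \<open>If the word sends its last letter \<open>a\<close> to a negative root, then
  \<open>a \<bullet> x\<close>, being the pairing of that root with \<open>x\<close>, is
  nonpositive; dominance makes \<open>a\<close> orthogonal to \<open>x\<close>, and exchange lets it
  be split off. Otherwise the word is not reduced and exchange shortens it.\<close>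

lemma stabilizer_dominant:
  assumes "set as \<subseteq> \<alpha> ` {1..l}" "reflection_word as x = x" "\<And>i. i \<in> {1..l} \<Longrightarrow> \<alpha> i \<bullet> x \<ge> 0"
  shows "reflection_word as \<in> reflection_group {b \<in> \<Phi>. b \<bullet> x = 0}"
  using assms(1,2)
proof (induction "length as" arbitrary: as rule: less_induct)
  case less
  show ?case
  proof (cases as rule: rev_cases)
    case Nil
    then show ?thesis by (simp add: reflection_group.one)
  next
    case (snoc bs a)
    then obtain i where i: "i \<in> {1..l}" "a = \<alpha> i" using less.prems by auto
    let ?w = "reflection_word as"
    have w: "?w \<in> reflection_group (\<alpha> ` {1..l})" using less.prems reflection_group_conv_word by auto
    have r: "?w a \<in> \<Phi>" using group_root [OF w] simple_root i by blast
    have wbs: "?w = reflection_word bs \<circ> reflection a" using snoc by (simp add: reflection_word_append)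
    show ?thesis
    proof (cases "positive (- ?w a)")
      case True
      obtain cs where cs: "set cs \<subseteq> set as" "length cs < length as" "?w \<circ> reflection a = reflection_word cs"
        using exchange [of as i] less.prems i True by blast
      have "- ?w a \<bullet> x \<ge> 0" using positive_inner [OF assms(3) True] .
      moreover have "?w a \<bullet> x = a \<bullet> x"
        using orthogonal_transformation_inner [OF reflection_group_orthogonal [OF w], of a x] less.prems by simp
      ultimately have "a \<bullet> x = 0" using assms(3) [OF i(1)] i(2) by simp
      then have "reflection_word cs x = x"
        using cs(3) less.prems(2) reflection_orthogonal by (metis comp_apply)
      then have "reflection_word cs \<in> reflection_group {b \<in> \<Phi>. b \<bullet> x = 0}"
        using less.hyps [OF cs(2)] cs(1) less.prems(1) by blast
      moreover have "?w = reflection_word cs \<circ> reflection a"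
        using cs(3) by (metis comp_apply ext reflection_reflection)
      moreover have "a \<in> {b \<in> \<Phi>. b \<bullet> x = 0}" using \<open>a \<bullet> x = 0\<close> i simple_root by simp
      ultimately show ?thesis by (metis reflection_group.gen reflection_group.mult)
    next
      case False
      then have p: "positive (?w a)" using positive_or_negative r by blast
      have "linear (reflection_word bs)"
        using orthogonal_transformation_reflection_word orthogonal_transformation_linear by blast
      then have "- reflection_word bs a = ?w a" by (simp add: wbs reflection_self linear_neg)
      then have "positive (- reflection_word bs (\<alpha> i))" using p i by simp
      then obtain cs where cs: "set cs \<subseteq> set bs" "length cs < length bs"
        "reflection_word bs \<circ> reflection a = reflection_word cs"
        using exchange [of bs i] less.prems snoc i by auto
      then have "?w = reflection_word cs" using wbs by simp
      then show ?thesis using less.hyps [of cs] cs less.prems snoc by auto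
    qed
  qed
qed

text \<open>Stabilizers and orthogonal roots are conjugated together, so \<open>x\<close> may be
  moved to a dominant vector.\<close>

lemma stabilizer:
  assumes w: "w \<in> reflection_group (\<alpha> ` {1..l})" and fixed: "w x = x"
  shows "w \<in> reflection_group {b \<in> \<Phi>. b \<bullet> x = 0}"
proof -
  let ?W = "reflection_group (\<alpha> ` {1..l})"
  obtain v where v: "v \<in> ?W" "\<And>i. i \<in> {1..l} \<Longrightarrow> \<alpha> i \<bullet> v x \<ge> 0"
    using dominant_conjugate by blast
  define v' where "v' = inv v"
  have v': "v' \<in> ?W" using v reflection_group.inv v'_def by blast
  have ov: "orthogonal_transformation v'" "orthogonal_transformation v"
    using v v' reflection_group_orthogonal by auto
  have inv: "v' (v y) = y" "v (v' y) = y" for y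
    unfolding v'_def using ov(2) by (simp_all add: inv_f_f orthogonal_transformation_inj orthogonal_transformation_surj surj_f_inv_f)
  have "v \<circ> w \<circ> v' \<in> ?W" using v(1) v' w reflection_group.mult by blast
  then obtain as where as: "set as \<subseteq> \<alpha> ` {1..l}" "v \<circ> w \<circ> v' = reflection_word as"
    using reflection_group_conv_word by blast
  have "reflection_word as (v x) = v x" using fixed inv by (simp flip: as(2))
  then have "reflection_word as \<in> reflection_group {b \<in> \<Phi>. b \<bullet> v x = 0}"
    using stabilizer_dominant [of as "v x"] as v(2) by blast
  then have "v' \<circ> reflection_word as \<circ> v \<in> reflection_group {b \<in> \<Phi>. b \<bullet> x = 0}"
  proof (induction rule: reflection_group_induct)
    case id
    have "v' \<circ> id \<circ> v = id" using inv by (simp add: fun_eq_iff)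
    then show ?case using reflection_group.one by metis
  next
    case (reflection a u)
    have "v' \<circ> (reflection a \<circ> u) \<circ> v = reflection (v' a) \<circ> (v' \<circ> u \<circ> v)"
      using reflection_conjugate [OF ov(1), of a] by (simp add: fun_eq_iff)
    moreover have "v' a \<in> {b \<in> \<Phi>. b \<bullet> x = 0}"
    proof -
      have "v' a \<bullet> v' (v x) = 0" using reflection orthogonal_transformation_inner [OF ov(1)] by simp
      moreover have "v' a \<in> \<Phi>" using group_root [OF v', of a] simple_root reflection by blast
      ultimately show ?thesis using inv by simp
    qed
    ultimately show ?case using reflection by (metis reflection_group.gen reflection_group.mult)
  qed
  moreover have "v' \<circ> reflection_word as \<circ> v = w"
    using inv by (simp add: fun_eq_iff flip: as(2))
  ultimately show ?thesis by simp
qed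

section \<open>Action of the longest elements on the extended simple roots\<close>

lemma inj_alpha: "inj_on \<alpha> {0..l}"
proof -
  have "\<alpha> 0 \<noteq> \<alpha> i" if "i \<in> {1..l}" for i
    using not_positive_negative [OF positive_h] positive_simple [OF that] alpha_0 by metis
  moreover have "{0..l} = insert 0 {1..l}" by auto
  ultimately show ?thesis using inj_simple by (force simp: inj_on_insert)
qed

text \<open>This forces \<open>w\<^sub>0 h = - h\<close> and makes \<open>w\<^sub>j\<close> exchange the largest and the smallest root with
  coefficient \<open>1\<close> at \<open>\<alpha> j\<close>.\<close>

lemma longest_element_antitone:
  assumes T: "T \<subseteq> {1..l}" and le: "\<And>i. i \<in> T \<Longrightarrow> x \<bullet> cw i \<ge> 0"
    and eq: "\<And>i. i \<in> {1..l} - T \<Longrightarrow> x \<bullet> cw i = 0" and k: "k \<in> {1..l}"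
  shows "longest_element (\<alpha> ` T) x \<bullet> cw k \<le> 0"
proof -
  let ?w = "longest_element (\<alpha> ` T)"
  have A: "\<alpha> ` T \<subseteq> \<Phi>" using T simple_root by auto
  have lin: "linear ?w"
    using longest_element_props(1) [OF A] reflection_group_orthogonal orthogonal_transformation_linear by blast
  have "x = (\<Sum>i\<in>T. (x \<bullet> cw i) *\<^sub>R \<alpha> i)"
    by (subst expansion [of x], rule sum.mono_neutral_right) (use T eq in auto)
  then have "?w x = ?w (\<Sum>i\<in>T. (x \<bullet> cw i) *\<^sub>R \<alpha> i)" by simp
  then have "?w x \<bullet> cw k = (\<Sum>i\<in>T. (x \<bullet> cw i) * (?w (\<alpha> i) \<bullet> cw k))"
    by (simp only: linear_sum [OF lin] linear_scale [OF lin] inner_sum_left inner_scaleR_left)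
  also have "\<dots> \<le> 0"
    using longest_element_negative [OF T] le k
    by (intro sum_nonpos mult_nonneg_nonpos) (auto simp: positive_def)
  finally show ?thesis .
qed

lemma omega_group:
  "omega l \<alpha> j \<in> reflection_group (\<alpha> ` {1..l})"
proof -
  have "longest_element (\<alpha> ` ({1..l} - {j})) \<in> reflection_group (\<alpha> ` {1..l})" for j
    using longest_element_props(1) [of "\<alpha> ` ({1..l} - {j})"] simple_root
      reflection_group_mono [of "\<alpha> ` ({1..l} - {j})" "\<alpha> ` {1..l}"] by blast
  then show ?thesis unfolding omega_def w_elt_def by (blast intro: reflection_group.mult)
qed

lemma longest_h: "longest_element (\<alpha> ` {1..l}) h = - h"
proof -
  let ?w = "longest_element (\<alpha> ` {1..l})"
  have A: "\<alpha> ` {1..l} \<subseteq> \<Phi>" using simple_root by auto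
  have w: "?w \<in> reflection_group (\<alpha> ` {1..l})" by (rule longest_element_props [OF A])
  have lin: "linear ?w" using w reflection_group_orthogonal orthogonal_transformation_linear by blast
  obtain b where b: "b \<in> \<Phi>" "?w b = - h" using group_preimage [OF w A uminus_root [OF h_root]] .
  show ?thesis
  proof (rule coeff_eqI)
    fix i assume i: "i \<in> {1..l}"
    \<comment> \<open>\<open>h\<close> dominates every root, so \<open>h - b\<close> is a
      nonnegative combination of simple roots. Hence \<open>?w h\<close> lies below
      \<open>- h\<close>, the lowest root.\<close>
    have "?w (h - b) \<bullet> cw i \<le> 0"
      by (rule longest_element_antitone) (use b i highest_coeff h_coeff in \<open>auto simp: inner_diff_left\<close>)
    then have "?w h \<bullet> cw i \<le> - h \<bullet> cw i" using b lin by (simp add: linear_diff inner_add_left)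
    moreover have "- (?w h) \<bullet> cw i \<le> h \<bullet> cw i"
      using highest_coeff [OF uminus_root [OF group_root [OF w A h_root]] i] h_coeff [OF i] by simp
    ultimately show "?w h \<bullet> cw i = - h \<bullet> cw i" by simp
  qed
qed

lemma longest_j:
  assumes j: "j \<in> {1..l}" "n j = 1"
  defines "w \<equiv> longest_element (\<alpha> ` ({1..l} - {j}))"
  shows "w h = \<alpha> j" and "w (\<alpha> j) = h"
proof -
  let ?T = "{1..l} - {j}"
  have T: "?T \<subseteq> {1..l}" by auto
  have A: "\<alpha> ` ?T \<subseteq> \<Phi>" using simple_root by auto
  have w: "w \<in> reflection_group (\<alpha> ` ?T)" unfolding w_def by (rule longest_element_props [OF A])
  have lin: "linear w" using w reflection_group_orthogonal orthogonal_transformation_linear by blast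
  have j_coeff: "w x \<bullet> cw j = x \<bullet> cw j" for x using parabolic_coeff [OF w T, of j] j by simp
  have hj: "h \<bullet> cw j = 1" using h_coeff j by simp
  have aj: "\<alpha> j \<bullet> cw j = 1" using dual j by simp
  obtain b where b: "b \<in> \<Phi>" "w b = \<alpha> j" using group_preimage [OF w A simple_root [OF j(1)]] .
  obtain c where c: "c \<in> \<Phi>" "w c = h" using group_preimage [OF w A h_root] .
  have bj: "b \<bullet> cw j = 1" using j_coeff [of b] b aj by simp
  have cj: "c \<bullet> cw j = 1" using j_coeff [of c] c hj by simp
  have wh: "w h \<in> \<Phi>" "w (\<alpha> j) \<in> \<Phi>" using group_root [OF w A] h_root simple_root j by auto
  have pos: "positive (w h)" "positive c"
    using positiveI [of _ j] wh c j j_coeff hj cj by auto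
  show "w h = \<alpha> j"
  proof (rule coeff_eqI)
    fix i assume i: "i \<in> {1..l}"
    \<comment> \<open>\<open>h\<close> and \<open>b\<close> both have coefficient 1 at
      \<open>\<alpha> j\<close>, so their difference involves only simple roots that
      \<open>w\<close> makes negative.\<close>
    have "w (h - b) \<bullet> cw i \<le> 0" unfolding w_def
      by (rule longest_element_antitone)
        (use b bj hj i highest_coeff h_coeff in \<open>auto simp: inner_diff_left\<close>)
    then have "w h \<bullet> cw i \<le> \<alpha> j \<bullet> cw i" using b lin by (simp add: linear_diff inner_diff_left)
    moreover have "w h \<bullet> cw i \<ge> 0" using pos i by (simp add: positive_def)
    ultimately show "w h \<bullet> cw i = \<alpha> j \<bullet> cw i"
      using j_coeff [of h] hj aj dual [OF j(1) i] by (cases "i = j") auto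
  qed
  show "w (\<alpha> j) = h"
  proof (rule coeff_eqI)
    fix i assume i: "i \<in> {1..l}"
    have "w (c - \<alpha> j) \<bullet> cw i \<le> 0" unfolding w_def
      by (rule longest_element_antitone)
        (use pos(2) j cj aj i dual in \<open>auto simp: inner_diff_left positive_def\<close>)
    then have "h \<bullet> cw i \<le> w (\<alpha> j) \<bullet> cw i" using c lin by (simp add: linear_diff inner_diff_left)
    moreover have "w (\<alpha> j) \<bullet> cw i \<le> h \<bullet> cw i" using highest_coeff [OF wh(2) i] h_coeff [OF i] by simp
    ultimately show "w (\<alpha> j) \<bullet> cw i = h \<bullet> cw i" by simp
  qed
qed

text \<open>Each longest element sends the simple roots of its own parabolic to negatives of simple
  roots, so two signs cancel. The exception is the node that \<open>?v\<close> sends to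
  \<open>- \<alpha> j\<close>: \<open>?w\<close> takes it on to \<open>- h\<close>, which is
  \<open>\<alpha> 0\<close>.\<close>

lemma omega_alpha:
  assumes j: "j \<in> {0..l}" "n j = 1"
  shows "omega l \<alpha> j (\<alpha> 0) = \<alpha> j" and "i \<in> {0..l} \<Longrightarrow> \<exists>k\<in>{0..l}. omega l \<alpha> j (\<alpha> i) = \<alpha> k"
proof -
  let ?v = "longest_element (\<alpha> ` {1..l})" and ?w = "longest_element (\<alpha> ` ({1..l} - {j}))"
  have "{1..l} - {0} = {1..l}" by auto
  then have om: "omega l \<alpha> j x = ?w (?v x)" for x by (simp add: omega_def w_elt_def)
  have lin: "linear (longest_element (\<alpha> ` T))" if "T \<subseteq> {1..l}" for T
    using longest_element_props(1) [of "\<alpha> ` T"] simple_root that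
      reflection_group_orthogonal orthogonal_transformation_linear by blast
  have vneg: "?v (- x) = - ?v x" and wneg: "?w (- x) = - ?w x" for x
    using lin [of "{1..l}"] lin [of "{1..l} - {j}"] by (auto simp: linear_neg)
  have "?v (\<alpha> 0) = h" using vneg [of h] longest_h by (simp add: alpha_0)
  show 0: "omega l \<alpha> j (\<alpha> 0) = \<alpha> j"
  proof (cases "j = 0")
    case True
    then have "?w = ?v" by (simp only: \<open>{1..l} - {0} = {1..l}\<close>)
    then have "omega l \<alpha> j (\<alpha> 0) = \<alpha> 0"
      by (simp only: om \<open>?v (\<alpha> 0) = h\<close> longest_h) (simp only: alpha_0)
    then show ?thesis using True by (simp only:)
  next
    case False
    then show ?thesis using longest_j(1) [of j] j \<open>?v (\<alpha> 0) = h\<close> by (simp add: om)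
  qed
  show "\<exists>k\<in>{0..l}. omega l \<alpha> j (\<alpha> i) = \<alpha> k" if i: "i \<in> {0..l}"
  proof (cases "i = 0")
    case True
    then show ?thesis using 0 j by blast
  next
    case False
    then obtain k where k: "k \<in> {1..l}" "?v (\<alpha> i) = - \<alpha> k"
      using longest_element_simple [of "{1..l}" i] i by force
    show ?thesis
    proof (cases "k = j")
      case True
      then have "omega l \<alpha> j (\<alpha> i) = \<alpha> 0"
        using k longest_j(2) [of j] j wneg [of "\<alpha> j"] by (simp add: om alpha_0)
      then show ?thesis by (intro bexI [of _ 0]) auto
    next
      case False
      then obtain m where "m \<in> {1..l} - {j}" "?w (\<alpha> k) = - \<alpha> m"
        using longest_element_simple [of "{1..l} - {j}" k] k by blast
      then show ?thesis using k wneg [of "\<alpha> k"] by (intro bexI [of _ m]) (auto simp: om)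
    qed
  qed
qed

subsection \<open>Affine roots\<close>

text \<open>\<open>affine_coeff b m i\<close> is the coefficient at the \<open>i\<close>-th simple affine root of the affine
  root \<open>b + m \<delta>\<close>.  It depends on \<open>m\<close> because \<open>\<alpha> 0, \<dots>, \<alpha> l\<close> are linearly dependent.\<close>

definition affine_coeff :: "'a \<Rightarrow> int \<Rightarrow> nat \<Rightarrow> real" where
  "affine_coeff b m i = b \<bullet> cw i + of_int m * of_int (n i)"

lemma split_range: "{0..l} = insert 0 {1..l}"
  by auto

lemma sum_marks: "(\<Sum>i\<in>{0..l}. of_int (n i) *\<^sub>R \<alpha> i) = 0"
  unfolding split_range using h_eq by (simp add: n_0 alpha_0)

lemma affine_expansion: "(\<Sum>i\<in>{0..l}. affine_coeff b m i *\<^sub>R \<alpha> i) = b"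
proof -
  have "(\<Sum>i\<in>{0..l}. (b \<bullet> cw i) *\<^sub>R \<alpha> i) = b"
    unfolding split_range using expansion [of b] by (simp add: cw_0)
  moreover have "(\<Sum>i\<in>{0..l}. (of_int m * of_int (n i)) *\<^sub>R \<alpha> i) = 0"
    using sum_marks by (simp flip: scaleR_scaleR scaleR_sum_right)
  ultimately show ?thesis
    by (simp add: affine_coeff_def scaleR_add_left sum.distrib)
qed

text \<open>Comparing coordinates at the simple roots shows that the relations form the line spanned
  by the marks; \<open>n 0 = 1\<close> identifies the factor as \<open>c 0\<close>.\<close>

lemma relation_marks:
  assumes "(\<Sum>i\<in>{0..l}. c i *\<^sub>R \<alpha> i) = 0" "i \<in> {0..l}"
  shows "c i = c 0 * of_int (n i)"
proof (cases "i = 0")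
  case False
  then have i: "i \<in> {1..l}" using assms by auto
  have "0 = (c 0 *\<^sub>R \<alpha> 0 + (\<Sum>i\<in>{1..l}. c i *\<^sub>R \<alpha> i)) \<bullet> cw i"
    using assms(1) unfolding split_range by simp
  also have "\<dots> = - c 0 * of_int (n i) + c i"
    unfolding inner_add_left using simple_combination_coeff [of "{1..l}" i c] i
    by (simp add: alpha_0 h_coeff)
  finally show ?thesis by simp
qed (simp add: n_0)

lemma affine_coeff_int: "b \<in> \<Phi> \<Longrightarrow> i \<in> {0..l} \<Longrightarrow> affine_coeff b m i \<in> \<int>"
  unfolding affine_coeff_def using coeff_int by auto

text \<open>The marks bound the coefficients of a root in absolute value, so for
  \<open>m \<noteq> 0\<close> the multiple of the marks decides the sign at every node, including 0,
  where the coefficient is \<open>m\<close> itself.\<close>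

lemma affine_coeff_sign:
  assumes b: "b \<in> \<Phi>"
  shows "(\<forall>i\<in>{0..l}. affine_coeff b m i \<ge> 0) \<or> (\<forall>i\<in>{0..l}. affine_coeff b m i \<le> 0)"
proof -
  have bd: "\<bar>b \<bullet> cw i\<bar> \<le> of_int (n i)" "1 \<le> real_of_int (n i)" if "i \<in> {0..l}" for i
    using highest_coeff_abs [OF b, of i] n_pos [OF that] that cw_0 by (cases "i = 0"; simp)+
  consider "m = 0" | "m \<ge> 1" | "m \<le> -1" by linarith
  then show ?thesis
  proof cases
    case 1
    then show ?thesis using root_coeffs [OF b] unfolding split_range by (auto simp: affine_coeff_def cw_0)
  next
    case 2
    have "affine_coeff b m i \<ge> 0" if "i \<in> {0..l}" for i
    proof -
      have "1 * real_of_int (n i) \<le> of_int m * of_int (n i)"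
        using bd(2) [OF that] 2 by (intro mult_right_mono) auto
      then show ?thesis using bd(1) [OF that] by (simp add: affine_coeff_def)
    qed
    then show ?thesis by blast
  next
    case 3
    have "affine_coeff b m i \<le> 0" if "i \<in> {0..l}" for i
    proof -
      have "of_int m * real_of_int (n i) \<le> -1 * of_int (n i)"
        using bd(2) [OF that] 3 by (intro mult_right_mono) auto
      then show ?thesis using bd(1) [OF that] by (simp add: affine_coeff_def)
    qed
    then show ?thesis by blast
  qed
qed

lemma affine_coeff_pos:
  "b \<in> \<Phi> \<Longrightarrow> k \<in> {0..l} \<Longrightarrow> affine_coeff b m k > 0 \<Longrightarrow> i \<in> {0..l} \<Longrightarrow> affine_coeff b m i \<ge> 0"
  using affine_coeff_sign [of b m] by fastforce

lemma affine_coeff_neg: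
  "b \<in> \<Phi> \<Longrightarrow> k \<in> {0..l} \<Longrightarrow> affine_coeff b m k < 0 \<Longrightarrow> i \<in> {0..l} \<Longrightarrow> affine_coeff b m i \<le> 0"
  using affine_coeff_sign [of b m] by fastforce

text \<open>The simple affine root at node 0 is \<open>\<alpha> 0 + \<delta>\<close>, hence the
  shift 1 there and 0 elsewhere.\<close>

lemma affine_coeff_alpha:
  "i \<in> {0..l} \<Longrightarrow> k \<in> {0..l} \<Longrightarrow> affine_coeff (\<alpha> i) (if i = 0 then 1 else 0) k = (if i = k then 1 else 0)"
  using n_0 cw_0 alpha_0 h_coeff [of k] dual [of i k] by (cases "i = 0"; cases "k = 0") (auto simp: affine_coeff_def)

lemma affine_coeff_diff:
  "affine_coeff (b - of_int t *\<^sub>R a) (m - t * m') k = affine_coeff b m k - of_int t * affine_coeff a m' k"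
  by (simp add: affine_coeff_def inner_diff_left algebra_simps)

lemma affine_coeff_add:
  "affine_coeff (b + a) (m + m') k = affine_coeff b m k + affine_coeff a m' k"
  by (simp add: affine_coeff_def inner_add_left algebra_simps)

text \<open>The reflection in the affine root \<open>a + ma \<delta>\<close> subtracts an integral
  multiple of it; integrality of the Cartan number makes the new shift an integer.\<close>

lemma affine_coeff_reflection:
  assumes "b \<in> \<Phi>" "a \<in> \<Phi>"
  shows "\<exists>m'. \<forall>k. affine_coeff (reflection a b) m' k
    = affine_coeff b m k - (2 * (b \<bullet> a) / (a \<bullet> a)) * affine_coeff a ma k"
proof -
  obtain t where t: "2 * (b \<bullet> a) / (a \<bullet> a) = of_int t" using cartan_int assms Ints_cases by metis
  show ?thesis
    by (rule exI [of _ "m - t * ma"]) (simp add: reflection_eq t affine_coeff_diff)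
qed

lemma affine_lift: "b \<in> \<Phi> \<Longrightarrow> \<exists>m. \<forall>i\<in>{0..l}. affine_coeff b m i \<ge> 0"
proof -
  assume b: "b \<in> \<Phi>"
  have "affine_coeff b 1 i \<ge> 0" if "i \<in> {0..l}" for i
    using highest_coeff_abs [OF b, of i] n_pos [OF that] that cw_0
    by (cases "i = 0") (auto simp: affine_coeff_def)
  then show ?thesis by blast
qed

lemma simple_inner_nonpos:
  assumes "i \<in> {1..l}" "k \<in> {1..l}" "i \<noteq> k"
  shows "\<alpha> i \<bullet> \<alpha> k \<le> 0"
proof (rule ccontr)
  let ?r = "reflection (\<alpha> i) (\<alpha> k)"
  assume "\<not> ?thesis"
  then have p: "\<alpha> i \<bullet> \<alpha> k > 0" by simp
  then have "\<alpha> i \<noteq> 0" by auto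
  have r: "?r \<in> \<Phi>" using reflection_root simple_root assms by blast
  have "?r \<bullet> cw k = 1" using simple_reflection_coeff [of i k "\<alpha> k"] dual assms by simp
  moreover have "?r \<bullet> cw i < 0"
    using dual assms p \<open>\<alpha> i \<noteq> 0\<close> by (simp add: reflection_def inner_diff_left)
  ultimately show False using root_coeffs [OF r] assms by fastforce
qed

lemma h_dominant:
  assumes i: "i \<in> {1..l}" shows "h \<bullet> \<alpha> i \<ge> 0"
proof (rule ccontr)
  assume "\<not> ?thesis"
  then have neg: "h \<bullet> \<alpha> i < 0" by simp
  then have "\<alpha> i \<noteq> 0" by auto
  have "reflection (\<alpha> i) h \<bullet> cw i \<le> of_int (n i)"
    using highest_coeff reflection_root simple_root h_root i by blast
  moreover have "reflection (\<alpha> i) h \<bullet> cw i = of_int (n i) - 2 * (h \<bullet> \<alpha> i) / (\<alpha> i \<bullet> \<alpha> i)"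
    using dual [OF i i] h_coeff [OF i] by (simp add: reflection_eq inner_diff_left)
  ultimately have "2 * (h \<bullet> \<alpha> i) / (\<alpha> i \<bullet> \<alpha> i) \<ge> 0" by linarith
  moreover have "\<alpha> i \<bullet> \<alpha> i > 0" using \<open>\<alpha> i \<noteq> 0\<close> by simp
  ultimately show False using neg divide_neg_pos [of "2 * (h \<bullet> \<alpha> i)" "\<alpha> i \<bullet> \<alpha> i"] by simp
qed

lemma alpha_inner_nonpos:
  "i \<in> {0..l} \<Longrightarrow> k \<in> {0..l} \<Longrightarrow> i \<noteq> k \<Longrightarrow> \<alpha> i \<bullet> \<alpha> k \<le> 0"
  using simple_inner_nonpos [of i k] h_dominant [of k] h_dominant [of i] alpha_0
  by (cases "i = 0"; cases "k = 0") (auto simp: inner_commute)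

text \<open>Reflections in orthogonal roots do not disturb each other's inner products with
  \<open>b\<close>, so their product subtracts all multiples at once. Lifts vanishing on
  \<open>K\<close> keep the affine coefficients there.\<close>

lemma orthogonal_product:
  assumes "finite R" "R \<subseteq> \<Phi>" "pairwise (\<lambda>a b. a \<bullet> b = 0) R" "b \<in> \<Phi>"
    "\<And>a. a \<in> R \<Longrightarrow> \<exists>m. \<forall>k\<in>K. affine_coeff a m k = 0"
  shows "b - (\<Sum>a\<in>R. (2 * (b \<bullet> a) / (a \<bullet> a)) *\<^sub>R a) \<in> \<Phi> \<and>
    (\<exists>m'. \<forall>k\<in>K. affine_coeff (b - (\<Sum>a\<in>R. (2 * (b \<bullet> a) / (a \<bullet> a)) *\<^sub>R a)) m' k = affine_coeff b m k)"
  using assms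
proof (induction R)
  case (insert a R)
  let ?b = "b - (\<Sum>a\<in>R. (2 * (b \<bullet> a) / (a \<bullet> a)) *\<^sub>R a)"
  have "?b \<in> \<Phi> \<and> (\<exists>m'. \<forall>k\<in>K. affine_coeff ?b m' k = affine_coeff b m k)"
    using insert by (intro insert.IH) (auto simp: pairwise_insert)
  then obtain m1 where b1: "?b \<in> \<Phi>" and m1: "\<forall>k\<in>K. affine_coeff ?b m1 k = affine_coeff b m k" by blast
  have "(\<Sum>a\<in>R. (2 * (b \<bullet> a) / (a \<bullet> a)) *\<^sub>R a) \<bullet> a = 0"
    unfolding inner_sum_left using insert.prems(2) insert.hyps(2)
    by (intro sum.neutral) (auto simp: pairwise_insert)
  then have "reflection a ?b = b - (\<Sum>a\<in>insert a R. (2 * (b \<bullet> a) / (a \<bullet> a)) *\<^sub>R a)"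
    using insert.hyps by (simp add: reflection_eq inner_diff_left)
  moreover have "reflection a ?b \<in> \<Phi>" using reflection_root b1 insert.prems by blast
  moreover obtain ma where ma: "\<forall>k\<in>K. affine_coeff a ma k = 0" using insert.prems(4) by blast
  moreover obtain m' where "\<forall>k. affine_coeff (reflection a ?b) m' k
      = affine_coeff ?b m1 k - (2 * (?b \<bullet> a) / (a \<bullet> a)) * affine_coeff a ma k"
    using affine_coeff_reflection [OF b1, of a m1 ma] insert.prems(1) by blast
  ultimately have "reflection a ?b \<in> \<Phi>" and "\<forall>k\<in>K. affine_coeff (reflection a ?b) m' k = affine_coeff b m k"
    and "reflection a ?b = b - (\<Sum>a\<in>insert a R. (2 * (b \<bullet> a) / (a \<bullet> a)) *\<^sub>R a)"
    using m1 by auto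
  then show ?case by metis
qed auto

subsection \<open>The coroot lattice\<close>

definition coroot :: "'a \<Rightarrow> 'a" where
  "coroot a = (2 / (a \<bullet> a)) *\<^sub>R a"

definition coroot_lattice :: "'a set" where
  "coroot_lattice = group_closure (coroot ` \<Phi>)"

lemma reflection_coroot: "reflection a x = x - (a \<bullet> x) *\<^sub>R coroot a"
  by (simp add: reflection_def coroot_def)

text \<open>Negatives of coroots are coroots, so differences are absorbed. A list keeps
  multiplicities, and its length is the measure for the induction below.\<close>

lemma coroot_lattice_list:
  assumes "x \<in> coroot_lattice"
  shows "\<exists>xs. set xs \<subseteq> \<Phi> \<and> x = sum_list (map coroot xs)"
  using assms unfolding coroot_lattice_def
proof induction
  case (base s)
  then consider "s = 0" | a where "a \<in> \<Phi>" "s = coroot a" by blast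
  then show ?case
  proof cases
    case 1
    then show ?thesis by (intro exI [of _ "[]"]) simp
  next
    case 2
    then show ?thesis by (intro exI [of _ "[a]"]) simp
  qed
next
  case (diff s t)
  then obtain xs ys where xs: "set xs \<subseteq> \<Phi>" "s = sum_list (map coroot xs)"
    and ys: "set ys \<subseteq> \<Phi>" "t = sum_list (map coroot ys)" by blast
  have "sum_list (map coroot (map uminus ys)) = - sum_list (map coroot ys)" for ys
    by (induction ys) (simp_all add: coroot_def)
  then show ?case using xs ys uminus_root
    by (intro exI [of _ "xs @ map uminus ys"]) auto
qed

text \<open>A reflection shortens the expression of a minuscule element as a sum of coroots.\<close>

lemma minuscule_coroot_sum:
  assumes "set xs \<subseteq> \<Phi>" "x = sum_list (map coroot xs)"
    and "\<And>b. b \<in> \<Phi> \<Longrightarrow> b \<bullet> x \<in> \<int> \<and> \<bar>b \<bullet> x\<bar> \<le> 1"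
  shows "x = 0"
  using assms
proof (induction "length xs" arbitrary: xs x rule: less_induct)
  case less
  show ?case
  proof (rule ccontr)
    assume "x \<noteq> 0"
    then have "x \<bullet> x > 0" by simp
    moreover have "x \<bullet> x = (\<Sum>a\<leftarrow>xs. coroot a \<bullet> x)"
      by (subst (1) less.prems(2)) (induction xs, simp_all add: inner_add_left)
    moreover have "(\<Sum>a\<leftarrow>xs. coroot a \<bullet> x) \<le> 0" if "\<forall>a\<in>set xs. coroot a \<bullet> x \<le> 0"
      using that by (induction xs) auto
    ultimately obtain a where a: "a \<in> set xs" "coroot a \<bullet> x > 0" by force
    have root: "a \<in> \<Phi>" using a less.prems(1) by blast
    have "a \<bullet> x > 0"
      using a(2) inner_ge_zero [of a] by (auto simp: coroot_def zero_less_mult_iff zero_less_divide_iff)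
    moreover obtain z where "a \<bullet> x = of_int z" using less.prems(3) [OF root] Ints_cases by blast
    ultimately have "a \<bullet> x = 1" using less.prems(3) [OF root] by auto
    then have r: "reflection a x = x - coroot a" by (simp add: reflection_coroot)
    have "reflection a x = 0"
    proof (rule less.hyps [of "remove1 a xs"])
      show "length (remove1 a xs) < length xs"
        using length_pos_if_in_set [OF a(1)] a(1) by (simp add: length_remove1)
      show "set (remove1 a xs) \<subseteq> \<Phi>" using less.prems(1) set_remove1_subset by fastforce
      show "reflection a x = sum_list (map coroot (remove1 a xs))"
        using less.prems(2) sum_list_map_remove1 [OF a(1), of coroot] r by simp
      fix b assume "b \<in> \<Phi>"
      then have "reflection a b \<in> \<Phi>" using reflection_root root by blast
      moreover have "b \<bullet> reflection a x = reflection a b \<bullet> x"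
        using reflection_inner [of a "reflection a b" x] by simp
      ultimately show "b \<bullet> reflection a x \<in> \<int> \<and> \<bar>b \<bullet> reflection a x\<bar> \<le> 1" using less.prems(3) by simp
    qed
    then have "reflection a x \<bullet> reflection a x = 0" by simp
    then show False using \<open>x \<noteq> 0\<close> by (simp add: reflection_inner)
  qed
qed

text \<open>Each further reflection subtracts \<open>a \<bullet> w x\<close> times a coroot; the
  second conjunct keeps this factor integral along the induction.\<close>

lemma group_diff_coroot_lattice:
  assumes "w \<in> reflection_group A" "A \<subseteq> \<Phi>" "\<And>b. b \<in> \<Phi> \<Longrightarrow> b \<bullet> x \<in> \<int>"
  shows "w x - x \<in> coroot_lattice \<and> (\<forall>b\<in>\<Phi>. b \<bullet> w x \<in> \<int>)"
  using assms(1)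
proof (induction rule: reflection_group_induct)
  case id
  then show ?case using assms(3) by (simp add: coroot_lattice_def)
next
  case (reflection a w)
  then have a: "a \<in> \<Phi>" using assms(2) by blast
  obtain z where z: "a \<bullet> w x = of_int z" using reflection a Ints_cases by blast
  have "of_int z *\<^sub>R coroot a \<in> coroot_lattice"
    unfolding coroot_lattice_def using a by (intro group_closure_scaleR_int group_closure.base) blast
  then have "(w x - x) - of_int z *\<^sub>R coroot a \<in> coroot_lattice"
    using reflection unfolding coroot_lattice_def by (blast intro: group_closure.diff)
  then have "reflection a (w x) - x \<in> coroot_lattice" by (simp add: reflection_coroot z algebra_simps)
  moreover have "b \<bullet> reflection a (w x) \<in> \<int>" if "b \<in> \<Phi>" for b
  proof -
    have "b \<bullet> reflection a (w x) = reflection a b \<bullet> w x"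
      using reflection_inner [of a "reflection a b" "w x"] by simp
    then show ?thesis using reflection reflection_root a that by simp
  qed
  ultimately show ?case by simp
qed

text \<open>Node 0 pairs as \<open>- h\<close> and contributes \<open>- n s\<close>; at
  \<open>k = s = 0\<close> the two terms cancel, in accordance with \<open>cw 0 = 0\<close>.\<close>

lemma alpha_cw:
  "k \<in> {0..l} \<Longrightarrow> s \<in> {0..l} \<Longrightarrow>
    \<alpha> k \<bullet> cw s = (if k = s then 1 else 0) - of_int (n s) * (if k = 0 then 1 else 0)"
  using dual [of k s] h_coeff [of s] n_0 cw_0 alpha_0 by (cases "k = 0"; cases "s = 0") auto

lemma eq_by_alpha:
  assumes "\<And>k. k \<in> {0..l} \<Longrightarrow> \<alpha> k \<bullet> x = \<alpha> k \<bullet> y" shows "x = y"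
proof -
  let ?z = "x - y"
  have "?z \<bullet> ?z = (\<Sum>i=1..l. (?z \<bullet> cw i) * (\<alpha> i \<bullet> ?z))"
    by (subst (1) expansion [of ?z]) (simp add: inner_sum_left)
  also have "\<dots> = 0" using assms by (intro sum.neutral) (simp add: inner_diff_right)
  finally show ?thesis by simp
qed

text \<open>If one of the two Cartan integers is 1, a reflection yields the difference up to sign.
  Otherwise both are at least 2, so \<open>a \<bullet> b\<close> bounds both squared norms and
  \<open>a - b\<close> would vanish.\<close>

lemma root_diff:
  assumes a: "a \<in> \<Phi>" and b: "b \<in> \<Phi>" and pos: "a \<bullet> b > 0" and ne: "a \<noteq> b"
  shows "a - b \<in> \<Phi>"
proof -
  have nz: "a \<bullet> a > 0" "b \<bullet> b > 0" using a b zero_notin by auto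
  obtain p q where p: "2 * (a \<bullet> b) / (b \<bullet> b) = of_int p" and q: "2 * (a \<bullet> b) / (a \<bullet> a) = of_int q"
    using cartan_int [OF a b] cartan_int [OF b a] by (metis Ints_cases inner_commute)
  have "2 * (a \<bullet> b) / (b \<bullet> b) > 0" "2 * (a \<bullet> b) / (a \<bullet> a) > 0" using pos nz by simp_all
  then have "p > 0" "q > 0" unfolding p q by simp_all
  then consider "p = 1" | "q = 1" | "p \<ge> 2" "q \<ge> 2" by linarith
  then show ?thesis
  proof cases
    case 1
    then have "reflection b a = a - b" unfolding reflection_eq p by simp
    then show ?thesis using reflection_root [OF b a] by simp
  next
    case 2
    then have "reflection a b = b - a" unfolding reflection_def q by simp
    then show ?thesis using uminus_root [OF reflection_root [OF a b]] by simp
  next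
    case 3
    then have "2 * (a \<bullet> b) / (b \<bullet> b) \<ge> 2" "2 * (a \<bullet> b) / (a \<bullet> a) \<ge> 2" using p q by simp_all
    then have "a \<bullet> b \<ge> b \<bullet> b" "a \<bullet> b \<ge> a \<bullet> a" using nz by (simp_all add: field_simps)
    then have "(a - b) \<bullet> (a - b) \<le> 0" by (simp add: inner_diff_left inner_diff_right inner_commute)
    moreover have "(a - b) \<bullet> (a - b) > 0" using ne by (simp only: inner_gt_zero_iff right_minus_eq not_False_eq_True)
    ultimately show ?thesis by linarith
  qed
qed

end

section \<open>Folding along a symmetry of the extended simple roots\<close>

text \<open>Membership of \<open>\<omega>\<close> in the Weyl group gives more than orthogonality:
  finite order, Steinberg's factorisation and the trivial action on coweights modulo coroots.
  \<open>n_sigma_0\<close> makes \<open>cw (\<sigma> 0)\<close> minuscule or zero.\<close>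

locale folded_root_system = based_root_system +
  fixes \<omega> :: "'a \<Rightarrow> 'a" and \<sigma> :: "nat \<Rightarrow> nat"
  assumes omega_in: "\<omega> \<in> reflection_group (\<alpha> ` {1..l})"
    and sigma_permutes: "\<sigma> permutes {0..l}"
    and omega_simple: "\<And>i. i \<in> {0..l} \<Longrightarrow> \<omega> (\<alpha> i) = \<alpha> (\<sigma> i)"
    and n_sigma_0: "n (\<sigma> 0) = 1"
begin

section \<open>The averaging projection\<close>

abbreviation P :: "'a \<Rightarrow> 'a" where "P \<equiv> avg \<omega>"
abbreviation orb :: "nat \<Rightarrow> nat set" where "orb \<equiv> orbit \<sigma>"

lemma ortho: "orthogonal_transformation \<omega>"
  using reflection_group_orthogonal omega_in .

lemma lin: "linear \<omega>"
  using ortho orthogonal_transformation_linear by blast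

lemma omega_inner: "\<omega> x \<bullet> \<omega> y = x \<bullet> y"
  using orthogonal_transformation_inner ortho .

lemma funpow_inner: "(\<omega> ^^ t) x \<bullet> (\<omega> ^^ t) y = x \<bullet> y"
  by (induction t) (simp_all add: omega_inner)

lemma linear_funpow: "linear (\<omega> ^^ t)"
proof (induction t)
  case (Suc t)
  then show ?case using linear_compose [OF Suc lin] by (simp add: o_def)
qed (simp add: id_def linear_id [unfolded id_def])

lemma map_order: "map_order \<omega> > 0" "\<omega> ^^ map_order \<omega> = id"
proof -
  have "\<omega> ^^ t \<in> reflection_group (\<alpha> ` {1..l})" for t
    by (induction t)
      (auto simp only: funpow.simps intro: reflection_group.one reflection_group.mult omega_in)
  then have "finite (range (\<lambda>t. \<omega> ^^ t))"
    using finite_group [of "\<alpha> ` {1..l}"] simple_root by (meson finite_subset image_subset_iff)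
  then have "\<not> inj (\<lambda>t. \<omega> ^^ t)" using finite_imageD infinite_UNIV_nat by blast
  then obtain s t where "s \<noteq> t" "\<omega> ^^ s = \<omega> ^^ t" by (auto simp: inj_def)
  then obtain s t where st: "s < t" "\<omega> ^^ s = \<omega> ^^ t" by (metis linorder_neqE_nat)
  have "(\<omega> ^^ s) ((\<omega> ^^ (t - s)) x) = (\<omega> ^^ s) x" for x
    using st by (metis comp_apply funpow_add le_add_diff_inverse less_imp_le)
  moreover have "inj (\<omega> ^^ s)"
    using ortho orthogonal_transformation_inj inj_fn by blast
  ultimately have "\<omega> ^^ (t - s) = id" by (auto simp: fun_eq_iff inj_def)
  then have "0 < t - s \<and> \<omega> ^^ (t - s) = id" using st by simp
  from LeastI [of "\<lambda>t. 0 < t \<and> \<omega> ^^ t = id", OF this]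
  show "map_order \<omega> > 0" "\<omega> ^^ map_order \<omega> = id" unfolding map_order_def by auto
qed

lemma linear_avg: "linear P"
proof -
  have "linear (\<lambda>x. (1 / real (map_order \<omega>)) *\<^sub>R (\<Sum>t=1..map_order \<omega>. (\<omega> ^^ t) x))"
    by (intro linear_compose_scale_right linear_compose_sum ballI linear_funpow)
  then show ?thesis by (simp add: avg_def [abs_def])
qed

lemmas avg_linear [simp] =
  linear_add [OF linear_avg] linear_diff [OF linear_avg] linear_neg [OF linear_avg]
  linear_scale [OF linear_avg] linear_0 [OF linear_avg]
  linear_sum [OF linear_avg]

lemma sum_funpow_shift: "(\<Sum>t=1..map_order \<omega>. (\<omega> ^^ t) (\<omega> x)) = (\<Sum>t=1..map_order \<omega>. (\<omega> ^^ t) x)"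
proof -
  let ?m = "map_order \<omega>"
  have "(\<Sum>t=1..?m. (\<omega> ^^ t) (\<omega> x)) = (\<Sum>t=1..?m. (\<omega> ^^ Suc t) x)"
    by (simp add: funpow_swap1)
  also have "\<dots> = (\<Sum>t=Suc 1..Suc ?m. (\<omega> ^^ t) x)"
    by (rule sum.shift_bounds_cl_Suc_ivl [symmetric])
  also have "\<dots> = (\<Sum>t=1..?m. (\<omega> ^^ t) x)"
  proof -
    have "(\<Sum>t=1..Suc ?m. (\<omega> ^^ t) x) = (\<omega> ^^ 1) x + (\<Sum>t=Suc 1..Suc ?m. (\<omega> ^^ t) x)"
      by (rule sum.atLeast_Suc_atMost) simp
    moreover have "(\<Sum>t=1..Suc ?m. (\<omega> ^^ t) x) = (\<Sum>t=1..?m. (\<omega> ^^ t) x) + \<omega> x"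
      using map_order(2) by simp
    ultimately show ?thesis by simp
  qed
  finally show ?thesis .
qed

lemma avg_omega: "P (\<omega> x) = P x"
  unfolding avg_def sum_funpow_shift ..

lemma omega_avg: "\<omega> (P x) = P x"
proof -
  have "\<omega> (P x) = (1 / real (map_order \<omega>)) *\<^sub>R (\<Sum>t=1..map_order \<omega>. (\<omega> ^^ t) (\<omega> x))"
    unfolding avg_def by (simp add: linear_scale [OF lin] linear_sum [OF lin] funpow_swap1)
  then show ?thesis by (simp only: avg_def sum_funpow_shift)
qed

lemma avg_fixed: "\<omega> x = x \<Longrightarrow> P x = x"
proof -
  assume fixed: "\<omega> x = x"
  have "(\<omega> ^^ t) x = x" for t by (induction t) (simp_all add: fixed)
  then show ?thesis using map_order(1) by (simp add: avg_def sum_constant_scaleR del: sum_constant)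
qed

lemma avg_avg [simp]: "P (P x) = P x"
  by (rule avg_fixed) (rule omega_avg)

text \<open>Every iterate is orthogonal and fixes \<open>P y\<close>. This makes \<open>P\<close>
  self-adjoint, hence the orthogonal projection onto the fixed space.\<close>

lemma avg_inner: "P x \<bullet> P y = x \<bullet> P y"
proof -
  have "(\<omega> ^^ t) x \<bullet> P y = x \<bullet> P y" for t
  proof -
    have "(\<omega> ^^ t) (P y) = P y" by (induction t) (simp_all add: omega_avg)
    then show ?thesis using funpow_inner [of t x "P y"] by simp
  qed
  then show ?thesis using map_order(1) by (subst avg_def) (simp add: inner_sum_left)
qed

lemma avg_sym: "P x \<bullet> y = x \<bullet> P y"
  using avg_inner [of x y] avg_inner [of y x] by (simp add: inner_commute)

lemma fixed_space_iff: "x \<in> fixed_space \<omega> \<longleftrightarrow> P x = x"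
  using avg_fixed omega_avg [of x] by (auto simp: fixed_space_def)

lemma subspace_fixed: "subspace (fixed_space \<omega>)"
  by (auto simp: subspace_def fixed_space_iff)

subsection \<open>Orbits of simple affine roots\<close>

lemma permutation_sigma: "permutation \<sigma>"
  using sigma_permutes permutation_permutes by blast

lemma self_in_orb: "i \<in> orb i"
  using permutation_sigma permutation_self_in_orbit by metis

lemma orb_subset: "i \<in> {0..l} \<Longrightarrow> orb i \<subseteq> {0..l}"
  using permutes_orbit_subset sigma_permutes by metis

lemma finite_orb: "finite (orb i)"
  using finite_orbit self_in_orb by metis

lemma orb_eq: "s \<in> orb i \<Longrightarrow> orb s = orb i"
  using orbit_cyclic_eq3 cyclic_on_orbit' permutation_sigma by metis

lemma sigma_orb: "\<sigma> ` orb i = orb i"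
proof (rule endo_inj_surj)
  show "\<sigma> ` orb i \<subseteq> orb i" by (auto intro: orbit.step)
  show "inj_on \<sigma> (orb i)" using permutes_inj [OF sigma_permutes] inj_on_subset by blast
qed (rule finite_orb)

lemma sigma_in: "i \<in> {0..l} \<Longrightarrow> \<sigma> i \<in> {0..l}"
  using permutes_in_image [OF sigma_permutes] by blast

lemma orb_induct [consumes 1, case_names self step]:
  assumes "s \<in> orb i" "Q i" "\<And>s. s \<in> orb i \<Longrightarrow> Q s \<Longrightarrow> Q (\<sigma> s)"
  shows "Q s"
  using assms(1) by induction (use assms(2,3) self_in_orb in blast)+

lemma avg_alpha:
  assumes "i \<in> {0..l}" "s \<in> orb i" shows "P (\<alpha> s) = P (\<alpha> i)"
  using assms(2)
proof (induction rule: orb_induct)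
  case (step s)
  then have "s \<in> {0..l}" using orb_subset assms(1) by blast
  then show ?case using avg_omega [of "\<alpha> s"] omega_simple step by simp
qed simp

lemma alpha_norm:
  assumes "i \<in> {0..l}" "s \<in> orb i" shows "\<alpha> s \<bullet> \<alpha> s = \<alpha> i \<bullet> \<alpha> i"
  using assms(2)
proof (induction rule: orb_induct)
  case (step s)
  then have "s \<in> {0..l}" using orb_subset assms(1) by blast
  then show ?case using omega_inner [of "\<alpha> s" "\<alpha> s"] omega_simple step by simp
qed simp

text \<open>\<open>\<omega>\<close> carries the relation given by the marks to another relation,
  which is a multiple of it; the mark 1 at \<open>\<sigma> 0\<close> forces the factor 1.\<close>

lemma n_sigma:
  assumes "i \<in> {0..l}" shows "n (\<sigma> i) = n i"
proof -
  define c where "c k = real_of_int (n (inv \<sigma> k))" for k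
  have inv: "inv \<sigma> (\<sigma> k) = k" for k using permutes_inverses(2) [OF sigma_permutes] .
  have "(\<Sum>i\<in>{0..l}. c i *\<^sub>R \<alpha> i) = (\<Sum>i\<in>{0..l}. c (\<sigma> i) *\<^sub>R \<alpha> (\<sigma> i))"
    using sum.permute [OF sigma_permutes] by (simp add: o_def)
  also have "\<dots> = (\<Sum>i\<in>{0..l}. of_int (n i) *\<^sub>R \<omega> (\<alpha> i))"
    by (intro sum.cong) (auto simp: c_def inv omega_simple)
  also have "\<dots> = \<omega> (\<Sum>i\<in>{0..l}. of_int (n i) *\<^sub>R \<alpha> i)"
    by (simp add: linear_sum [OF lin] linear_scale [OF lin])
  also have "\<dots> = 0" by (simp only: sum_marks linear_0 [OF lin])
  finally have rel: "(\<Sum>i\<in>{0..l}. c i *\<^sub>R \<alpha> i) = 0" .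
  have "c 0 = 1" using relation_marks [OF rel sigma_in [of 0]] n_0 n_sigma_0 by (simp add: c_def inv)
  then show ?thesis using relation_marks [OF rel sigma_in [OF assms]] by (simp add: c_def inv)
qed

text \<open>The orbit sum is fixed by \<open>\<omega>\<close>, so it equals its own average. This
  identifies \<open>orbit_root\<close> with \<open>P (\<alpha> i)\<close>.\<close>

lemma sum_orb:
  assumes i: "i \<in> {0..l}"
  shows "(\<Sum>s\<in>orb i. \<alpha> s) = of_nat (card (orb i)) *\<^sub>R P (\<alpha> i)"
proof -
  have "\<omega> (\<Sum>s\<in>orb i. \<alpha> s) = (\<Sum>s\<in>orb i. \<alpha> (\<sigma> s))"
    unfolding linear_sum [OF lin] using orb_subset [OF i] omega_simple by (intro sum.cong) auto
  also have "\<dots> = (\<Sum>s\<in>\<sigma> ` orb i. \<alpha> s)"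
    using inj_on_subset [OF permutes_inj [OF sigma_permutes]] by (subst sum.reindex) auto
  finally have "P (\<Sum>s\<in>orb i. \<alpha> s) = (\<Sum>s\<in>orb i. \<alpha> s)" unfolding sigma_orb by (rule avg_fixed)
  then show ?thesis using avg_alpha [OF i] by (simp add: sum_constant_scaleR del: sum_constant)
qed

text \<open>\<open>P (\<alpha> i) \<noteq> 0\<close> forces every simple affine root in the orbit of \<open>\<alpha> i\<close> to have at most one
  neighbour in the orbit, because its inner product with the orbit sum is positive.  So the
  orbit is of type \<open>A\<^sub>1\<^sup>m\<close> (\<open>e = 1\<close>) or \<open>A\<^sub>2\<^sup>m\<close> (\<open>e = 2\<close>), and \<open>R\<close> consists of the highest roots of
  the components.\<close>

definition folding_set :: "nat \<Rightarrow> nat \<Rightarrow> 'a set \<Rightarrow> bool" where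
  "folding_set i e R \<longleftrightarrow> R \<subseteq> \<Phi> \<and> pairwise (\<lambda>a b. a \<bullet> b = 0) R \<and>
     (\<Sum>a\<in>R. a) = (\<Sum>s\<in>orb i. \<alpha> s) \<and>
     (\<forall>a\<in>R. a \<bullet> a = \<alpha> i \<bullet> \<alpha> i \<and> P a = of_nat e *\<^sub>R P (\<alpha> i) \<and>
        (\<exists>m. \<forall>k\<in>{0..l} - orb i. affine_coeff a m k = 0)) \<and>
     (\<forall>b\<in>\<Phi>. \<forall>m. (\<forall>k\<in>{0..l}. affine_coeff b m k \<ge> 0) \<longrightarrow> (\<forall>k\<in>{0..l} - orb i. affine_coeff b m k = 0) \<longrightarrow>
        (\<exists>C\<in>{1,2::nat}. C dvd e \<and> P b = of_nat C *\<^sub>R P (\<alpha> i)))"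

lemma affine_coeff_alpha': "i \<in> {0..l} \<Longrightarrow> \<exists>m. \<forall>k\<in>{0..l}. affine_coeff (\<alpha> i) m k = (if i = k then 1 else 0)"
  using affine_coeff_alpha by blast

lemma supported_expansion:
  assumes i: "i \<in> {0..l}" and off: "\<forall>k\<in>{0..l} - orb i. affine_coeff b m k = 0"
  shows "b = (\<Sum>k\<in>orb i. affine_coeff b m k *\<^sub>R \<alpha> k)"
proof -
  have "b = (\<Sum>k\<in>{0..l}. affine_coeff b m k *\<^sub>R \<alpha> k)" by (rule affine_expansion [symmetric])
  also have "\<dots> = (\<Sum>k\<in>orb i. affine_coeff b m k *\<^sub>R \<alpha> k)"
    using orb_subset [OF i] off by (intro sum.mono_neutral_right) auto
  finally show ?thesis .
qed

text \<open>These facts describe a row of the Cartan matrix of the orbit. Pairing with the orbit sum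
  sees only \<open>P (\<alpha> s)\<close>, so all rows have the same sum, which is positive because
  \<open>P (\<alpha> i)\<close> is nonzero.\<close>

lemma orbit_degree:
  assumes i: "i \<in> {0..l}" and nz: "P (\<alpha> i) \<noteq> 0" and s: "s \<in> orb i"
  defines "N \<equiv> \<alpha> i \<bullet> \<alpha> i"
  shows "(\<Sum>t\<in>orb i. 2 * (\<alpha> s \<bullet> \<alpha> t) / N) = 2 * (real (card (orb i)) * (P (\<alpha> i) \<bullet> P (\<alpha> i))) / N"
    and "(\<Sum>t\<in>orb i. 2 * (\<alpha> s \<bullet> \<alpha> t) / N) = 2 + (\<Sum>t\<in>orb i - {s}. 2 * (\<alpha> s \<bullet> \<alpha> t) / N)"
    and "t \<in> orb i \<Longrightarrow> 2 * (\<alpha> s \<bullet> \<alpha> t) / N \<in> \<int>"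
    and "t \<in> orb i \<Longrightarrow> t \<noteq> s \<Longrightarrow> 2 * (\<alpha> s \<bullet> \<alpha> t) / N \<le> 0"
    and "N > 0"
proof -
  have "\<alpha> i \<noteq> 0" using nz avg_linear(5) by metis
  then show N: "N > 0" by (simp add: N_def)
  have "(\<Sum>t\<in>orb i. 2 * (\<alpha> s \<bullet> \<alpha> t) / N) = 2 * (\<alpha> s \<bullet> (\<Sum>t\<in>orb i. \<alpha> t)) / N"
    by (simp add: inner_sum_right sum_distrib_left sum_divide_distrib)
  also have "\<dots> = 2 * (real (card (orb i)) * (\<alpha> s \<bullet> P (\<alpha> i))) / N"
    unfolding sum_orb [OF i] by simp
  also have "\<alpha> s \<bullet> P (\<alpha> i) = P (\<alpha> i) \<bullet> P (\<alpha> i)"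
    using avg_inner [of "\<alpha> s" "\<alpha> i"] avg_alpha [OF i s] by simp
  finally show "(\<Sum>t\<in>orb i. 2 * (\<alpha> s \<bullet> \<alpha> t) / N) = 2 * (real (card (orb i)) * (P (\<alpha> i) \<bullet> P (\<alpha> i))) / N" .
  have sN: "\<alpha> s \<bullet> \<alpha> s = N" using alpha_norm [OF i s] N_def by simp
  then show "(\<Sum>t\<in>orb i. 2 * (\<alpha> s \<bullet> \<alpha> t) / N) = 2 + (\<Sum>t\<in>orb i - {s}. 2 * (\<alpha> s \<bullet> \<alpha> t) / N)"
    using sum.remove [OF finite_orb s, of "\<lambda>t. 2 * (\<alpha> s \<bullet> \<alpha> t) / N"] N by simp
  show "2 * (\<alpha> s \<bullet> \<alpha> t) / N \<in> \<int>" if "t \<in> orb i"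
  proof -
    have "\<alpha> s \<in> \<Phi>" "\<alpha> t \<in> \<Phi>" using alpha_root orb_subset [OF i] s that by blast+
    then show ?thesis using cartan_int [of "\<alpha> t" "\<alpha> s"] sN by (simp add: inner_commute)
  qed
  show "2 * (\<alpha> s \<bullet> \<alpha> t) / N \<le> 0" if "t \<in> orb i" "t \<noteq> s"
  proof -
    have "s \<in> {0..l}" "t \<in> {0..l}" using orb_subset [OF i] s that by blast+
    then show ?thesis using alpha_inner_nonpos [of s t] that N by (simp add: divide_le_0_iff)
  qed
qed

lemma folding_set_A1:
  assumes i: "i \<in> {0..l}"
    and ortho: "\<And>s t. s \<in> orb i \<Longrightarrow> t \<in> orb i \<Longrightarrow> s \<noteq> t \<Longrightarrow> \<alpha> s \<bullet> \<alpha> t = 0"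
  shows "folding_set i 1 (\<alpha> ` orb i)"
  unfolding folding_set_def
proof (intro conjI ballI allI impI)
  have sub: "orb i \<subseteq> {0..l}" using orb_subset i .
  have inj: "inj_on \<alpha> (orb i)" using inj_on_subset [OF inj_alpha sub] .
  show "\<alpha> ` orb i \<subseteq> \<Phi>" using alpha_root sub by auto
  show "pairwise (\<lambda>a b. a \<bullet> b = 0) (\<alpha> ` orb i)" using ortho by (auto simp: pairwise_def)
  show "(\<Sum>a\<in>\<alpha> ` orb i. a) = (\<Sum>s\<in>orb i. \<alpha> s)" using inj by (simp add: sum.reindex)
  fix a assume "a \<in> \<alpha> ` orb i"
  then obtain s where s: "s \<in> orb i" "a = \<alpha> s" by blast
  show "a \<bullet> a = \<alpha> i \<bullet> \<alpha> i" using alpha_norm i s by blast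
  show "P a = of_nat 1 *\<^sub>R P (\<alpha> i)" using avg_alpha [OF i s(1)] s(2) by simp
  show "\<exists>m. \<forall>k\<in>{0..l} - orb i. affine_coeff a m k = 0"
  proof -
    obtain m where m: "\<forall>k\<in>{0..l}. affine_coeff (\<alpha> s) m k = (if s = k then 1 else 0)"
      using affine_coeff_alpha' s sub by blast
    show ?thesis by (rule exI [of _ m]) (use m s in auto)
  qed
next
  have sub: "orb i \<subseteq> {0..l}" using orb_subset i .
  fix b m assume b: "b \<in> \<Phi>" and c: "\<forall>k\<in>{0..l}. affine_coeff b m k \<ge> 0"
    and off: "\<forall>k\<in>{0..l} - orb i. affine_coeff b m k = 0"
  let ?c = "affine_coeff b m"
  have be: "b = (\<Sum>k\<in>orb i. ?c k *\<^sub>R \<alpha> k)" using supported_expansion [OF i off] .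
  have "b \<noteq> 0" using b zero_notin by auto
  then obtain s where s: "s \<in> orb i" "?c s \<noteq> 0"
    using be by (metis (no_types, lifting) scale_eq_0_iff sum.neutral)
  then have sI: "s \<in> {0..l}" using sub by blast
  have sp: "?c s > 0" using s c sub by force
  have as: "\<alpha> s \<in> \<Phi>" "\<alpha> s \<bullet> \<alpha> s \<noteq> 0" using alpha_root [OF sI] zero_notin by auto
  have "b \<bullet> \<alpha> s = (\<Sum>k\<in>orb i. if k = s then ?c k * (\<alpha> s \<bullet> \<alpha> s) else 0)"
    by (subst be, unfold inner_sum_left, rule sum.cong) (use ortho s in auto)
  then have bs: "b \<bullet> \<alpha> s = ?c s * (\<alpha> s \<bullet> \<alpha> s)" using s finite_orb by simp
  obtain ms where ms: "\<forall>k\<in>{0..l}. affine_coeff (\<alpha> s) ms k = (if s = k then 1 else 0)"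
    using affine_coeff_alpha' [OF sI] by blast
  obtain m' where m': "affine_coeff (reflection (\<alpha> s) b) m' k = ?c k - (2 * (b \<bullet> \<alpha> s) / (\<alpha> s \<bullet> \<alpha> s)) * affine_coeff (\<alpha> s) ms k" for k
    using affine_coeff_reflection [OF b as(1)] by metis
  have r: "reflection (\<alpha> s) b \<in> \<Phi>" using reflection_root as b by blast
  \<comment> \<open>The reflection makes the positive coefficient at \<open>s\<close> negative and
    changes no other, so sign coherence forces the others to vanish.\<close>
  have "affine_coeff (reflection (\<alpha> s) b) m' s = - ?c s" using m' [of s] ms sI bs as by simp
  then have "affine_coeff (reflection (\<alpha> s) b) m' k \<le> 0" if "k \<in> {0..l}" for k
    using affine_coeff_neg [OF r sI _ that, of m'] sp by simp
  then have "?c k \<le> 0" if "k \<in> {0..l}" "k \<noteq> s" for k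
    using m' [of k] ms that by force
  then have "b = (\<Sum>k\<in>orb i. if k = s then ?c s *\<^sub>R \<alpha> s else 0)"
    using be c sub by (subst be, intro sum.cong) (force intro: antisym)+
  then have b_eq: "b = ?c s *\<^sub>R \<alpha> s" using s finite_orb by simp
  then have "?c s = 1" using multiple_root [OF as(1), of "?c s"] b sp by auto
  then have "P b = of_nat 1 *\<^sub>R P (\<alpha> i)" using b_eq avg_alpha [OF i s(1)] by simp
  then show "\<exists>C\<in>{1,2::nat}. C dvd 1 \<and> P b = of_nat C *\<^sub>R P (\<alpha> i)"
    by (intro bexI [of _ 1]) auto
qed

lemma folding_set_A2:
  assumes i: "i \<in> {0..l}" and nz: "P (\<alpha> i) \<noteq> 0"
    and p: "\<And>s. s \<in> orb i \<Longrightarrow> p s \<in> orb i \<and> p s \<noteq> s \<and> 2 * (\<alpha> s \<bullet> \<alpha> (p s)) = - (\<alpha> i \<bullet> \<alpha> i)"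
    and ortho: "\<And>s t. s \<in> orb i \<Longrightarrow> t \<in> orb i \<Longrightarrow> t \<noteq> s \<Longrightarrow> t \<noteq> p s \<Longrightarrow> \<alpha> s \<bullet> \<alpha> t = 0"
  shows "folding_set i 2 ((\<lambda>s. \<alpha> s + \<alpha> (p s)) ` orb i)"
proof -
  define r where "r s = \<alpha> s + \<alpha> (p s)" for s
  define N where "N = \<alpha> i \<bullet> \<alpha> i"
  have sub: "orb i \<subseteq> {0..l}" using orb_subset i .
  have "\<alpha> i \<noteq> 0" using nz avg_linear(5) by metis
  then have N: "N > 0" by (simp add: N_def)
  have pO: "p s \<in> orb i" "p s \<noteq> s" "\<alpha> s \<bullet> \<alpha> (p s) = - N / 2" if "s \<in> orb i" for s
    using p [OF that] by (auto simp: N_def)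
  have nrm: "\<alpha> s \<bullet> \<alpha> s = N" if "s \<in> orb i" for s using alpha_norm [OF i that] by (simp add: N_def)
  \<comment> \<open>Each node has a single neighbour in its orbit, and \<open>s\<close> is not
    orthogonal to \<open>p s\<close>.\<close>
  have pp: "p (p s) = s" if "s \<in> orb i" for s
    using ortho [of "p s" s] pO [OF that] that N by (force simp: inner_commute)
  have root: "\<alpha> s \<in> \<Phi>" if "s \<in> orb i" for s using that sub alpha_root by blast
  have r_root: "r s \<in> \<Phi>" if "s \<in> orb i" for s
  proof -
    have "reflection (\<alpha> s) (\<alpha> (p s)) = r s"
      using pO [OF that] nrm [OF that] N by (simp add: reflection_def r_def)
    then show ?thesis using reflection_root root that pO by metis
  qed
  have ar: "\<alpha> k \<bullet> r s = (if k = s \<or> k = p s then N / 2 else 0)" if "k \<in> orb i" "s \<in> orb i" for k s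
  proof -
    consider "k = s" | "k = p s" | "k \<noteq> s" "k \<noteq> p s" by blast
    then show ?thesis
    proof cases
      case 3
      have "\<alpha> k \<bullet> \<alpha> s = 0" using ortho [of s k] that 3 by (simp add: inner_commute)
      moreover have "\<alpha> k \<bullet> \<alpha> (p s) = 0"
        using ortho [of "p s" k] that 3 pO pp by (simp add: inner_commute)
      ultimately show ?thesis using 3 by (simp add: r_def inner_add_right)
    qed (use that pO nrm in \<open>auto simp: r_def inner_add_right inner_commute\<close>)
  qed
  have rr: "r t \<bullet> r s = (if t = s \<or> t = p s then N else 0)" if "t \<in> orb i" "s \<in> orb i" for t s
  proof -
    have "p t = s \<longleftrightarrow> t = p s" using pp that by auto
    moreover have "p t = p s \<longleftrightarrow> t = s" using pp that by metis
    ultimately have "\<alpha> (p t) \<bullet> r s = \<alpha> t \<bullet> r s" using ar [of "p t" s] ar [of t s] that pO by auto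
    then show ?thesis using ar [of t s] that by (simp add: r_def [of t] inner_add_left)
  qed
  have rp: "r (p s) = r s" if "s \<in> orb i" for s using pp that by (simp add: r_def)
  have Pr: "P (r s) = 2 *\<^sub>R P (\<alpha> i)" if "s \<in> orb i" for s
    using avg_alpha [OF i] that pO by (simp add: r_def scaleR_2)
  have r_coeff: "\<exists>m. \<forall>k\<in>{0..l}. affine_coeff (r s) m k = (if k = s \<or> k = p s then 1 else 0)"
    if s: "s \<in> orb i" for s
  proof -
    obtain m where m: "\<forall>k\<in>{0..l}. affine_coeff (\<alpha> s) m k = (if s = k then 1 else 0)"
      using affine_coeff_alpha' s sub by blast
    obtain m' where m': "\<forall>k\<in>{0..l}. affine_coeff (\<alpha> (p s)) m' k = (if p s = k then 1 else 0)"
      using affine_coeff_alpha' pO [OF s] sub by blast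
    show ?thesis
      by (rule exI [of _ "m + m'"]) (use m m' pO(2) [OF s] in \<open>auto simp: r_def affine_coeff_add\<close>)
  qed
  have "folding_set i 2 (r ` orb i)"
    unfolding folding_set_def
  proof (intro conjI ballI allI impI)
    show "r ` orb i \<subseteq> \<Phi>" using r_root by auto
    show "pairwise (\<lambda>a b. a \<bullet> b = 0) (r ` orb i)"
      using rr rp by (fastforce simp: pairwise_def)
    have "(\<Sum>s\<in>orb i. \<alpha> s) = (\<Sum>a\<in>r ` orb i. \<Sum>s | s \<in> orb i \<and> r s = a. \<alpha> s)"
      by (rule sum.image_gen [OF finite_orb])
    also have "\<dots> = (\<Sum>a\<in>r ` orb i. a)"
    proof (rule sum.cong [OF refl])
      fix a assume "a \<in> r ` orb i"
      then obtain t where t: "t \<in> orb i" "a = r t" by blast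
      \<comment> \<open>The two nodes of a component give the same highest root, so summing over the
        fibres of \<open>r\<close> counts each component once.\<close>
      have "{s. s \<in> orb i \<and> r s = a} = {t, p t}"
      proof -
        have "s \<in> {t, p t}" if "s \<in> orb i" "r s = r t" for s
          using rr [OF that(1) t(1)] rr [OF t(1) t(1)] that N by (auto split: if_splits)
        then show ?thesis using t pO [OF t(1)] rp [OF t(1)] by auto
      qed
      then show "(\<Sum>s | s \<in> orb i \<and> r s = a. \<alpha> s) = a" using t pO(2) [OF t(1)] by (auto simp: r_def)
    qed
    finally show "(\<Sum>a\<in>r ` orb i. a) = (\<Sum>s\<in>orb i. \<alpha> s)" by simp
    fix a assume "a \<in> r ` orb i"
    then obtain s where s: "s \<in> orb i" "a = r s" by blast
    show "a \<bullet> a = \<alpha> i \<bullet> \<alpha> i" using rr [of s s] s by (simp add: N_def)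
    show "P a = of_nat 2 *\<^sub>R P (\<alpha> i)" using Pr s by simp
    show "\<exists>m. \<forall>k\<in>{0..l} - orb i. affine_coeff a m k = 0"
    proof -
      obtain m where m: "\<forall>k\<in>{0..l}. affine_coeff (r s) m k = (if k = s \<or> k = p s then 1 else 0)"
        using r_coeff s by blast
      show ?thesis by (rule exI [of _ m]) (use m s pO(1) [OF s(1)] in auto)
    qed
  next
    fix b m assume b: "b \<in> \<Phi>" and c: "\<forall>k\<in>{0..l}. affine_coeff b m k \<ge> 0"
      and off: "\<forall>k\<in>{0..l} - orb i. affine_coeff b m k = 0"
    let ?c = "affine_coeff b m"
    have be: "b = (\<Sum>k\<in>orb i. ?c k *\<^sub>R \<alpha> k)" using supported_expansion [OF i off] .
    have "b \<noteq> 0" using b zero_notin by auto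
    then obtain s where s: "s \<in> orb i" "?c s \<noteq> 0"
      using be by (metis (no_types, lifting) scale_eq_0_iff sum.neutral)
    then have sI: "s \<in> {0..l}" "p s \<in> {0..l}" using sub pO by blast+
    have sp: "?c s > 0" using s c sub by force
    have pos: "?c (p s) \<ge> 0" using c sI by blast
    have "b \<bullet> r s = (\<Sum>k\<in>orb i. ?c k * (\<alpha> k \<bullet> r s))"
      by (subst be) (simp add: inner_sum_left)
    also have "\<dots> = (\<Sum>k\<in>{s, p s}. ?c k * (\<alpha> k \<bullet> r s))"
      using s pO [OF s(1)] finite_orb ar by (intro sum.mono_neutral_right) auto
    finally have bs: "b \<bullet> r s = (?c s + ?c (p s)) * N / 2"
      using s pO [OF s(1)] ar by (simp add: algebra_simps add_divide_distrib)
    obtain ms where ms: "\<forall>k\<in>{0..l}. affine_coeff (r s) ms k = (if k = s \<or> k = p s then 1 else 0)"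
      using r_coeff [OF s(1)] by blast
    obtain m' where m': "affine_coeff (reflection (r s) b) m' k = ?c k - (2 * (b \<bullet> r s) / (r s \<bullet> r s)) * affine_coeff (r s) ms k" for k
      using affine_coeff_reflection [OF b r_root [OF s(1)]] by metis
    have m'': "affine_coeff (reflection (r s) b) m' k = ?c k - (?c s + ?c (p s)) * affine_coeff (r s) ms k" for k
      using m' [of k] bs rr [of s s] s N by simp
    have ref: "reflection (r s) b \<in> \<Phi>" using reflection_root r_root s b by blast
    \<comment> \<open>Up to sign, this reflection exchanges the coefficients at \<open>s\<close> and
      \<open>p s\<close> and keeps all others, so again the others vanish.\<close>
    have "affine_coeff (reflection (r s) b) m' (p s) = - ?c s"
      using m'' [of "p s"] ms sI by simp
    then have neg: "affine_coeff (reflection (r s) b) m' k \<le> 0" if "k \<in> {0..l}" for k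
      using affine_coeff_neg [OF ref sI(2) _ that, of m'] sp by simp
    have z: "?c k = 0" if "k \<in> {0..l}" "k \<noteq> s" "k \<noteq> p s" for k
      using m'' [of k] ms that neg [OF that(1)] c by force
    have "b = (\<Sum>k\<in>{s, p s}. ?c k *\<^sub>R \<alpha> k)"
      by (subst be, rule sum.mono_neutral_right) (use s pO [OF s(1)] finite_orb z sub in auto)
    then have b_eq: "b = ?c s *\<^sub>R \<alpha> s + ?c (p s) *\<^sub>R \<alpha> (p s)" using pO(2) [OF s(1)] by simp
    \<comment> \<open>Reflecting in \<open>\<alpha> t\<close> replaces \<open>?c t\<close> by
      \<open>?c (p t) - ?c t\<close>, which must be nonnegative while \<open>?c (p t)\<close> is
      positive. Used at both nodes, this makes two positive coefficients equal.\<close>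
    have comp: "?c t \<le> ?c (p t)" if t: "t \<in> orb i" "?c (p t) > 0" "b = ?c t *\<^sub>R \<alpha> t + ?c (p t) *\<^sub>R \<alpha> (p t)" for t
    proof -
      have tI: "t \<in> {0..l}" "p t \<in> {0..l}" using t pO sub by blast+
      have bt: "2 * (b \<bullet> \<alpha> t) / (\<alpha> t \<bullet> \<alpha> t) = 2 * ?c t - ?c (p t)"
      proof -
        have "b \<bullet> \<alpha> t = ?c t * (\<alpha> t \<bullet> \<alpha> t) + ?c (p t) * (\<alpha> t \<bullet> \<alpha> (p t))"
          by (subst t(3)) (simp add: inner_add_left inner_commute [of "\<alpha> (p t)"])
        then show ?thesis using pO(3) [OF t(1)] nrm [OF t(1)] N by (simp add: field_simps)
      qed
      obtain mt where mt: "\<forall>k\<in>{0..l}. affine_coeff (\<alpha> t) mt k = (if t = k then 1 else 0)"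
        using affine_coeff_alpha' [OF tI(1)] by blast
      obtain m2 where m2: "affine_coeff (reflection (\<alpha> t) b) m2 k = ?c k - (2 * (b \<bullet> \<alpha> t) / (\<alpha> t \<bullet> \<alpha> t)) * affine_coeff (\<alpha> t) mt k" for k
        using affine_coeff_reflection [OF b root [OF t(1)]] by metis
      have "reflection (\<alpha> t) b \<in> \<Phi>" using reflection_root root t b by blast
      moreover have "affine_coeff (reflection (\<alpha> t) b) m2 (p t) = ?c (p t)"
        using m2 [of "p t"] mt tI pO(2) [OF t(1)] by auto
      ultimately have "affine_coeff (reflection (\<alpha> t) b) m2 t \<ge> 0"
        using affine_coeff_pos tI t(2) by metis
      then show ?thesis using m2 [of t] mt tI bt by simp
    qed
    show "\<exists>C\<in>{1,2::nat}. C dvd 2 \<and> P b = of_nat C *\<^sub>R P (\<alpha> i)"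
    proof (cases "?c (p s) = 0")
      case True
      then have "b = ?c s *\<^sub>R \<alpha> s" using b_eq by simp
      moreover have "?c s = 1" using multiple_root [OF root [OF s(1)], of "?c s"] b sp calculation by auto
      ultimately have "P b = of_nat 1 *\<^sub>R P (\<alpha> i)" using avg_alpha [OF i s(1)] by simp
      then show ?thesis by (intro bexI [of _ 1]) auto
    next
      case False
      then have "?c s \<le> ?c (p s)" using comp [of s] s pos b_eq by simp
      moreover have "?c (p s) \<le> ?c s" using comp [of "p s"] s pO [OF s(1)] pp [OF s(1)] sp b_eq by (simp add: add.commute)
      ultimately have "b = ?c s *\<^sub>R r s" using b_eq by (simp add: r_def scaleR_add_right)
      moreover have "?c s = 1" using multiple_root [OF r_root [OF s(1)], of "?c s"] b sp calculation by auto
      ultimately have "P b = of_nat 2 *\<^sub>R P (\<alpha> i)" using Pr [OF s(1)] by simp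
      then show ?thesis by (intro bexI [of _ 2]) auto
    qed
  qed
  then show ?thesis by (simp add: r_def [abs_def])
qed

lemma folding_set_exists:
  assumes i: "i \<in> {0..l}" and nz: "P (\<alpha> i) \<noteq> 0"
  shows "\<exists>e R. e > 0 \<and> folding_set i e R"
proof -
  define N where "N = \<alpha> i \<bullet> \<alpha> i"
  define c where "c s t = 2 * (\<alpha> s \<bullet> \<alpha> t) / N" for s t
  define d where "d = 2 * (real (card (orb i)) * (P (\<alpha> i) \<bullet> P (\<alpha> i))) / N"
  note deg = orbit_degree [OF i nz, folded N_def, folded c_def d_def]
  have N: "N > 0" using deg(5) self_in_orb by blast
  have ii: "i \<in> orb i" by (rule self_in_orb)
  have "card (orb i) > 0" using ii finite_orb card_gt_0_iff by blast
  then have dp: "d > 0" using nz N by (simp add: d_def)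
  have rest: "(\<Sum>t\<in>orb i - {s}. c s t) = d - 2" if "s \<in> orb i" for s
    using deg(1,2) [OF that] by simp
  have "d - 2 \<in> \<int>" using rest [OF ii] deg(3) [OF ii] by (metis DiffD1 Ints_sum)
  then obtain z where z: "d - 2 = of_int z" by (elim Ints_cases)
  moreover have "d - 2 \<le> 0" using rest [OF ii] deg(4) [OF ii] by (metis DiffE insertI1 sum_nonpos)
  \<comment> \<open>\<open>z\<close> is the off-diagonal total of a row. Nonpositive integers with
    total 0 all vanish; total -1 means exactly one neighbour, with entry -1.\<close>
  ultimately have "z \<le> 0" "z > - 2" using dp by linarith+
  then consider "z = 0" | "z = - 1" by linarith
  then consider "d - 2 = 0" | "d - 2 = -1" using z by cases auto
  then show ?thesis
  proof cases
    case 1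
    have "\<alpha> s \<bullet> \<alpha> t = 0" if "s \<in> orb i" "t \<in> orb i" "s \<noteq> t" for s t
    proof -
      have "(\<Sum>t\<in>orb i - {s}. - c s t) = 0" using rest [OF that(1)] 1 by (simp add: sum_negf)
      then have "- c s t = 0"
        using sum_nonneg_eq_0_iff [of "orb i - {s}" "\<lambda>t. - c s t"] deg(4) [OF that(1)] finite_orb that by auto
      then show ?thesis using N by (simp add: c_def)
    qed
    then show ?thesis using folding_set_A1 [OF i] by (intro exI [of _ 1]) auto
  next
    case 2
    have "\<exists>t. t \<in> orb i \<and> t \<noteq> s \<and> c s t = -1 \<and> (\<forall>u\<in>orb i. u \<noteq> s \<longrightarrow> u \<noteq> t \<longrightarrow> c s u = 0)"
      if s: "s \<in> orb i" for s
    proof -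
      have "\<exists>t\<in>orb i - {s}. c s t \<noteq> 0"
        using rest [OF s] 2 by (metis sum.neutral zero_neq_neg_one)
      then obtain t where t: "t \<in> orb i" "t \<noteq> s" "c s t \<noteq> 0" by auto
      have "c s t < 0" using deg(4) [OF s t(1,2)] t(3) by simp
      moreover obtain z where "c s t = of_int z" using deg(3) [OF s t(1)] Ints_cases by blast
      ultimately have le: "c s t \<le> -1" by simp
      have fin: "finite (orb i - {s} - {t})" using finite_orb by simp
      have e: "c s t + (\<Sum>u\<in>orb i - {s} - {t}. c s u) = -1"
        using sum.remove [of "orb i - {s}" t "c s"] finite_orb t rest [OF s] 2 by simp
      have np: "(\<Sum>u\<in>orb i - {s} - {t}. c s u) \<le> 0" using deg(4) [OF s] by (intro sum_nonpos) auto
      have z: "(\<Sum>u\<in>orb i - {s} - {t}. - c s u) = 0"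
      proof -
        have "c s t \<ge> -1" using e np by simp
        then show ?thesis using e le np by (simp add: sum_negf)
      qed
      then have "c s u = 0" if "u \<in> orb i" "u \<noteq> s" "u \<noteq> t" for u
        using sum_nonneg_eq_0_iff [OF fin, of "\<lambda>u. - c s u"] deg(4) [OF s] that by auto
      moreover have "c s t = -1" using e z by (simp add: sum_negf)
      ultimately show ?thesis using t by blast
    qed
    then obtain p where p: "\<And>s. s \<in> orb i \<Longrightarrow> p s \<in> orb i \<and> p s \<noteq> s \<and> c s (p s) = -1 \<and>
      (\<forall>u\<in>orb i. u \<noteq> s \<longrightarrow> u \<noteq> p s \<longrightarrow> c s u = 0)" by metis
    have "folding_set i 2 ((\<lambda>s. \<alpha> s + \<alpha> (p s)) ` orb i)"
    proof (rule folding_set_A2 [OF i nz])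
      show "p s \<in> orb i \<and> p s \<noteq> s \<and> 2 * (\<alpha> s \<bullet> \<alpha> (p s)) = - (\<alpha> i \<bullet> \<alpha> i)" if "s \<in> orb i" for s
        using p [OF that] N by (simp add: c_def N_def field_simps)
      show "\<alpha> s \<bullet> \<alpha> t = 0" if "s \<in> orb i" "t \<in> orb i" "t \<noteq> s" "t \<noteq> p s" for s t
        using p [OF that(1)] that N by (auto simp: c_def)
    qed
    then show ?thesis by (intro exI [of _ 2]) auto
  qed
qed

text \<open>The squared norm of the orbit sum is computed twice: as a multiple of
  \<open>P (\<alpha> i)\<close>, and from the orthogonal roots in \<open>R\<close>. Averaging the
  latter sum shows that the orbit has \<open>e\<close> times as many elements as
  \<open>R\<close>.\<close>

lemma folding_set_norm:
  assumes i: "i \<in> {0..l}" and nz: "P (\<alpha> i) \<noteq> 0" and f: "folding_set i e R" and e: "e > 0"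
  shows "of_nat (card (orb i)) * of_nat e * (P (\<alpha> i) \<bullet> P (\<alpha> i)) = \<alpha> i \<bullet> \<alpha> i"
proof -
  let ?u = "\<Sum>s\<in>orb i. \<alpha> s" and ?p = "P (\<alpha> i)" and ?o = "real (card (orb i))" and ?N = "\<alpha> i \<bullet> \<alpha> i"
  have R: "R \<subseteq> \<Phi>" "pairwise (\<lambda>a b. a \<bullet> b = 0) R" "(\<Sum>a\<in>R. a) = ?u"
    and Ra: "\<And>a. a \<in> R \<Longrightarrow> a \<bullet> a = ?N \<and> P a = of_nat e *\<^sub>R ?p"
    using f unfolding folding_set_def by blast+
  have fin: "finite R" using R finite_roots finite_subset by blast
  have "card (orb i) > 0" using self_in_orb finite_orb card_gt_0_iff by blast
  then have u: "?u = ?o *\<^sub>R ?p" "?u \<noteq> 0" using sum_orb [OF i] nz by auto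
  then have "R \<noteq> {}" using R(3) by auto
  have "P ?u = (\<Sum>a\<in>R. of_nat e *\<^sub>R ?p)" using Ra by (simp flip: R(3))
  then have "?o *\<^sub>R ?p = (real (card R) * of_nat e) *\<^sub>R ?p"
    using u(1) by (simp add: sum_constant_scaleR del: sum_constant)
  then have o: "?o = real (card R) * of_nat e" using nz by simp
  have "a \<bullet> ?u = ?N" if "a \<in> R" for a
  proof -
    have "a \<bullet> ?u = (\<Sum>b\<in>R. if b = a then a \<bullet> a else 0)"
      using R(2) that unfolding R(3) [symmetric] inner_sum_right
      by (intro sum.cong) (auto simp: pairwise_def)
    then show ?thesis using Ra [OF that] fin that by simp
  qed
  then have "?u \<bullet> ?u = real (card R) * ?N"
    by (subst (1) R(3) [symmetric]) (simp add: inner_sum_left)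
  then have "?o * ?o * (?p \<bullet> ?p) = real (card R) * ?N" using u(1) by simp
  then have "real (card R) * (?o * of_nat e * (?p \<bullet> ?p)) = real (card R) * ?N"
    by (simp add: o mult_ac)
  moreover have "real (card R) \<noteq> 0" using \<open>R \<noteq> {}\<close> fin by simp
  ultimately show ?thesis by (metis mult_left_cancel)
qed

text \<open>This serves twice: it makes the product of the reflections in \<open>R\<close> act on
  averages as one reflection, and it shows that restricted Cartan numbers are divisible by
  \<open>e\<close>, which is needed when \<open>P b\<close> is twice
  \<open>P (\<alpha> i)\<close>.\<close>

lemma folding_set_cartan:
  assumes i: "i \<in> {0..l}" and nz: "P (\<alpha> i) \<noteq> 0" and f: "folding_set i e R" and e: "e > 0"
  shows "2 * (P b \<bullet> P (\<alpha> i)) / (P (\<alpha> i) \<bullet> P (\<alpha> i)) = of_nat e * (\<Sum>a\<in>R. 2 * (b \<bullet> a) / (a \<bullet> a))"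
proof -
  let ?p = "P (\<alpha> i)" and ?o = "real (card (orb i))" and ?N = "\<alpha> i \<bullet> \<alpha> i"
  have nrm: "?N = ?o * of_nat e * (?p \<bullet> ?p)" using folding_set_norm assms by metis
  have "card (orb i) > 0" using self_in_orb finite_orb card_gt_0_iff by blast
  have "(\<Sum>a\<in>R. 2 * (b \<bullet> a) / (a \<bullet> a)) = (\<Sum>a\<in>R. 2 * (b \<bullet> a) / ?N)"
    using f unfolding folding_set_def by (intro sum.cong) auto
  also have "\<dots> = 2 * (b \<bullet> (\<Sum>a\<in>R. a)) / ?N"
    by (simp add: inner_sum_right sum_distrib_left sum_divide_distrib)
  also have "(\<Sum>a\<in>R. a) = ?o *\<^sub>R ?p" using f sum_orb [OF i] unfolding folding_set_def by metis
  also have "2 * (b \<bullet> (?o *\<^sub>R ?p)) / ?N = 2 * (P b \<bullet> ?p) / (of_nat e * (?p \<bullet> ?p))"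
    using \<open>card (orb i) > 0\<close> unfolding nrm by (simp add: avg_inner)
  finally show ?thesis using e by simp
qed

lemma folding_reflection:
  assumes i: "i \<in> {0..l}" and nz: "P (\<alpha> i) \<noteq> 0" and b: "b \<in> \<Phi>"
  shows "\<exists>b'\<in>\<Phi>. \<exists>m'. P b' = reflection (P (\<alpha> i)) (P b) \<and>
    (\<forall>k\<in>{0..l} - orb i. affine_coeff b' m' k = affine_coeff b m k)"
proof -
  obtain e R where e: "e > 0" and f: "folding_set i e R" using folding_set_exists i nz by blast
  let ?b = "b - (\<Sum>a\<in>R. (2 * (b \<bullet> a) / (a \<bullet> a)) *\<^sub>R a)"
  have R: "R \<subseteq> \<Phi>" "pairwise (\<lambda>a b. a \<bullet> b = 0) R"
    and Ra: "\<And>a. a \<in> R \<Longrightarrow> P a = of_nat e *\<^sub>R P (\<alpha> i) \<and> (\<exists>m. \<forall>k\<in>{0..l} - orb i. affine_coeff a m k = 0)"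
    using f unfolding folding_set_def by blast+
  have fin: "finite R" using R finite_roots finite_subset by blast
  have "?b \<in> \<Phi> \<and> (\<exists>m'. \<forall>k\<in>{0..l} - orb i. affine_coeff ?b m' k = affine_coeff b m k)"
    by (rule orthogonal_product [OF fin R b]) (use Ra in blast)
  moreover have "P ?b = reflection (P (\<alpha> i)) (P b)"
  proof -
    have "P ?b = P b - (\<Sum>a\<in>R. (2 * (b \<bullet> a) / (a \<bullet> a)) *\<^sub>R (of_nat e *\<^sub>R P (\<alpha> i)))"
      using Ra by simp
    also have "\<dots> = P b - (of_nat e * (\<Sum>a\<in>R. 2 * (b \<bullet> a) / (a \<bullet> a))) *\<^sub>R P (\<alpha> i)"
      by (simp add: sum_distrib_left mult.commute flip: scaleR_sum_left)
    finally show ?thesis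
      by (simp only: reflection_eq folding_set_cartan [OF i nz f e])
  qed
  ultimately show ?thesis by blast
qed

section \<open>Restricted roots and the root system axioms\<close>

definition cartan_multiple :: "nat \<Rightarrow> real \<Rightarrow> bool" where
  "cartan_multiple i C \<longleftrightarrow>
     C > 0 \<and> (\<forall>b\<in>\<Phi>. 2 * (P b \<bullet> P (\<alpha> i)) / (P (\<alpha> i) \<bullet> P (\<alpha> i)) / C \<in> \<int>)"

text \<open>Replacing \<open>P (\<alpha> i)\<close> by its \<open>C\<close>-fold divides Cartan
  numbers by \<open>C\<close>; they stay integral because \<open>C\<close> divides \<open>e\<close>.
  That is what \<open>cartan_multiple\<close> records.\<close>

lemma supported_multiple:
  assumes i: "i \<in> {0..l}" and nz: "P (\<alpha> i) \<noteq> 0" and b: "b \<in> \<Phi>"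
    and c: "\<forall>k\<in>{0..l}. affine_coeff b m k \<ge> 0" and off: "\<forall>k\<in>{0..l} - orb i. affine_coeff b m k = 0"
  shows "\<exists>C. cartan_multiple i C \<and> P b = C *\<^sub>R P (\<alpha> i)"
proof -
  obtain e R where e: "e > 0" and f: "folding_set i e R" using folding_set_exists i nz by blast
  then obtain C where C: "C \<in> {1,2::nat}" "C dvd e" "P b = of_nat C *\<^sub>R P (\<alpha> i)"
    using b c off unfolding folding_set_def by blast
  obtain q where q: "e = C * q" using C(2) by blast
  have "2 * (P b \<bullet> P (\<alpha> i)) / (P (\<alpha> i) \<bullet> P (\<alpha> i)) / of_nat C \<in> \<int>" if "b \<in> \<Phi>" for b
  proof -
    have "(\<Sum>a\<in>R. 2 * (b \<bullet> a) / (a \<bullet> a)) \<in> \<int>"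
      using cartan_int [OF that] f unfolding folding_set_def by (intro Ints_sum) blast
    then have "of_nat q * (\<Sum>a\<in>R. 2 * (b \<bullet> a) / (a \<bullet> a)) \<in> \<int>" by simp
    then show ?thesis using C(1) unfolding folding_set_cartan [OF i nz f e] q by auto
  qed
  then have "cartan_multiple i (of_nat C)" using C(1) by (auto simp: cartan_multiple_def)
  then show ?thesis using C(3) by blast
qed

text \<open>Each reflection in some \<open>P (\<alpha> i)\<close> with \<open>i \<in> K\<close> that strictly decreases the height keeps
  the affine root positive, until it becomes supported on a single orbit.\<close>

lemma restricted_root_induct:
  assumes K: "K \<subseteq> {0..l}" "\<And>i. i \<in> K \<Longrightarrow> orb i \<subseteq> K"
    and base: "\<And>i C. i \<in> K \<Longrightarrow> P (\<alpha> i) \<noteq> 0 \<Longrightarrow> cartan_multiple i C \<Longrightarrow> Q (C *\<^sub>R P (\<alpha> i))"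
    and step: "\<And>i b. i \<in> K \<Longrightarrow> P (\<alpha> i) \<noteq> 0 \<Longrightarrow> b \<in> \<Phi> \<Longrightarrow> P b \<noteq> 0 \<Longrightarrow>
      Q (reflection (P (\<alpha> i)) (P b)) \<Longrightarrow> Q (P b)"
    and b: "b \<in> \<Phi>" "\<forall>k\<in>{0..l}. affine_coeff b m k \<ge> 0" "\<forall>k\<in>{0..l} - K. affine_coeff b m k = 0"
      "P b \<noteq> 0"
  shows "Q (P b)"
  using b
proof (induction "nat \<lfloor>\<Sum>k\<in>{0..l}. affine_coeff b m k\<rfloor>" arbitrary: b m rule: less_induct)
  case less
  let ?c = "affine_coeff b m"
  have Pb: "P b = (\<Sum>k\<in>{0..l}. ?c k *\<^sub>R P (\<alpha> k))"
    by (subst affine_expansion [of b m, symmetric], simp)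
  have "P b \<bullet> P b = (\<Sum>k\<in>{0..l}. ?c k * (P (\<alpha> k) \<bullet> P b))"
    by (subst (1) Pb) (simp add: inner_sum_left)
  moreover have "P b \<bullet> P b > 0" using less.prems by simp
  moreover have "(\<Sum>k\<in>{0..l}. ?c k * (P (\<alpha> k) \<bullet> P b)) \<le> 0"
    if "\<forall>i\<in>{0..l}. \<not> ?c i * (P (\<alpha> i) \<bullet> P b) > 0"
    using that by (intro sum_nonpos) (simp add: not_less)
  \<comment> \<open>\<open>P b\<close> has positive squared norm, so some term of its expansion is
    positive; the reflection in this \<open>P (\<alpha> i)\<close> lowers the height.\<close>
  ultimately obtain i where i: "i \<in> {0..l}" "?c i * (P (\<alpha> i) \<bullet> P b) > 0" by force
  have ci: "?c i > 0" and pi: "P (\<alpha> i) \<bullet> P b > 0"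
    using i less.prems(2) zero_less_mult_iff [of "?c i"] by force+
  have iK: "i \<in> K" using ci i less.prems(3) by force
  have nz: "P (\<alpha> i) \<noteq> 0" using pi by auto
  show ?case
  proof (cases "\<forall>k\<in>{0..l} - orb i. ?c k = 0")
    case True
    then show ?thesis using supported_multiple [OF i(1) nz less.prems(1,2)] base iK nz by metis
  next
    case False
    \<comment> \<open>The reflection keeps this coefficient outside the orbit, and one positive
      coefficient keeps the whole affine root positive.\<close>
    then obtain k where k: "k \<in> {0..l} - orb i" "?c k > 0" using less.prems(2) by force
    obtain b' m' where b': "b' \<in> \<Phi>" "P b' = reflection (P (\<alpha> i)) (P b)"
      and c': "\<forall>k\<in>{0..l} - orb i. affine_coeff b' m' k = ?c k"
      using folding_reflection [OF i(1) nz less.prems(1)] by blast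
    have nn: "\<forall>k\<in>{0..l}. affine_coeff b' m' k \<ge> 0"
      using affine_coeff_pos [OF b'(1), of k m'] k c' by auto
    have off: "\<forall>k\<in>{0..l} - K. affine_coeff b' m' k = 0"
    proof
      fix k assume "k \<in> {0..l} - K"
      moreover from this have "k \<in> {0..l} - orb i" using K(2) [OF iK] by blast
      ultimately show "affine_coeff b' m' k = 0" using c' less.prems(3) by simp
    qed
    have nzb: "P b' \<noteq> 0"
      using less.prems(4) reflection_inner [of "P (\<alpha> i)" "P b" "P b"] b'(2) by auto
    define t where "t = 2 * (P b \<bullet> P (\<alpha> i)) / (P (\<alpha> i) \<bullet> P (\<alpha> i))"
    have t: "t > 0" using pi nz by (simp add: t_def inner_commute)
    have Pb': "P b' = P b - t *\<^sub>R P (\<alpha> i)" using b'(2) by (simp add: reflection_eq t_def)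
    \<comment> \<open>Coefficients change only on the orbit of \<open>i\<close>, where all averages
      are \<open>P (\<alpha> i)\<close>, so the height drops by exactly the Cartan number
      \<open>t\<close>.\<close>
    have "P b - P b' = (\<Sum>k\<in>{0..l}. (?c k - affine_coeff b' m' k) *\<^sub>R P (\<alpha> k))"
      by (subst affine_expansion [of b m, symmetric], subst affine_expansion [of b' m', symmetric])
        (simp add: scaleR_diff_left sum_subtractf)
    also have "\<dots> = (\<Sum>k\<in>orb i. (?c k - affine_coeff b' m' k) *\<^sub>R P (\<alpha> k))"
      using orb_subset [OF i(1)] c' by (intro sum.mono_neutral_right) auto
    also have "\<dots> = (\<Sum>k\<in>orb i. ?c k - affine_coeff b' m' k) *\<^sub>R P (\<alpha> i)"
      unfolding scaleR_sum_left using avg_alpha [OF i(1)] by simp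
    also have "(\<Sum>k\<in>orb i. ?c k - affine_coeff b' m' k) = (\<Sum>k\<in>{0..l}. ?c k - affine_coeff b' m' k)"
      using orb_subset [OF i(1)] c' by (intro sum.mono_neutral_left) auto
    finally have "t *\<^sub>R P (\<alpha> i) = (\<Sum>k\<in>{0..l}. ?c k - affine_coeff b' m' k) *\<^sub>R P (\<alpha> i)"
      using Pb' by simp
    then have less_sum: "(\<Sum>k\<in>{0..l}. affine_coeff b' m' k) < (\<Sum>k\<in>{0..l}. ?c k)"
      using nz t by (simp add: sum_subtractf)
    have "(\<Sum>k\<in>{0..l}. affine_coeff b' m' k) \<in> \<int>" "(\<Sum>k\<in>{0..l}. ?c k) \<in> \<int>"
      using affine_coeff_int b'(1) less.prems(1) by (auto intro!: Ints_sum)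
    then obtain x y where xy: "(\<Sum>k\<in>{0..l}. affine_coeff b' m' k) = of_int x" "(\<Sum>k\<in>{0..l}. ?c k) = of_int y"
      by (elim Ints_cases)
    moreover have "(\<Sum>k\<in>{0..l}. affine_coeff b' m' k) \<ge> 0" using nn by (intro sum_nonneg) auto
    ultimately have "nat \<lfloor>\<Sum>k\<in>{0..l}. affine_coeff b' m' k\<rfloor> < nat \<lfloor>\<Sum>k\<in>{0..l}. ?c k\<rfloor>"
      using less_sum by simp
    then have "Q (P b')" using less.hyps b'(1) nn off nzb by blast
    then show ?thesis using step [OF iK nz less.prems(1,4)] b'(2) by simp
  qed
qed

lemma restricted_rootI: "b \<in> \<Phi> \<Longrightarrow> P b \<noteq> 0 \<Longrightarrow> P b \<in> restricted_roots \<omega> \<Phi>"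
  by (auto simp: restricted_roots_def)

lemma restricted_rootE:
  assumes "x \<in> restricted_roots \<omega> \<Phi>" obtains b where "b \<in> \<Phi>" "x = P b" "P b \<noteq> 0"
  using assms by (auto simp: restricted_roots_def)

lemma restricted_reflection:
  assumes "i \<in> {0..l}" "P (\<alpha> i) \<noteq> 0" "x \<in> restricted_roots \<omega> \<Phi>"
  shows "reflection (P (\<alpha> i)) x \<in> restricted_roots \<omega> \<Phi>"
proof -
  obtain b where b: "b \<in> \<Phi>" "x = P b" "P b \<noteq> 0" using assms(3) by (rule restricted_rootE)
  obtain b' where "b' \<in> \<Phi>" "P b' = reflection (P (\<alpha> i)) x"
    using folding_reflection [OF assms(1,2) b(1)] b(2) by blast
  moreover have "reflection (P (\<alpha> i)) x \<noteq> 0"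
    using b reflection_inner [of "P (\<alpha> i)" x x] by auto
  ultimately show ?thesis using restricted_rootI by metis
qed

text \<open>Stability under the reflection in \<open>x\<close> and integrality against
  \<open>x\<close> survive moving \<open>x\<close> by a reflection in some
  \<open>P (\<alpha> i)\<close>, because such reflections preserve the restricted roots. So both go
  into one induction property.\<close>

lemma restricted_root_system: "root_system (fixed_space \<omega>) (restricted_roots \<omega> \<Phi>)"
proof -
  let ?R = "restricted_roots \<omega> \<Phi>"
  have good: "(\<forall>a\<in>?R. reflection x a \<in> ?R) \<and> (\<forall>a\<in>?R. 2 * (a \<bullet> x) / (x \<bullet> x) \<in> \<int>)"
    (is "?Q x") if x: "x \<in> ?R" for x
  proof -
    obtain b where b: "b \<in> \<Phi>" "x = P b" "P b \<noteq> 0" using x by (rule restricted_rootE)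
    obtain m where m: "\<forall>i\<in>{0..l}. affine_coeff b m i \<ge> 0" using affine_lift b(1) by blast
    have "?Q (P b)"
    proof (rule restricted_root_induct [of "{0..l}" ?Q b m])
      show "orb i \<subseteq> {0..l}" if "i \<in> {0..l}" for i using orb_subset that .
    next
      fix i C assume i: "i \<in> {0..l}" "P (\<alpha> i) \<noteq> 0" and C: "cartan_multiple i C"
      then have "reflection (C *\<^sub>R P (\<alpha> i)) = reflection (P (\<alpha> i))"
        by (intro reflection_scaleR) (auto simp: cartan_multiple_def)
      moreover have "2 * (a \<bullet> C *\<^sub>R P (\<alpha> i)) / (C *\<^sub>R P (\<alpha> i) \<bullet> C *\<^sub>R P (\<alpha> i)) \<in> \<int>" if a: "a \<in> ?R" for a
      proof -
        obtain d where "d \<in> \<Phi>" "a = P d" using a by (rule restricted_rootE)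
        then have "2 * (a \<bullet> P (\<alpha> i)) / (P (\<alpha> i) \<bullet> P (\<alpha> i)) / C \<in> \<int>" and "C \<noteq> 0"
          using C unfolding cartan_multiple_def by blast+
        moreover have "2 * (a \<bullet> C *\<^sub>R P (\<alpha> i)) / (C *\<^sub>R P (\<alpha> i) \<bullet> C *\<^sub>R P (\<alpha> i))
            = 2 * (a \<bullet> P (\<alpha> i)) / (P (\<alpha> i) \<bullet> P (\<alpha> i)) / C"
          using \<open>C \<noteq> 0\<close> i(2) by (simp add: field_simps)
        ultimately show ?thesis by (simp only:)
      qed
      ultimately show "?Q (C *\<^sub>R P (\<alpha> i))" using restricted_reflection [OF i] by simp
    next
      fix i b assume i: "i \<in> {0..l}" "P (\<alpha> i) \<noteq> 0" and Q: "?Q (reflection (P (\<alpha> i)) (P b))"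
      let ?s = "reflection (P (\<alpha> i))"
      have "reflection (P b) a \<in> ?R" if "a \<in> ?R" for a
      proof -
        have "?s (reflection (P b) a) \<in> ?R"
          using Q restricted_reflection [OF i that]
            reflection_conjugate [OF orthogonal_transformation_reflection, of "P (\<alpha> i)" "P b" a] by metis
        from restricted_reflection [OF i this] show ?thesis by simp
      qed
      moreover have "2 * (a \<bullet> P b) / (P b \<bullet> P b) \<in> \<int>" if "a \<in> ?R" for a
        using Q restricted_reflection [OF i that] reflection_inner [of "P (\<alpha> i)"] by metis
      ultimately show "?Q (P b)" by blast
    qed (use b m in auto)
    then show ?thesis using b by simp
  qed
  have "span ?R = fixed_space \<omega>"
  proof
    have "?R \<subseteq> fixed_space \<omega>" by (auto simp: restricted_roots_def fixed_space_iff)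
    then show "span ?R \<subseteq> fixed_space \<omega>" using subspace_fixed span_minimal by blast
    show "fixed_space \<omega> \<subseteq> span ?R"
    proof
      fix x assume "x \<in> fixed_space \<omega>"
      then have "x = P x" by (simp add: fixed_space_iff)
      then have "x \<in> span (P ` \<Phi>)"
        using linear_span_image [OF linear_avg, of \<Phi>] span_roots by (metis UNIV_I image_eqI)
      moreover have "P ` \<Phi> \<subseteq> insert 0 ?R" using restricted_rootI by auto
      ultimately show "x \<in> span ?R" using span_mono span_insert_0 by blast
    qed
  qed
  moreover have "finite ?R"
  proof -
    have "?R \<subseteq> P ` \<Phi>" by (auto simp: restricted_roots_def)
    then show ?thesis using finite_roots finite_surj by blast
  qed
  moreover have "0 \<notin> ?R" by (auto simp: restricted_roots_def)
  ultimately show ?thesis using good subspace_fixed unfolding root_system_def by blast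
qed

section \<open>Orbit coweights and integrality\<close>

text \<open>The vertices of the fundamental alcove are the \<open>cw s\<close> divided by
  \<open>n s\<close>; \<open>\<omega>\<close> followed by translation by
  \<open>cw (\<sigma> 0)\<close> permutes them according to \<open>\<sigma>\<close>.\<close>

lemma omega_cw:
  assumes s: "s \<in> {0..l}"
  shows "\<omega> (cw s) = cw (\<sigma> s) - of_int (n s) *\<^sub>R cw (\<sigma> 0)"
proof (rule eq_by_alpha)
  fix m assume m: "m \<in> {0..l}"
  then obtain k where k: "k \<in> {0..l}" "m = \<sigma> k"
    using permutes_image [OF sigma_permutes] by (metis imageE)
  have inj: "\<sigma> a = \<sigma> b \<longleftrightarrow> a = b" for a b using permutes_inj [OF sigma_permutes] by (simp add: inj_eq)
  have "\<alpha> m \<bullet> \<omega> (cw s) = \<alpha> k \<bullet> cw s" using omega_simple [OF k(1)] k(2) omega_inner by metis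
  then show "\<alpha> m \<bullet> \<omega> (cw s) = \<alpha> m \<bullet> (cw (\<sigma> s) - of_int (n s) *\<^sub>R cw (\<sigma> 0))"
    using k s sigma_in [OF k(1)] sigma_in [OF s] sigma_in [of 0] n_sigma [OF s] n_sigma_0
    by (simp add: inner_diff_right alpha_cw inj)
qed

lemma n_orb_0: "s \<in> orb 0 \<Longrightarrow> n s = 1"
proof (induction rule: orb_induct)
  case (step s)
  then show ?case using n_sigma [of s] orb_subset [of 0] by auto
qed (rule n_0)

text \<open>Modulo coroots \<open>\<omega>\<close> is trivial on coweights. Summing
  \<open>omega_cw\<close> over an orbit then kills the mark sum times
  \<open>cw (\<sigma> 0)\<close>, while along the orbit of 0 it identifies the multiples of
  \<open>cw (\<sigma> 0)\<close> with the coweights of that orbit. Only the zero one among these is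
  a sum of coroots, so the order of the class is the size of the orbit.\<close>

lemma orbit_0_dvd:
  assumes i: "i \<in> {0..l}"
  shows "int (card (orb 0)) dvd (\<Sum>s\<in>orb i. n s)"
proof -
  let ?j = "\<sigma> 0"
  define M where "M = (\<Sum>s\<in>orb i. n s)"
  have diff: "\<omega> (cw s) - cw s \<in> coroot_lattice" if "s \<in> {0..l}" for s
    using group_diff_coroot_lattice [OF omega_in, of "cw s"] simple_root coeff_int [OF that] by blast
  have sub: "orb i \<subseteq> {0..l}" "orb 0 \<subseteq> {0..l}" using orb_subset i by auto
  have "(\<Sum>s\<in>orb i. \<omega> (cw s) - cw s) \<in> coroot_lattice"
    unfolding coroot_lattice_def
    by (rule group_closure_sum_mem) (use diff sub coroot_lattice_def in blast)
  also have "(\<Sum>s\<in>orb i. \<omega> (cw s) - cw s) = (\<Sum>s\<in>orb i. cw (\<sigma> s) - of_int (n s) *\<^sub>R cw ?j - cw s)"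
    using sub omega_cw by (intro sum.cong) auto
  also have "\<dots> = (\<Sum>s\<in>orb i. cw (\<sigma> s)) - of_int M *\<^sub>R cw ?j - (\<Sum>s\<in>orb i. cw s)"
    by (simp add: sum_subtractf M_def scaleR_sum_left)
  also have "(\<Sum>s\<in>orb i. cw (\<sigma> s)) = (\<Sum>s\<in>\<sigma> ` orb i. cw s)"
    using inj_on_subset [OF permutes_inj [OF sigma_permutes]] by (subst sum.reindex) auto
  finally have MQ: "of_int M *\<^sub>R cw ?j \<in> coroot_lattice"
    unfolding sigma_orb by (simp add: coroot_lattice_def)
  have "M \<ge> 0" unfolding M_def using n_pos sub by (intro sum_nonneg) force
  have pow0: "(\<sigma> ^^ t) 0 \<in> orb 0" for t using funpow_in_orbit self_in_orb by metis
  have tQ: "of_nat t *\<^sub>R cw ?j - cw ((\<sigma> ^^ t) 0) \<in> coroot_lattice" for t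
  proof (induction t)
    case 0
    then show ?case by (simp add: cw_0 coroot_lattice_def)
  next
    case (Suc t)
    let ?s = "(\<sigma> ^^ t) 0"
    have s: "?s \<in> {0..l}" "n ?s = 1" using pow0 sub n_orb_0 by blast+
    have "(of_nat t *\<^sub>R cw ?j - cw ?s) - (\<omega> (cw ?s) - cw ?s) \<in> coroot_lattice"
      using Suc diff [OF s(1)] unfolding coroot_lattice_def by (rule group_closure.diff)
    then show ?case using omega_cw [OF s(1)] s(2) by (simp add: algebra_simps)
  qed
  define z where "z = (\<sigma> ^^ nat M) 0"
  have z: "z \<in> {0..l}" "n z = 1" using pow0 sub n_orb_0 unfolding z_def by blast+
  have "of_int M *\<^sub>R cw ?j - (of_nat (nat M) *\<^sub>R cw ?j - cw z) \<in> coroot_lattice"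
    using MQ tQ unfolding coroot_lattice_def z_def by (blast intro: group_closure.diff)
  then have "cw z \<in> coroot_lattice" using \<open>M \<ge> 0\<close> by simp
  then obtain xs where xs: "set xs \<subseteq> \<Phi>" "cw z = sum_list (map coroot xs)"
    using coroot_lattice_list by blast
  have "b \<bullet> cw z \<in> \<int> \<and> \<bar>b \<bullet> cw z\<bar> \<le> 1" if "b \<in> \<Phi>" for b
    using coeff_int [OF z(1) that] highest_coeff_abs [OF that, of z] z cw_0 by (cases "z = 0") auto
  from minuscule_coroot_sum [OF xs this] have "cw z = 0" .
  then have "z = 0" using dual [of z z] z(1) by (cases "z = 0") auto
  \<comment> \<open>The return time of 0 is counted from 1, so a fixed node 0 gets
    \<open>d = 1\<close>, the size of its orbit.\<close>
  define d where "d = funpow_dist1 \<sigma> 0 0"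
  have d: "orb 0 = (\<lambda>n. (\<sigma> ^^ n) 0) ` {0..<d}" "inj_on (\<lambda>n. (\<sigma> ^^ n) 0) {0..<d}" "(\<sigma> ^^ d) 0 = 0"
    unfolding d_def
    using orbit_conv_funpow_dist1 inj_on_funpow_dist1 funpow_dist1_prop self_in_orb by metis+
  then have "card (orb 0) = d" by (simp add: card_image)
  have "d > 0" by (simp add: d_def)
  have "(\<sigma> ^^ (nat M mod d)) 0 = 0"
    using funpow_mod_eq [OF d(3), of "nat M"] \<open>z = 0\<close> z_def by simp
  moreover have "nat M mod d < d" using \<open>d > 0\<close> by simp
  ultimately have "nat M mod d = 0"
    using inj_onD [OF d(2), of "nat M mod d" 0] \<open>d > 0\<close> by simp
  then have "d dvd nat M" by (simp add: mod_eq_0_iff_dvd)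
  then have "int d dvd M" using \<open>M \<ge> 0\<close> by (simp add: int_dvd_int_iff [symmetric])
  then show ?thesis by (simp add: \<open>card (orb 0) = d\<close> M_def)
qed

definition orbit_cw :: "nat \<Rightarrow> 'a" where
  "orbit_cw k = (\<Sum>s\<in>orb k. cw s)"

lemma avg_alpha_inner:
  assumes "m \<in> {0..l}"
  shows "P (\<alpha> m) \<bullet> x = (\<Sum>s\<in>orb m. \<alpha> s \<bullet> x) / of_nat (card (orb m))"
proof -
  have "card (orb m) > 0" using self_in_orb finite_orb card_gt_0_iff by blast
  moreover have "(\<Sum>s\<in>orb m. \<alpha> s \<bullet> x) = of_nat (card (orb m)) * (P (\<alpha> m) \<bullet> x)"
    using sum_orb [OF assms] by (simp flip: inner_sum_left)
  ultimately show ?thesis by simp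
qed

lemma avg_alpha_orbit_cw:
  assumes m: "m \<in> {0..l}" "m \<notin> orb 0" and k: "k \<in> {0..l}" "k \<notin> orb 0"
  shows "P (\<alpha> m) \<bullet> orbit_cw k = (if m \<in> orb k then 1 else 0)"
proof -
  have "card (orb m) > 0" using self_in_orb finite_orb card_gt_0_iff by blast
  have "0 \<notin> orb m" using orb_eq self_in_orb m by blast
  have "\<alpha> s \<bullet> orbit_cw k = (if m \<in> orb k then 1 else 0)" if s: "s \<in> orb m" for s
  proof -
    have sk: "s \<in> orb k \<longleftrightarrow> m \<in> orb k" using orb_eq [OF s] orb_eq [of _ k] self_in_orb s by metis
    have "\<alpha> s \<bullet> orbit_cw k = (\<Sum>t\<in>orb k. if t = s then 1 else 0)"
      unfolding orbit_cw_def inner_sum_right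
    proof (rule sum.cong [OF refl])
      fix t assume "t \<in> orb k"
      then show "\<alpha> s \<bullet> cw t = (if t = s then 1 else 0)"
        using alpha_cw [of s t] orb_subset [OF k(1)] orb_subset [OF m(1)] s \<open>0 \<notin> orb m\<close> by force
    qed
    also have "\<dots> = (if m \<in> orb k then 1 else 0)" using sk finite_orb by simp
    finally show ?thesis .
  qed
  then show ?thesis using \<open>card (orb m) > 0\<close> by (simp add: avg_alpha_inner [OF m(1)])
qed

text \<open>The value is the negative of m_k, since marks are constant on an orbit.\<close>

lemma avg_alpha_0_orbit_cw:
  assumes k: "k \<in> {0..l}" "k \<notin> orb 0"
  shows "P (\<alpha> 0) \<bullet> orbit_cw k = - of_int (\<Sum>s\<in>orb k. n s) / of_nat (card (orb 0))"
proof -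
  have "0 \<notin> orb k" using orb_eq self_in_orb k by blast
  have "\<alpha> s \<bullet> orbit_cw k = (if s = 0 then - of_int (\<Sum>s\<in>orb k. n s) else 0)" if s: "s \<in> orb 0" for s
  proof -
    have "s \<notin> orb k" using orb_eq s self_in_orb k by metis
    have "\<alpha> s \<bullet> orbit_cw k = (\<Sum>t\<in>orb k. if s = 0 then - of_int (n t) else 0)"
      unfolding orbit_cw_def inner_sum_right
    proof (rule sum.cong [OF refl])
      fix t assume t: "t \<in> orb k"
      then have "t \<noteq> s" using \<open>s \<notin> orb k\<close> by blast
      moreover have "t \<in> {0..l}" "s \<in> {0..l}" using orb_subset [OF k(1)] orb_subset [of 0] s t by auto
      ultimately show "\<alpha> s \<bullet> cw t = (if s = 0 then - of_int (n t) else 0)"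
        using alpha_cw [of s t] by auto
    qed
    then show ?thesis by (simp add: sum_negf)
  qed
  then have "(\<Sum>s\<in>orb 0. \<alpha> s \<bullet> orbit_cw k) = - of_int (\<Sum>s\<in>orb k. n s)"
    using finite_orb self_in_orb by simp
  then show ?thesis by (simp add: avg_alpha_inner)
qed

text \<open>Finitely many hyperplanes, one for each nonzero \<open>P b\<close>, do not cover the
  space; a point off them is projected. At this vector \<open>stabilizer\<close> yields only
  reflections in roots averaging to 0.\<close>

lemma generic_fixed: "\<exists>x. \<omega> x = x \<and> (\<forall>b\<in>\<Phi>. b \<bullet> x = 0 \<longrightarrow> P b = 0)"
proof -
  define H where "H b = {y. P b \<bullet> y = 0}" for b
  have "negligible (\<Union> (H ` {b\<in>\<Phi>. P b \<noteq> 0}))"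
  proof (rule negligible_Union)
    show "finite (H ` {b \<in> \<Phi>. P b \<noteq> 0})" using finite_roots by simp
    show "negligible t" if "t \<in> H ` {b \<in> \<Phi>. P b \<noteq> 0}" for t
      using that negligible_hyperplane unfolding H_def by blast
  qed
  then have "\<Union> (H ` {b\<in>\<Phi>. P b \<noteq> 0}) \<noteq> UNIV"
    using open_not_negligible [of "UNIV :: 'a set"] by auto
  then obtain y where "y \<notin> \<Union> (H ` {b\<in>\<Phi>. P b \<noteq> 0})" by blast
  then have y: "P b \<bullet> y \<noteq> 0" if "b \<in> \<Phi>" "P b \<noteq> 0" for b
    using that by (auto simp: H_def)
  show ?thesis by (rule exI [of _ "P y"]) (use y omega_avg avg_sym in metis)
qed

lemma orb_range:
  assumes "k \<in> {0..l}" "k \<notin> orb 0" shows "orb k \<subseteq> {1..l}"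
proof -
  have "0 \<notin> orb k" using assms orb_eq [of 0 k] self_in_orb [of k] by blast
  then show ?thesis using orb_subset [OF assms(1)] unfolding split_range by blast
qed

text \<open>For such roots the restricted coordinates are orbit sums of ordinary coefficients and so
  inherit their signs.\<close>

lemma avg_orbit_cw:
  assumes z: "\<forall>s\<in>orb 0. b \<bullet> cw s = 0" and k: "k \<in> {0..l}" "k \<notin> orb 0"
  shows "P b \<bullet> orbit_cw k = (\<Sum>m\<in>orb k. b \<bullet> cw m)"
proof -
  have "P b \<bullet> orbit_cw k = (\<Sum>m\<in>{1..l}. (b \<bullet> cw m) * (P (\<alpha> m) \<bullet> orbit_cw k))"
    by (subst expansion [of b]) (simp add: inner_sum_left)
  also have "\<dots> = (\<Sum>m\<in>{1..l}. if m \<in> orb k then b \<bullet> cw m else 0)"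
  proof (rule sum.cong [OF refl])
    fix m assume "m \<in> {1..l}"
    then show "(b \<bullet> cw m) * (P (\<alpha> m) \<bullet> orbit_cw k) = (if m \<in> orb k then b \<bullet> cw m else 0)"
      using z avg_alpha_orbit_cw [of m k] k orb_eq self_in_orb by (cases "m \<in> orb 0") auto
  qed
  also have "\<dots> = (\<Sum>m\<in>orb k. b \<bullet> cw m)"
    using orb_range [OF k] by (intro sum.mono_neutral_cong_right) auto
  finally show ?thesis .
qed

subsection \<open>The node \<open>0\<close> is special\<close>

text \<open>The roots whose average is a multiple of \<open>P (\<alpha> 0)\<close> form a root system containing \<open>h\<close> as
  dominant root.  By Steinberg's theorem \<open>\<omega>\<close> lies in its Weyl group, so \<open>h = - \<alpha> 0\<close> and all
  \<open>\<alpha> s\<close> with \<open>s\<close> in the orbit of \<open>0\<close> lie in the same irreducible component, and each such \<open>\<alpha> s\<close>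
  occurs when \<open>h\<close> is written as a sum of indecomposable roots.  If the orbit coefficient \<open>C0\<close> were
  nonzero on all these roots, comparing \<open>C0 h = card (orb 0) - 1\<close> with the number of summands would
  give \<open>h = (\<Sum>s\<in>orb 0 - {0}. \<alpha> s)\<close>, that is, \<open>P (\<alpha> 0) = 0\<close>.\<close>

lemma special_root:
  assumes a0: "P (\<alpha> 0) \<noteq> 0"
  shows "\<exists>b\<in>\<Phi>. (\<forall>s\<in>orb 0. b \<bullet> cw s = 0) \<and> P b \<noteq> 0 \<and> (\<exists>t. P b = t *\<^sub>R P (\<alpha> 0))"
proof (rule ccontr)
  assume none: "\<not> ?thesis"
  define L where "L = {b \<in> \<Phi>. \<exists>t. P b = t *\<^sub>R P (\<alpha> 0)}"
  define C0 where "C0 b = b \<bullet> orbit_cw 0" for b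
  have C0_eq: "C0 b = (\<Sum>s\<in>orb 0. b \<bullet> cw s)" for b by (simp add: C0_def orbit_cw_def inner_sum_right)
  have C0_add: "C0 (x + y) = C0 x + C0 y" "C0 (x - y) = C0 x - C0 y" for x y
    by (simp_all add: C0_def inner_add_left inner_diff_left)
  have sub: "orb 0 \<subseteq> {0..l}" using orb_subset [of 0] by simp
  have L_root: "b \<in> \<Phi>" if "b \<in> L" for b using that by (simp add: L_def)
  have L_diff: "a - b \<in> L" if "a \<in> L" "b \<in> L" "a - b \<in> \<Phi>" for a b
    using that by (auto simp: L_def simp flip: scaleR_diff_left)
  have L_minus: "- b \<in> L" if b: "b \<in> L" for b
  proof -
    obtain t where "P b = t *\<^sub>R P (\<alpha> 0)" using b by (auto simp: L_def)
    then have "P (- b) = (- t) *\<^sub>R P (\<alpha> 0)" by simp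
    then show ?thesis using b uminus_root unfolding L_def by blast
  qed
  \<comment> \<open>Under the assumption to be refuted, a positive root of \<open>L\<close> with
    \<open>C0 b = 0\<close> averages to 0; then its nonnegative coefficients have vanishing orbit
    sums, and the root is 0. So \<open>C0\<close> is a height on the positive roots of
    \<open>L\<close>.\<close>
  have C0_pos: "C0 b \<ge> 1" "C0 b \<in> \<int>" if b: "b \<in> L" "positive b" for b
  proof -
    have nn: "b \<bullet> cw s \<ge> 0" if "s \<in> orb 0" for s
      using b(2) sub that cw_0 by (cases "s = 0") (auto simp: positive_def)
    show int: "C0 b \<in> \<int>" unfolding C0_eq using coeff_int L_root [OF b(1)] sub by (intro Ints_sum) blast
    have "C0 b \<noteq> 0"
    proof
      assume "C0 b = 0"
      then have z: "\<forall>s\<in>orb 0. b \<bullet> cw s = 0"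
        unfolding C0_eq using nn finite_orb by (subst (asm) sum_nonneg_eq_0_iff) auto
      then have "P b = 0" using none b(1) by (auto simp: L_def)
      have "b = 0"
      proof (rule coeff_eqI)
        fix k assume k: "k \<in> {1..l}"
        show "b \<bullet> cw k = 0 \<bullet> cw k"
        proof (cases "k \<in> orb 0")
          case False
          have kI: "k \<in> {0..l}" using k by simp
          have "(\<Sum>m\<in>orb k. b \<bullet> cw m) = 0"
            using avg_orbit_cw [OF z kI False] \<open>P b = 0\<close> by simp
          moreover have "b \<bullet> cw m \<ge> 0" if "m \<in> orb k" for m
            using orb_range [OF kI False] that b(2) by (auto simp: positive_def)
          ultimately have "\<forall>m\<in>orb k. b \<bullet> cw m = 0"
            using sum_nonneg_eq_0_iff [OF finite_orb, of k "\<lambda>m. b \<bullet> cw m"] by simp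
          then show ?thesis using self_in_orb [of k] by simp
        qed (use z in simp)
      qed
      then show False using zero_notin L_root b by blast
    qed
    moreover have "C0 b \<ge> 0" unfolding C0_eq using nn by (intro sum_nonneg) auto
    ultimately show "C0 b \<ge> 1" using int by (elim Ints_cases) auto
  qed
  define Lp where "Lp b \<longleftrightarrow> b \<in> L \<and> positive b" for b
  define Ind where "Ind b \<longleftrightarrow> Lp b \<and> (\<forall>x y. Lp x \<longrightarrow> Lp y \<longrightarrow> b \<noteq> x + y)" for b
  have Lp_C0: "C0 b \<ge> 1" "C0 b \<in> \<int>" if "Lp b" for b using C0_pos that by (auto simp: Lp_def)
  have floor_less: "nat \<lfloor>C0 x\<rfloor> < nat \<lfloor>C0 y\<rfloor>" if x: "Lp x" and y: "Lp y" and lt: "C0 x < C0 y" for x y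
  proof -
    obtain p where "C0 x = of_int p" using Lp_C0(2) [OF x] by (elim Ints_cases)
    moreover obtain q where "C0 y = of_int q" using Lp_C0(2) [OF y] by (elim Ints_cases)
    ultimately show ?thesis using lt Lp_C0(1) [OF y] by simp
  qed
  have L_pm: "Lp b \<or> Lp (- b)" if "b \<in> L" for b
    using positive_or_negative [OF L_root [OF that]] that L_minus by (auto simp: Lp_def)
  have decompose: "\<exists>xs. (\<forall>x\<in>set xs. Ind x) \<and> b = sum_list xs" if "Lp b" for b
    using that
  proof (induction "nat \<lfloor>C0 b\<rfloor>" arbitrary: b rule: less_induct)
    case less
    show ?case
    proof (cases "Ind b")
      case True
      then show ?thesis by (intro exI [of _ "[b]"]) simp
    next
      case False
      then obtain x y where xy: "Lp x" "Lp y" "b = x + y" using less.prems by (auto simp: Ind_def)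
      have lt: "C0 x < C0 b" "C0 y < C0 b"
        using Lp_C0(1) [OF xy(1)] Lp_C0(1) [OF xy(2)] by (simp_all add: xy(3) C0_add)
      obtain xs where "\<forall>z\<in>set xs. Ind z" "x = sum_list xs"
        using less.hyps [OF floor_less [OF xy(1) less.prems lt(1)] xy(1)] by blast
      moreover obtain ys where "\<forall>z\<in>set ys. Ind z" "y = sum_list ys"
        using less.hyps [OF floor_less [OF xy(2) less.prems lt(2)] xy(2)] by blast
      ultimately show ?thesis using xy(3) by (intro exI [of _ "xs @ ys"]) auto
    qed
  qed
  have ind_obtuse: "x \<bullet> y \<le> 0" if "Ind x" "Ind y" "x \<noteq> y" for x y
  proof (rule ccontr)
    assume "\<not> x \<bullet> y \<le> 0"
    have xy: "Lp x" "Lp y" using that by (auto simp: Ind_def)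
    have "x - y \<in> L"
      using \<open>\<not> x \<bullet> y \<le> 0\<close> that xy L_root by (intro L_diff root_diff) (auto simp: Lp_def)
    then consider "Lp (x - y)" | "Lp (y - x)" using L_pm by fastforce
    then show False
    proof cases
      case 1
      then show False using that(1) xy unfolding Ind_def by (metis diff_add_cancel)
    next
      case 2
      then show False using that(2) xy unfolding Ind_def by (metis diff_add_cancel)
    qed
  qed
  have ind_simple: "Ind (\<alpha> s)" "C0 (\<alpha> s) = 1" if s: "s \<in> orb 0" "s \<noteq> 0" for s
  proof -
    have s1: "s \<in> {1..l}" using s sub by force
    have "C0 (\<alpha> s) = (\<Sum>k\<in>orb 0. if k = s then 1 else 0)"
      unfolding C0_eq
    proof (rule sum.cong [OF refl])
      fix k assume "k \<in> orb 0"
      then show "\<alpha> s \<bullet> cw k = (if k = s then 1 else 0)"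
        using alpha_cw [of s k] sub s s1 by force
    qed
    then show c: "C0 (\<alpha> s) = 1" using s finite_orb by simp
    have "P (\<alpha> s) = 1 *\<^sub>R P (\<alpha> 0)" using avg_alpha [of 0 s] s by simp
    then have "Lp (\<alpha> s)"
      using positive_simple [OF s1] simple_root [OF s1] unfolding Lp_def L_def by blast
    moreover have "\<alpha> s \<noteq> x + y" if "Lp x" "Lp y" for x y
      using Lp_C0(1) [OF that(1)] Lp_C0(1) [OF that(2)] c C0_add(1) [of x y] by auto
    ultimately show "Ind (\<alpha> s)" by (auto simp: Ind_def)
  qed
  have "P h = (- 1) *\<^sub>R P (\<alpha> 0)" by (simp add: alpha_0)
  then have "Lp h" using h_root positive_h unfolding Lp_def L_def by blast
  then obtain xs where xs: "\<forall>x\<in>set xs. Ind x" "h = sum_list xs" using decompose by blast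
  \<comment> \<open>\<open>h\<close> is dominant, but an indecomposable root absent from the sum has
    nonpositive inner product with every summand; so all these products vanish.\<close>
  have ortho_rest: "x \<bullet> b = 0" if b: "Ind b" "b \<notin> set xs" and x: "x \<in> set xs" for b x
  proof -
    have hb: "h \<bullet> b = (\<Sum>x\<leftarrow>xs. x \<bullet> b)" unfolding xs(2) by (induction xs) (simp_all add: inner_add_left)
    have "b \<bullet> h \<ge> 0"
      using positive_inner [of h b] h_dominant b(1) by (auto simp: inner_commute Ind_def Lp_def)
    have np: "x \<bullet> b \<le> 0" if "x \<in> set xs" for x using ind_obtuse b xs(1) that by blast
    then have "0 \<le> (\<Sum>x\<leftarrow>xs. - (x \<bullet> b))" by (intro sum_list_nonneg) auto
    moreover have "(\<Sum>x\<leftarrow>xs. - (x \<bullet> b)) = - (h \<bullet> b)" unfolding hb by (induction xs) simp_all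
    ultimately have "(\<Sum>x\<leftarrow>xs. - (x \<bullet> b)) = 0"
      using \<open>b \<bullet> h \<ge> 0\<close> by (simp add: inner_commute)
    then have "\<forall>y\<in>set (map (\<lambda>x. - (x \<bullet> b)) xs). y = 0"
      by (subst (asm) sum_list_nonneg_eq_0_iff) (use np in auto)
    then show ?thesis using x by simp
  qed
  let ?V = "span (set xs)"
  have dichotomy: "b \<in> ?V \<or> (\<forall>v\<in>?V. b \<bullet> v = 0)" if "Lp b" for b
    using that
  proof (induction "nat \<lfloor>C0 b\<rfloor>" arbitrary: b rule: less_induct)
    case less
    \<comment> \<open>Reflecting \<open>x + y\<close> in \<open>x\<close> gives the root
      \<open>y - x\<close>. Up to sign it is positive with smaller \<open>C0\<close>, so it lies in
      \<open>?V\<close> or is orthogonal to it; the nonzero parts \<open>y\<close> and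
      \<open>x\<close> exclude both.\<close>
    have mixed: False if xy: "Lp x" "Lp y" "b = x + y" "x \<in> ?V" "\<forall>v\<in>?V. y \<bullet> v = 0" for x y
    proof -
      have "x \<bullet> x > 0" "y \<bullet> y > 0" using xy(1,2) L_root zero_notin by (auto simp: Lp_def)
      have "x \<bullet> y = 0" using xy by (simp add: inner_commute)
      then have "x \<bullet> b = x \<bullet> x" using xy(3) by (simp add: inner_add_right)
      then have "reflection x b = y - x"
        using \<open>x \<bullet> x > 0\<close> xy(3) by (simp add: reflection_def scaleR_2)
      then have "y - x \<in> L"
        using L_diff xy reflection_root [of x b] L_root less.prems unfolding Lp_def by metis
      then obtain d where d: "d = y - x \<or> d = x - y" "Lp d" using L_pm by fastforce
      then have "C0 d < C0 b" using Lp_C0(1) [OF xy(1)] Lp_C0(1) [OF xy(2)] xy(3) by (auto simp: C0_add)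
      then have "d \<in> ?V \<or> (\<forall>v\<in>?V. d \<bullet> v = 0)"
        by (intro less.hyps [OF floor_less [OF d(2) less.prems] d(2)])
      then show False
      proof
        assume "d \<in> ?V"
        then have "y \<bullet> d = 0" using xy by blast
        then show False using d \<open>x \<bullet> y = 0\<close> \<open>y \<bullet> y > 0\<close> by (auto simp: inner_diff_right inner_commute)
      next
        assume "\<forall>v\<in>?V. d \<bullet> v = 0"
        then have "d \<bullet> x = 0" using xy by blast
        then have "x \<bullet> d = 0" by (simp add: inner_commute)
        then show False using d \<open>x \<bullet> y = 0\<close> \<open>x \<bullet> x > 0\<close> by (auto simp: inner_diff_right)
      qed
    qed
    show ?case
    proof (cases "Ind b")
      case True
      show ?thesis
      proof (cases "b \<in> set xs")
        case False
        have "b \<bullet> v = 0" if "v \<in> ?V" for v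
          using that
        proof (induction rule: span_induct_alt)
          case (step c x y)
          then show ?case using ortho_rest [OF True False step(1)] by (simp add: inner_add_right inner_commute)
        qed simp
        then show ?thesis by blast
      qed (simp add: span_base)
    next
      case False
      then obtain x y where xy: "Lp x" "Lp y" "b = x + y" using less.prems by (auto simp: Ind_def)
      have lt: "C0 x < C0 b" "C0 y < C0 b"
        using Lp_C0(1) [OF xy(1)] Lp_C0(1) [OF xy(2)] by (simp_all add: xy(3) C0_add)
      have "x \<in> ?V \<or> (\<forall>v\<in>?V. x \<bullet> v = 0)"
        by (rule less.hyps [OF floor_less [OF xy(1) less.prems lt(1)] xy(1)])
      moreover have "y \<in> ?V \<or> (\<forall>v\<in>?V. y \<bullet> v = 0)"
        by (rule less.hyps [OF floor_less [OF xy(2) less.prems lt(2)] xy(2)])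
      ultimately show ?thesis
        using mixed [OF xy] mixed [OF xy(2,1)] xy(3) by (auto simp: add.commute span_add inner_add_left)
    qed
  qed
  obtain x where x: "\<omega> x = x" "\<And>b. b \<in> \<Phi> \<Longrightarrow> b \<bullet> x = 0 \<Longrightarrow> P b = 0" using generic_fixed by blast
  \<comment> \<open>Roots averaging to 0 lie in \<open>L\<close> with factor 0. By the dichotomy
    each of their reflections is either in a root of \<open>?V\<close> or trivial on
    \<open>?V\<close>.\<close>
  have wV: "\<omega> v \<in> ?V" if "v \<in> ?V" for v
  proof -
    have "\<omega> \<in> reflection_group {b \<in> \<Phi>. b \<bullet> x = 0}" using stabilizer omega_in x(1) .
    then show ?thesis
    proof (induction rule: reflection_group_induct)
      case (reflection b w)
      have "P b = 0 *\<^sub>R P (\<alpha> 0)" using reflection x(2) by simp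
      then have "b \<in> L" using reflection unfolding L_def by blast
      then obtain d where d: "d = b \<or> d = - b" "Lp d" using L_pm by blast
      from dichotomy [OF d(2)] have "reflection b (w v) \<in> ?V"
      proof
        assume "d \<in> ?V"
        then have "b \<in> ?V" using d(1) span_neg [of "- b"] by auto
        then show ?thesis using reflection.IH by (simp add: reflection_def span_diff span_scale)
      next
        assume "\<forall>v\<in>?V. d \<bullet> v = 0"
        then have "d \<bullet> w v = 0" using reflection.IH by blast
        then have "b \<bullet> w v = 0" using d(1) by auto
        then show ?thesis using reflection.IH by (simp add: reflection_orthogonal)
      qed
      then show ?case by simp
    qed (simp add: that)
  qed
  have a0V: "\<alpha> 0 \<in> ?V"
  proof -
    have "sum_list ys \<in> span (set ys)" for ys :: "'a list"
      by (induction ys) (simp_all add: span_zero span_add span_base span_mono [THEN subsetD, OF subset_insertI])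
    then show ?thesis unfolding alpha_0 using xs(2) span_neg by metis
  qed
  have aV: "\<alpha> s \<in> ?V" if "s \<in> orb 0" for s
    using that
  proof (induction rule: orb_induct)
    case (step s)
    then show ?case using wV omega_simple [of s] sub by (metis subsetD)
  qed (rule a0V)
  have sset: "\<alpha> ` (orb 0 - {0}) \<subseteq> set xs"
  proof
    fix b assume "b \<in> \<alpha> ` (orb 0 - {0})"
    then obtain s where s: "s \<in> orb 0" "s \<noteq> 0" "b = \<alpha> s" by blast
    show "b \<in> set xs"
    proof (rule ccontr)
      assume nb: "b \<notin> set xs"
      have ib: "Ind b" using ind_simple s by blast
      have "b \<bullet> v = 0" if "v \<in> ?V" for v
        using that
      proof (induction rule: span_induct_alt)
        case (step c x y)
        then show ?case using ortho_rest [OF ib nb step(1)] by (simp add: inner_add_right inner_commute)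
      qed simp
      then have "b \<bullet> b = 0" using aV s by blast
      then show False using ib zero_notin L_root by (auto simp: Ind_def Lp_def)
    qed
  qed
  \<comment> \<open>Marks on the orbit of 0 are 1, and node 0 drops out by \<open>cw 0 = 0\<close>.
    As every summand has \<open>C0\<close> at least 1, \<open>xs\<close> is no longer than the list
    of \<open>\<alpha> s\<close> it must contain.\<close>
  have "C0 h = (\<Sum>s\<in>orb 0. if s = 0 then 0 else 1)"
    unfolding C0_eq
  proof (rule sum.cong [OF refl])
    fix s assume "s \<in> orb 0"
    then show "h \<bullet> cw s = (if s = 0 then 0 else 1)"
      using h_coeff [of s] n_orb_0 [of s] sub cw_0 by force
  qed
  also have "\<dots> = (\<Sum>s\<in>orb 0 - {0}. 1)"
    by (rule sum.mono_neutral_cong_right) (auto simp: finite_orb)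
  finally have Ch: "C0 h = real (card (orb 0 - {0}))" by simp
  have "C0 (sum_list ys) \<ge> real (length ys)" if "\<forall>y\<in>set ys. Ind y" for ys
    using that
  proof (induction ys)
    case (Cons y ys)
    then show ?case using Lp_C0(1) [of y] by (simp add: C0_add Ind_def)
  qed (simp add: C0_def)
  then have "real (length xs) \<le> real (card (orb 0 - {0}))" using xs Ch by metis
  moreover have inj: "inj_on \<alpha> (orb 0 - {0})"
    using inj_on_subset [OF inj_alpha, of "orb 0 - {0}"] sub by blast
  moreover have "card (\<alpha> ` (orb 0 - {0})) = card (orb 0 - {0})" using inj by (rule card_image)
  moreover have "card (\<alpha> ` (orb 0 - {0})) \<le> card (set xs)" using sset by (intro card_mono) auto
  moreover have "card (set xs) \<le> length xs" by (rule card_length)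
  ultimately have cards: "card (set xs) = length xs" "card (set xs) = card (\<alpha> ` (orb 0 - {0}))" by linarith+
  then have "set xs = \<alpha> ` (orb 0 - {0})" using card_subset_eq [OF _ sset] by simp
  moreover have "distinct xs" using cards(1) card_distinct by blast
  ultimately have "h = (\<Sum>b\<in>\<alpha> ` (orb 0 - {0}). b)"
    using xs(2) sum_list_distinct_conv_sum_set [of xs "\<lambda>x. x"] by simp
  also have "\<dots> = (\<Sum>s\<in>orb 0 - {0}. \<alpha> s)"
    using inj by (simp add: sum.reindex)
  also have "\<dots> = (\<Sum>s\<in>orb 0. \<alpha> s) - \<alpha> 0"
    using sum.remove [OF finite_orb self_in_orb, of \<alpha> 0] by simp
  finally have "of_nat (card (orb 0)) *\<^sub>R P (\<alpha> 0) = 0" using sum_orb [of 0] alpha_0 by simp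
  then show False using a0 self_in_orb [of 0] finite_orb [of 0] by auto
qed

subsection \<open>The restricted simple roots\<close>

definition special :: "'a set" where
  "special = {t *\<^sub>R P b | t b. t \<noteq> 0 \<and> b \<in> \<Phi> \<and> P b \<noteq> 0 \<and> (\<forall>s\<in>orb 0. b \<bullet> cw s = 0)}"

lemma specialI:
  "t \<noteq> 0 \<Longrightarrow> b \<in> \<Phi> \<Longrightarrow> P b \<noteq> 0 \<Longrightarrow> \<forall>s\<in>orb 0. b \<bullet> cw s = 0 \<Longrightarrow> t *\<^sub>R P b \<in> special"
  unfolding special_def by blast

lemma specialE:
  assumes "x \<in> special"
  obtains t b where "t \<noteq> 0" "b \<in> \<Phi>" "P b \<noteq> 0" "\<forall>s\<in>orb 0. b \<bullet> cw s = 0" "x = t *\<^sub>R P b"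
  using assms unfolding special_def by blast

lemma special_scale: "x \<in> special \<Longrightarrow> c \<noteq> 0 \<Longrightarrow> c *\<^sub>R x \<in> special"
proof (erule specialE)
  fix t b
  assume "c \<noteq> 0" "t \<noteq> 0" "b \<in> \<Phi>" "P b \<noteq> 0" "\<forall>s\<in>orb 0. b \<bullet> cw s = 0" "x = t *\<^sub>R P b"
  then show "c *\<^sub>R x \<in> special" using specialI [of "c * t" b] by simp
qed

lemma orb_disjoint: "i \<notin> orb 0 \<Longrightarrow> s \<in> orb i \<Longrightarrow> s \<notin> orb 0"
  using orb_eq self_in_orb by blast

lemma special_reflection:
  assumes i: "i \<in> {0..l}" "i \<notin> orb 0" and nz: "P (\<alpha> i) \<noteq> 0" and x: "x \<in> special"
  shows "reflection (P (\<alpha> i)) x \<in> special"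
proof -
  obtain t b where b: "t \<noteq> 0" "b \<in> \<Phi>" "P b \<noteq> 0" "\<forall>s\<in>orb 0. b \<bullet> cw s = 0" "x = t *\<^sub>R P b"
    using x by (rule specialE)
  obtain b' m' where b': "b' \<in> \<Phi>" "P b' = reflection (P (\<alpha> i)) (P b)"
    and c: "\<forall>k\<in>{0..l} - orb i. affine_coeff b' m' k = affine_coeff b 0 k"
    using folding_reflection [OF i(1) nz b(2)] by blast
  have off: "s \<in> {0..l} - orb i" if "s \<in> orb 0" for s
    using that orb_disjoint [OF i(2)] orb_subset [of 0] by auto
  \<comment> \<open>At node 0, which lies outside the orbit of \<open>i\<close>, the affine
    coefficient is the shift itself. With shift 0 the ordinary coefficients on the orbit of 0 are
    kept too.\<close>
  have "m' = 0" using bspec [OF c off [OF self_in_orb]] by (simp add: affine_coeff_def cw_0 n_0)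
  then have "b' \<bullet> cw s = 0" if "s \<in> orb 0" for s
    using bspec [OF c off [OF that]] b(4) that by (simp add: affine_coeff_def)
  moreover have "P b' \<noteq> 0" using b(3) b'(2) reflection_inner [of "P (\<alpha> i)" "P b" "P b"] by auto
  ultimately have "t *\<^sub>R P b' \<in> special" using b(1) b'(1) by (intro specialI) auto
  then show ?thesis using b(5) b'(2) linear_scale [OF linear_reflection] by metis
qed

lemma special_root_reflection:
  assumes b: "b \<in> \<Phi>" "\<forall>s\<in>orb 0. b \<bullet> cw s = 0" "P b \<noteq> 0"
  shows "\<forall>x\<in>special. reflection (P b) x \<in> special"
proof -
  have pos: "\<forall>x\<in>special. reflection (P b) x \<in> special"
    if b: "positive b" "\<forall>s\<in>orb 0. b \<bullet> cw s = 0" "P b \<noteq> 0" for b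
  \<comment> \<open>Shift 0 confines the support to the nodes off the orbit of 0, whose reflections
    are already known to preserve \<open>special\<close>.\<close>
  proof (rule restricted_root_induct [of "{0..l} - orb 0" "\<lambda>y. \<forall>x\<in>special. reflection y x \<in> special" b 0])
    show "orb i \<subseteq> {0..l} - orb 0" if "i \<in> {0..l} - orb 0" for i
      using that orb_subset [of i] orb_disjoint [of i] by auto
    show "b \<in> \<Phi>" using b positive_root by blast
    show "\<forall>k\<in>{0..l}. 0 \<le> affine_coeff b 0 k"
      unfolding split_range using b(1) cw_0 by (auto simp: affine_coeff_def positive_def)
    show "\<forall>k\<in>{0..l} - ({0..l} - orb 0). affine_coeff b 0 k = 0"
      using b(2) by (auto simp: affine_coeff_def)
  next
    fix i C assume "i \<in> {0..l} - orb 0" "P (\<alpha> i) \<noteq> 0" "cartan_multiple i C"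
    moreover from this have "C \<noteq> 0" by (auto simp: cartan_multiple_def)
    ultimately show "\<forall>x\<in>special. reflection (C *\<^sub>R P (\<alpha> i)) x \<in> special"
      using special_reflection by (simp add: reflection_scaleR)
  next
    fix i b assume i: "i \<in> {0..l} - orb 0" "P (\<alpha> i) \<noteq> 0"
      and Q: "\<forall>x\<in>special. reflection (reflection (P (\<alpha> i)) (P b)) x \<in> special"
    let ?s = "reflection (P (\<alpha> i))"
    have s: "?s x \<in> special" if "x \<in> special" for x using special_reflection i that by blast
    show "\<forall>x\<in>special. reflection (P b) x \<in> special"
    proof
      fix x assume "x \<in> special"
      then have "reflection (?s (P b)) (?s x) \<in> special" using Q s by blast
      then have "?s (reflection (P b) x) \<in> special"
        by (simp only: reflection_conjugate [OF orthogonal_transformation_reflection])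
      from s [OF this] show "reflection (P b) x \<in> special" by simp
    qed
  qed (use b in auto)
  show ?thesis
  proof (cases "positive b")
    case True
    then show ?thesis using pos b by blast
  next
    case False
    then have "positive (- b)" using positive_or_negative b(1) by blast
    moreover have "reflection (P (- b)) = reflection (P b)"
      using reflection_scaleR [of "-1" "P b"] by simp
    ultimately show ?thesis using pos [of "- b"] b by simp
  qed
qed

text \<open>On the orbit of 0, the reflection in \<open>P (\<alpha> 0)\<close> is the one in the
  average provided by \<open>special_root\<close>; elsewhere \<open>\<alpha> i\<close> itself has no
  component in that orbit.\<close>

lemma special_alpha:
  assumes i: "i \<in> {0..l}" and nz: "P (\<alpha> i) \<noteq> 0"
  shows "P (\<alpha> i) \<in> special" and "x \<in> special \<Longrightarrow> reflection (P (\<alpha> i)) x \<in> special"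
proof -
  have "P (\<alpha> i) \<in> special \<and> (\<forall>x\<in>special. reflection (P (\<alpha> i)) x \<in> special)"
  proof (cases "i \<in> orb 0")
    case True
    then have eq: "P (\<alpha> i) = P (\<alpha> 0)" using avg_alpha [of 0] by simp
    then obtain b t where b: "b \<in> \<Phi>" "\<forall>s\<in>orb 0. b \<bullet> cw s = 0" "P b \<noteq> 0" "P b = t *\<^sub>R P (\<alpha> 0)"
      using special_root nz by metis
    then have "t \<noteq> 0" by auto
    then have "P (\<alpha> 0) = (1 / t) *\<^sub>R P b" "reflection (P b) = reflection (P (\<alpha> 0))"
      using b(4) reflection_scaleR by auto
    then show ?thesis
      using specialI [of "1 / t" b] b \<open>t \<noteq> 0\<close> special_root_reflection [OF b(1-3)] by (simp add: eq)
  next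
    case False
    have "\<alpha> i \<bullet> cw s = 0" if "s \<in> orb 0" for s
    proof -
      have "i \<noteq> 0" using False self_in_orb [of 0] by metis
      moreover have "s \<in> {0..l}" "i \<noteq> s" using that False orb_subset [of 0] by auto
      ultimately show ?thesis using alpha_cw [OF i, of s] by simp
    qed
    then have "1 *\<^sub>R P (\<alpha> i) \<in> special" using alpha_root [OF i] nz by (intro specialI) auto
    then show ?thesis using special_reflection [OF i False nz] by simp
  qed
  then show "P (\<alpha> i) \<in> special" and "x \<in> special \<Longrightarrow> reflection (P (\<alpha> i)) x \<in> special" by blast+
qed

lemma restricted_root_special:
  assumes b: "b \<in> \<Phi>" "P b \<noteq> 0" shows "P b \<in> special"
proof -
  obtain m where m: "\<forall>i\<in>{0..l}. affine_coeff b m i \<ge> 0" using affine_lift b(1) by blast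
  show ?thesis
  proof (rule restricted_root_induct [of "{0..l}" "\<lambda>x. x \<in> special" b m])
    show "orb i \<subseteq> {0..l}" if "i \<in> {0..l}" for i using orb_subset that .
    show "C *\<^sub>R P (\<alpha> i) \<in> special"
      if "i \<in> {0..l}" "P (\<alpha> i) \<noteq> 0" "cartan_multiple i C" for i C
      using that special_alpha(1) by (intro special_scale) (auto simp: cartan_multiple_def)
    show "P b \<in> special"
      if "i \<in> {0..l}" "P (\<alpha> i) \<noteq> 0" "reflection (P (\<alpha> i)) (P b) \<in> special" for i b
      using special_alpha(2) [OF that] by simp
  qed (use b m in auto)
qed

lemma restricted_coeff_sign:
  assumes "b \<in> \<Phi>" "P b \<noteq> 0"
  shows "(\<forall>k\<in>{0..l} - orb 0. P b \<bullet> orbit_cw k \<ge> 0) \<or> (\<forall>k\<in>{0..l} - orb 0. P b \<bullet> orbit_cw k \<le> 0)"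
proof -
  obtain t a where a: "t \<noteq> 0" "a \<in> \<Phi>" "\<forall>s\<in>orb 0. a \<bullet> cw s = 0" "P b = t *\<^sub>R P a"
    using restricted_root_special [OF assms] by (rule specialE)
  have Pb: "P b \<bullet> orbit_cw k = t * (\<Sum>m\<in>orb k. a \<bullet> cw m)" if "k \<in> {0..l} - orb 0" for k
    using avg_orbit_cw [OF a(3), of k] that a(4) by simp
  have range: "m \<in> {1..l}" if "k \<in> {0..l} - orb 0" "m \<in> orb k" for k m using orb_range that by blast
  have "(\<forall>k\<in>{0..l} - orb 0. (\<Sum>m\<in>orb k. a \<bullet> cw m) \<ge> 0) \<or> (\<forall>k\<in>{0..l} - orb 0. (\<Sum>m\<in>orb k. a \<bullet> cw m) \<le> 0)"
    using root_coeffs [OF a(2)] range by (metis (no_types, lifting) sum_nonneg sum_nonpos)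
  then show ?thesis using Pb a(1) by (cases "t > 0") (auto simp: zero_le_mult_iff mult_le_0_iff)
qed

text \<open>Only simple roots in the orbit of 0 could contribute fractions, and
  \<open>orbit_0_dvd\<close> clears the denominator.\<close>

lemma restricted_coeff_int:
  assumes b: "b \<in> \<Phi>" and k: "k \<in> {0..l}" "k \<notin> orb 0"
  shows "P b \<bullet> orbit_cw k \<in> \<int>"
proof -
  have "P (\<alpha> m) \<bullet> orbit_cw k \<in> \<int>" if m: "m \<in> {1..l}" for m
  proof (cases "m \<in> orb 0")
    case True
    obtain q where "(\<Sum>s\<in>orb k. n s) = int (card (orb 0)) * q" using orbit_0_dvd [OF k(1)] by blast
    moreover have "card (orb 0) > 0" using self_in_orb finite_orb card_gt_0_iff by blast
    moreover have "P (\<alpha> m) = P (\<alpha> 0)" using avg_alpha [of 0] True by simp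
    ultimately have "P (\<alpha> m) \<bullet> orbit_cw k = - of_int q" using avg_alpha_0_orbit_cw [OF k] by simp
    then show ?thesis by simp
  next
    case False
    then show ?thesis using avg_alpha_orbit_cw [of m k] m k by simp
  qed
  moreover have "P b \<bullet> orbit_cw k = (\<Sum>m\<in>{1..l}. (b \<bullet> cw m) * (P (\<alpha> m) \<bullet> orbit_cw k))"
    by (subst expansion [of b]) (simp add: inner_sum_left)
  ultimately show ?thesis using coeff_int [of _ b] b by (auto intro!: Ints_sum Ints_mult)
qed

section \<open>The restricted basis and its coweight lattice\<close>

text \<open>Both claims rest on the duality of \<open>\<beta>\<close> and \<open>\<pi>\<close>:
  pairing with \<open>\<pi> k\<close> gives the coefficients of restricted roots, pairing with
  \<open>\<beta> k\<close> those of coweights.\<close>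

theorem folded_basis:
  fixes S :: "nat \<Rightarrow> nat set"
  assumes S: "bij_betw S {0..r} (orb ` {0..l})" and S0: "0 \<in> S 0"
  defines "\<beta> \<equiv> \<lambda>k. orbit_root \<alpha> (S k)" and "\<pi> \<equiv> \<lambda>k. orbit_coweight \<omega> cw (S k)"
  defines "R \<equiv> restricted_roots \<omega> \<Phi>"
  shows "inj_on \<beta> {1..r}" and "root_basis (fixed_space \<omega>) R (\<beta> ` {1..r})"
    and "group_closure (\<pi> ` {1..r}) = coweight_lattice (fixed_space \<omega>) R"
proof -
  have "\<exists>i. i \<in> {0..l} \<and> S k = orb i" if "k \<in> {0..r}" for k
    using S that unfolding bij_betw_def by blast
  then obtain i where i: "\<And>k. k \<in> {0..r} \<Longrightarrow> i k \<in> {0..l} \<and> S k = orb (i k)" by metis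
  have S0_eq: "S 0 = orb 0" using i [of 0] S0 orb_eq [of 0 "i 0"] by simp
  have inj: "k = m" if "k \<in> {0..r}" "m \<in> {0..r}" "S k = S m" for k m
    using S that unfolding bij_betw_def inj_on_def by blast
  have ik: "i k \<in> {0..l}" "S k = orb (i k)" "i k \<notin> orb 0" if "k \<in> {1..r}" for k
  proof -
    show 1: "i k \<in> {0..l}" "S k = orb (i k)" using i [of k] that by auto
    show "i k \<notin> orb 0"
    proof
      assume "i k \<in> orb 0"
      then have "S k = S 0" using orb_eq 1 S0_eq by simp
      then show False using inj [of k 0] that by simp
    qed
  qed
  have \<beta>: "\<beta> k = P (\<alpha> (i k))" if "k \<in> {1..r}" for k
  proof -
    have "card (orb (i k)) > 0" using self_in_orb finite_orb card_gt_0_iff by blast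
    then show ?thesis using sum_orb [OF ik(1) [OF that]] by (simp add: \<beta>_def orbit_root_def ik(2) [OF that])
  qed
  have \<pi>: "\<pi> k = P (orbit_cw (i k))" if "k \<in> {1..r}" for k
    using ik [OF that] by (simp add: \<pi>_def orbit_coweight_def orbit_cw_def)
  have P_\<pi>: "P x \<bullet> \<pi> k = P x \<bullet> orbit_cw (i k)" if "k \<in> {1..r}" for x k
    unfolding \<pi> [OF that] avg_sym [symmetric] by simp
  have dual\<beta>: "\<beta> k \<bullet> \<pi> m = (if k = m then 1 else 0)" if "k \<in> {1..r}" "m \<in> {1..r}" for k m
  proof -
    have "i k \<in> orb (i m) \<longleftrightarrow> k = m"
    proof
      assume "i k \<in> orb (i m)"
      then have "S k = S m" using orb_eq ik that by simp
      then show "k = m" using inj [of k m] that by simp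
    qed (use self_in_orb in blast)
    then show ?thesis
      using avg_alpha_orbit_cw [OF ik(1,3) [OF that(1)] ik(1,3) [OF that(2)]] P_\<pi> [OF that(2)]
        \<beta> [OF that(1)] by simp
  qed
  show inj\<beta>: "inj_on \<beta> {1..r}"
    by (rule inj_onI) (use dual\<beta> in \<open>metis zero_neq_one\<close>)
  have \<beta>_fixed: "P (\<beta> k) = \<beta> k" "P (\<pi> k) = \<pi> k" if "k \<in> {1..r}" for k using \<beta> \<pi> that by auto
  have comb: "(\<Sum>k\<in>{1..r}. c k *\<^sub>R \<beta> k) \<bullet> \<pi> m = c m" if "m \<in> {1..r}" for c m
  proof -
    have "(\<Sum>k\<in>{1..r}. c k *\<^sub>R \<beta> k) \<bullet> \<pi> m = (\<Sum>k\<in>{1..r}. if k = m then c k else 0)"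
      unfolding inner_sum_left using dual\<beta> that by (intro sum.cong) auto
    then show ?thesis using that by simp
  qed
  have off: "P (\<alpha> m) \<in> span (\<beta> ` {1..r})" if m: "m \<in> {0..l}" "m \<notin> orb 0" for m
  proof -
    obtain k where k: "k \<in> {0..r}" "S k = orb m" using S m(1) unfolding bij_betw_def by (metis image_iff)
    then have "k \<noteq> 0" using S0_eq m(2) self_in_orb by metis
    then have k1: "k \<in> {1..r}" using k by simp
    then have "i k \<in> orb m" using ik(2) k(2) self_in_orb by metis
    then have "\<beta> k = P (\<alpha> m)" using avg_alpha m(1) \<beta> k1 by simp
    then show ?thesis using k1 span_base by (metis imageI)
  qed
  \<comment> \<open>The averaged relation of the marks can be solved for
    \<open>P (\<alpha> 0)\<close>.\<close>
  have on: "P (\<alpha> 0) \<in> span (\<beta> ` {1..r})"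
  proof -
    have "0 = (\<Sum>m\<in>{0..l}. of_int (n m) *\<^sub>R P (\<alpha> m))"
      using arg_cong [OF sum_marks, of P] by simp
    also have "\<dots> = (\<Sum>m\<in>orb 0. of_int (n m) *\<^sub>R P (\<alpha> m)) + (\<Sum>m\<in>{0..l} - orb 0. of_int (n m) *\<^sub>R P (\<alpha> m))"
      using sum.subset_diff [of "orb 0" "{0..l}"] orb_subset [of 0] by (simp add: add.commute)
    also have "(\<Sum>m\<in>orb 0. of_int (n m) *\<^sub>R P (\<alpha> m)) = of_nat (card (orb 0)) *\<^sub>R P (\<alpha> 0)"
      using n_orb_0 avg_alpha [of 0] by (simp add: sum_constant_scaleR del: sum_constant)
    finally have "of_nat (card (orb 0)) *\<^sub>R P (\<alpha> 0) = - (\<Sum>m\<in>{0..l} - orb 0. of_int (n m) *\<^sub>R P (\<alpha> m))"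
      by (simp add: eq_neg_iff_add_eq_0)
    also have "\<dots> \<in> span (\<beta> ` {1..r})" using off by (intro span_neg span_sum span_scale) auto
    finally have "(1 / of_nat (card (orb 0))) *\<^sub>R (of_nat (card (orb 0)) *\<^sub>R P (\<alpha> 0)) \<in> span (\<beta> ` {1..r})"
      by (rule span_scale)
    moreover have "card (orb 0) > 0" using self_in_orb finite_orb card_gt_0_iff by blast
    ultimately show ?thesis by simp
  qed
  have expand: "x = (\<Sum>k\<in>{1..r}. (x \<bullet> \<pi> k) *\<^sub>R \<beta> k)" and in_span: "x \<in> span (\<beta> ` {1..r})"
    if "P x = x" for x
  proof -
    have "P (\<alpha> m) \<in> span (\<beta> ` {1..r})" if "m \<in> {0..l}" for m
      using off on avg_alpha [of 0 m] that by (cases "m \<in> orb 0") auto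
    then have "(\<Sum>m\<in>{1..l}. (x \<bullet> cw m) *\<^sub>R P (\<alpha> m)) \<in> span (\<beta> ` {1..r})"
      by (intro span_sum span_scale) auto
    moreover have "P x = (\<Sum>m\<in>{1..l}. (x \<bullet> cw m) *\<^sub>R P (\<alpha> m))"
      by (subst expansion [of x]) simp
    ultimately show s: "x \<in> span (\<beta> ` {1..r})" using that by simp
    obtain u where "x = (\<Sum>v\<in>\<beta> ` {1..r}. u v *\<^sub>R v)"
      using s span_finite [of "\<beta> ` {1..r}"] by auto
    then have xu: "x = (\<Sum>k\<in>{1..r}. u (\<beta> k) *\<^sub>R \<beta> k)" using inj\<beta> by (simp add: sum.reindex)
    have "x \<bullet> \<pi> k = u (\<beta> k)" if "k \<in> {1..r}" for k
      using comb [OF that, of "\<lambda>k. u (\<beta> k)"] by (simp only: xu [symmetric])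
    then have "(\<Sum>k\<in>{1..r}. (x \<bullet> \<pi> k) *\<^sub>R \<beta> k) = (\<Sum>k\<in>{1..r}. u (\<beta> k) *\<^sub>R \<beta> k)"
      by (intro sum.cong) simp_all
    then show "x = (\<Sum>k\<in>{1..r}. (x \<bullet> \<pi> k) *\<^sub>R \<beta> k)" using xu by (simp only:)
  qed
  have \<beta>_root: "\<beta> k \<in> R" if "k \<in> {1..r}" for k
  proof -
    have "\<beta> k \<noteq> 0" using dual\<beta> [OF that that] by auto
    then show ?thesis
      unfolding R_def using restricted_rootI alpha_root ik(1) \<beta> that by metis
  qed
  have R_int: "x \<bullet> \<pi> k \<in> \<int>" if x: "x \<in> R" and k: "k \<in> {1..r}" for x k
  proof -
    obtain b where "b \<in> \<Phi>" "x = P b" using x unfolding R_def by (rule restricted_rootE)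
    then show ?thesis using restricted_coeff_int ik k P_\<pi> by simp
  qed
  have R_sign: "(\<forall>k\<in>{1..r}. x \<bullet> \<pi> k \<ge> 0) \<or> (\<forall>k\<in>{1..r}. x \<bullet> \<pi> k \<le> 0)" if x: "x \<in> R" for x
  proof -
    obtain b where b: "b \<in> \<Phi>" "x = P b" "P b \<noteq> 0" using x unfolding R_def by (rule restricted_rootE)
    then show ?thesis using restricted_coeff_sign [OF b(1,3)] ik P_\<pi> by auto
  qed
  have R_fixed: "P x = x" if "x \<in> R" for x using that by (auto simp: R_def restricted_roots_def)
  show "root_basis (fixed_space \<omega>) R (\<beta> ` {1..r})"
    unfolding root_basis_def
  proof (intro conjI ballI)
    show "independent (\<beta> ` {1..r})"
    proof (rule independent_if_scalars_zero)
      fix u v assume 0: "(\<Sum>v\<in>\<beta> ` {1..r}. u v *\<^sub>R v) = 0" and "v \<in> \<beta> ` {1..r}"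
      then obtain m where m: "m \<in> {1..r}" "v = \<beta> m" by blast
      have "(\<Sum>k\<in>{1..r}. u (\<beta> k) *\<^sub>R \<beta> k) = 0" using 0 inj\<beta> by (simp add: sum.reindex)
      then show "u v = 0" using comb [OF m(1), of "\<lambda>k. u (\<beta> k)"] m(2) by simp
    qed simp
    show "span (\<beta> ` {1..r}) = fixed_space \<omega>"
    proof
      show "span (\<beta> ` {1..r}) \<subseteq> fixed_space \<omega>"
        using \<beta>_fixed by (intro span_minimal subspace_fixed) (auto simp: fixed_space_iff)
      show "fixed_space \<omega> \<subseteq> span (\<beta> ` {1..r})" using in_span by (auto simp: fixed_space_iff)
    qed
  next
    fix v assume "v \<in> \<beta> ` {1..r}"
    then obtain k where k: "k \<in> {1..r}" "v = \<beta> k" by blast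
    \<comment> \<open>Half of \<open>\<beta> k\<close> would have coefficient 1/2 at
      \<open>\<beta> k\<close>.\<close>
    have "(1/2) *\<^sub>R v \<notin> R"
    proof
      assume "(1/2) *\<^sub>R v \<in> R"
      then have "(1/2 :: real) \<in> \<int>" using R_int [of "(1/2) *\<^sub>R v" k] dual\<beta> [OF k(1) k(1)] k by simp
      then obtain q where "(1/2 :: real) = of_int q" by (elim Ints_cases)
      then have "real_of_int (2 * q) = of_int 1" by simp
      then have "2 * q = 1" by (simp only: of_int_eq_iff)
      then show False by presburger
    qed
    then show "indivisible R v" using \<beta>_root k by (simp add: indivisible_def)
  next
    fix x assume x: "x \<in> R"
    define c where "c v = \<lfloor>x \<bullet> \<pi> (the_inv_into {1..r} \<beta> v)\<rfloor>" for v
    have c: "of_int (c (\<beta> k)) = x \<bullet> \<pi> k" if "k \<in> {1..r}" for k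
      using R_int [OF x that] the_inv_into_f_f [OF inj\<beta> that] by (simp add: c_def)
    have "x = (\<Sum>k\<in>{1..r}. of_int (c (\<beta> k)) *\<^sub>R \<beta> k)"
      using expand [OF R_fixed [OF x]] c by simp
    then have "x = (\<Sum>v\<in>\<beta> ` {1..r}. of_int (c v) *\<^sub>R v)" using inj\<beta> by (simp add: sum.reindex)
    moreover have "(\<forall>v\<in>\<beta> ` {1..r}. c v \<ge> 0) \<or> (\<forall>v\<in>\<beta> ` {1..r}. c v \<le> 0)"
    proof -
      have "c (\<beta> k) \<ge> 0 \<longleftrightarrow> x \<bullet> \<pi> k \<ge> 0" "c (\<beta> k) \<le> 0 \<longleftrightarrow> x \<bullet> \<pi> k \<le> 0" if "k \<in> {1..r}" for k
        unfolding c [OF that, symmetric] by simp_all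
      then show ?thesis using R_sign [OF x] by auto
    qed
    ultimately show "\<exists>c. x = (\<Sum>b\<in>\<beta> ` {1..r}. real_of_int (c b) *\<^sub>R b) \<and>
        ((\<forall>b\<in>\<beta> ` {1..r}. 0 \<le> c b) \<or> (\<forall>b\<in>\<beta> ` {1..r}. c b \<le> 0))" by blast
  qed
  show "group_closure (\<pi> ` {1..r}) = coweight_lattice (fixed_space \<omega>) R"
  proof
    show "group_closure (\<pi> ` {1..r}) \<subseteq> coweight_lattice (fixed_space \<omega>) R"
    proof
      fix y assume "y \<in> group_closure (\<pi> ` {1..r})"
      then have "P y = y \<and> (\<forall>x\<in>R. x \<bullet> y \<in> \<int>)"
      proof induction
        case (base s)
        then show ?case using \<beta>_fixed(2) R_int by auto
      next
        case (diff s t)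
        then show ?case by (auto simp: inner_diff_right)
      qed
      then show "y \<in> coweight_lattice (fixed_space \<omega>) R"
        by (simp add: coweight_lattice_def fixed_space_iff)
    qed
    show "coweight_lattice (fixed_space \<omega>) R \<subseteq> group_closure (\<pi> ` {1..r})"
    proof
      fix y assume "y \<in> coweight_lattice (fixed_space \<omega>) R"
      then have y: "P y = y" "\<And>x. x \<in> R \<Longrightarrow> x \<bullet> y \<in> \<int>"
        by (auto simp: coweight_lattice_def fixed_space_iff)
      \<comment> \<open>The error of the expansion is fixed and orthogonal to every
        \<open>\<beta> k\<close>; expanded in the \<open>\<beta> k\<close>, it is orthogonal to
        itself.\<close>
      define z where "z = y - (\<Sum>k\<in>{1..r}. (\<beta> k \<bullet> y) *\<^sub>R \<pi> k)"
      have "\<beta> m \<bullet> z = 0" if "m \<in> {1..r}" for m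
      proof -
        have "(\<Sum>k\<in>{1..r}. (\<beta> k \<bullet> y) * (\<beta> m \<bullet> \<pi> k)) = (\<Sum>k\<in>{1..r}. if k = m then \<beta> k \<bullet> y else 0)"
          using dual\<beta> that by (intro sum.cong) auto
        then show ?thesis using that by (simp add: z_def inner_diff_right inner_sum_right)
      qed
      moreover have "P z = z" using y(1) \<beta>_fixed(2) by (simp add: z_def)
      then have "z = (\<Sum>k\<in>{1..r}. (z \<bullet> \<pi> k) *\<^sub>R \<beta> k)" by (rule expand)
      then have "z \<bullet> z = (\<Sum>k\<in>{1..r}. (z \<bullet> \<pi> k) *\<^sub>R \<beta> k) \<bullet> z" by (rule arg_cong)
      then have "z \<bullet> z = (\<Sum>k\<in>{1..r}. (z \<bullet> \<pi> k) * (\<beta> k \<bullet> z))"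
        by (simp add: inner_sum_left)
      ultimately have "z \<bullet> z = 0" by simp
      then have y_eq: "y = (\<Sum>k\<in>{1..r}. (\<beta> k \<bullet> y) *\<^sub>R \<pi> k)" by (simp add: z_def)
      have "(\<Sum>k\<in>{1..r}. (\<beta> k \<bullet> y) *\<^sub>R \<pi> k) \<in> group_closure (\<pi> ` {1..r})"
      proof (rule group_closure_sum_mem)
        fix k assume k: "k \<in> {1..r}"
        obtain c where "\<beta> k \<bullet> y = of_int c" using y(2) [OF \<beta>_root [OF k]] by (elim Ints_cases)
        moreover have "\<pi> k \<in> group_closure (\<pi> ` {1..r})" using k by (intro group_closure.base) blast
        ultimately show "(\<beta> k \<bullet> y) *\<^sub>R \<pi> k \<in> group_closure (\<pi> ` {1..r})"
          by (simp only: group_closure_scaleR_int)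
      qed
      then show "y \<in> group_closure (\<pi> ` {1..r})" using y_eq by simp
    qed
  qed
qed

end

section \<open>Application to the elements \<open>omega l \<alpha> j\<close>\<close>

context based_root_system
begin

lemma sigma_props:
  assumes "j \<in> {0..l}" "n j = 1" "i \<in> {0..l}"
  shows "sigma l \<alpha> j i \<in> {0..l}" and "omega l \<alpha> j (\<alpha> i) = \<alpha> (sigma l \<alpha> j i)"
proof -
  have "\<exists>!k. k \<in> {0..l} \<and> omega l \<alpha> j (\<alpha> i) = \<alpha> k"
    using omega_alpha(2) [OF assms] inj_alpha by (metis inj_onD)
  from theI' [OF this] show "sigma l \<alpha> j i \<in> {0..l}" and "omega l \<alpha> j (\<alpha> i) = \<alpha> (sigma l \<alpha> j i)"
    using assms(3) by (simp_all add: sigma_def)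
qed

lemma folded_omega:
  assumes j: "j \<in> {0..l}" "n j = 1"
  shows "folded_root_system \<Phi> \<alpha> cw h n l (omega l \<alpha> j) (sigma l \<alpha> j)"
proof unfold_locales
  show "omega l \<alpha> j \<in> reflection_group (\<alpha> ` {1..l})" by (rule omega_group)
  show "omega l \<alpha> j (\<alpha> i) = \<alpha> (sigma l \<alpha> j i)" if "i \<in> {0..l}" for i
    using sigma_props(2) [OF j that] .
  have "inj_on (sigma l \<alpha> j) {0..l}"
  proof (rule inj_onI)
    fix i k assume ik: "i \<in> {0..l}" "k \<in> {0..l}" "sigma l \<alpha> j i = sigma l \<alpha> j k"
    then have "omega l \<alpha> j (\<alpha> i) = omega l \<alpha> j (\<alpha> k)" using sigma_props(2) [OF j] by metis
    then have "\<alpha> i = \<alpha> k"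
      using orthogonal_transformation_inj [OF reflection_group_orthogonal [OF omega_group [of j]]]
      by (simp add: inj_eq)
    then show "i = k" using inj_alpha ik by (simp add: inj_on_eq_iff)
  qed
  moreover have "sigma l \<alpha> j ` {0..l} \<subseteq> {0..l}" using sigma_props(1) [OF j] by blast
  ultimately have "bij_betw (sigma l \<alpha> j) {0..l} {0..l}"
    by (simp add: bij_betw_def endo_inj_surj)
  then show "sigma l \<alpha> j permutes {0..l}" by (rule bij_imp_permutes) (simp add: sigma_def)
  have "\<alpha> (sigma l \<alpha> j 0) = \<alpha> j"
    using omega_alpha(1) [OF j] sigma_props(2) [OF j, of 0] by simp
  then have "sigma l \<alpha> j 0 = j"
    using inj_alpha sigma_props(1) [OF j, of 0] j by (simp add: inj_on_eq_iff)
  then show "n (sigma l \<alpha> j 0) = 1" using j by simp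
qed

end

theorem theorem4p1:
  fixes \<Phi> :: "'a::euclidean_space set"
    and \<alpha> cw :: "nat \<Rightarrow> 'a"
    and h :: 'a
    and n :: "nat \<Rightarrow> int"
    and l j r :: nat
    and S :: "nat \<Rightarrow> nat set"
    and \<omega> :: "'a \<Rightarrow> 'a"
  assumes "root_system UNIV \<Phi>" and "reduced_roots \<Phi>" and "irreducible_roots \<Phi>"
    and "inj_on \<alpha> {1..l}" and "root_basis UNIV \<Phi> (\<alpha> ` {1..l})"
    and "highest_root \<Phi> (\<alpha> ` {1..l}) h" and "h = (\<Sum>i=1..l. of_int (n i) *\<^sub>R \<alpha> i)"
    and "\<alpha> 0 = - h" and "n 0 = 1"
    and "\<And>i k. i \<in> {1..l} \<Longrightarrow> k \<in> {1..l} \<Longrightarrow> \<alpha> i \<bullet> cw k = (if i = k then 1 else 0)"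
    and "cw 0 = 0"
    and "j \<in> {i \<in> {0..l}. n i = 1}" and "\<omega> = omega l \<alpha> j"
    and "bij_betw S {0..r} (sigma_orbits l \<alpha> j)" and "0 \<in> S 0"
  shows "root_system (fixed_space \<omega>) (restricted_roots \<omega> \<Phi>) \<and>
    inj_on (\<lambda>k. orbit_root \<alpha> (S k)) {1..r} \<and>
    root_basis (fixed_space \<omega>) (restricted_roots \<omega> \<Phi>) ((\<lambda>k. orbit_root \<alpha> (S k)) ` {1..r}) \<and>
    group_closure ((\<lambda>k. orbit_coweight \<omega> cw (S k)) ` {1..r}) =
      coweight_lattice (fixed_space \<omega>) (restricted_roots \<omega> \<Phi>)"
proof -
  interpret based_root_system \<Phi> \<alpha> cw h n l
    by (rule based_root_system.intro) (use assms in auto)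
  interpret folded_root_system \<Phi> \<alpha> cw h n l \<omega> "sigma l \<alpha> j"
    using folded_omega [of j] assms(12,13) by simp
  have "bij_betw S {0..r} (orb ` {0..l})" using assms(14) by (simp add: sigma_orbits_def)
  from restricted_root_system folded_basis [OF this assms(15)] show ?thesis by blast
qed

end
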